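(* Let $\gamma_n=\gamma n^{-\beta}$ with $\gamma>0$ and $\beta\in(1/2,1)$, let $r\in[0,1/2]$ and $\phi(t)=(1+t^2)^{\frac{1-2r}{2}}$. Assume that: (1) there is a Lipschitz continuous function $S:\mathbb{R}^d\to\mathcal{M}_d(\mathbb{R})$ such that $\mathbb{E}[\Delta M_{n+1}\Delta M_{n+1}^T\mid\mathcal{F}_n]=S(\theta_n)$ a.s. for all $n$; (2) $D^2f$ is bounded and Lipschitz, $D^2f(\theta^\star)$ is invertible, $\liminf_{|x|\to+\infty}f(x)^{-r}|\nabla f(x)|>0$ and $\limsup_{|x|\to+\infty}f(x)^{-r}|\nabla f(x)|<+\infty$; (3) a locally bounded deterministic function $\rho_2:\mathbb{R}_+\to\mathbb{R}_+$ exists such that for all $u\ge0$ and all $n\ge0$, $\mathbb{E}\left[|\Delta M_{n+1}|^{6}e^{\phi(u|\Delta M_{n+1}|^2)}\mid\mathcal{F}_n\right]\le\rho_2(u)$ a.s. Then there is a constant $C$ such that $$\forall n\in\mathbb{N}^\star,\qquad\mathbb{E}\left[|\hat\theta_n-\theta^\star|^2\right]\le\frac{\mathrm{Tr}(\Sigma^\star)}{n}+Cn^{-r_\beta},$$ where $\Sigma^\star=\{D^2f(\theta^\star)\}^{-1}S(\theta^\star)\{D^2f(\theta^\star)\}^{-1}$ and $r_\beta=\left(\beta+\frac12\right)\wedge(2-\beta)$.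
   Context: Setting. $f:\mathbb{R}^d\to\mathbb{R}$ is of class $\mathcal{C}^2$, $\lim_{|x|\to+\infty}f(x)=+\infty$, $\{x:\nabla f(x)=0\}=\{\theta^\star\}$ (so $\theta^\star$ is the unique minimizer of $f$), and $f(\theta^\star)=0$. There are a measurable function $\Lambda:\mathbb{R}^d\times\mathbb{R}^{k}\to\mathbb{R}^d$ and an i.i.d. sequence $(Z_n)_{n\ge1}$ of $\mathbb{R}^{k}$-valued random variables such that $\nabla f(\theta)=\mathbb{E}[\Lambda(\theta,Z_1)]$ for all $\theta\in\mathbb{R}^d$. Given $\theta_0\in\mathbb{R}^d$ and positive step sizes $(\gamma_n)_{n\ge1}$, the stochastic gradient sequence is $\theta_{n+1}=\theta_n-\gamma_{n+1}\Lambda(\theta_n,Z_{n+1})$, $n\ge0$. Set $\Delta M_{n+1}=\nabla f(\theta_n)-\Lambda(\theta_n,Z_{n+1})$, so that $\theta_{n+1}=\theta_n-\gamma_{n+1}\nabla f(\theta_n)+\gamma_{n+1}\Delta M_{n+1}$. The filtration is $\mathcal{F}_n=\sigma(\theta_1,\dots,\theta_n)$ ($\mathcal{F}_0$ trivial). The Ruppert-Polyak average is $\hat\theta_n=\frac1n\sum_{k=1}^n\theta_k$. $|\cdot|$ is the Euclidean norm, $D^2f$ the Hessian of $f$, $\mathcal{M}_d(\mathbb{R})$ the set of real $d\times d$ matrices. *)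

theory Defs
  imports "HOL-Probability.Probability"
begin

definition grad :: "(real ^ 'd \<Rightarrow> real) \<Rightarrow> real ^ 'd \<Rightarrow> real ^ 'd" where
  "grad f x = (THE D. GDERIV f x :> D)"

definition hessian :: "(real ^ 'd \<Rightarrow> real) \<Rightarrow> real ^ 'd \<Rightarrow> real ^ 'd ^ 'd" where
  "hessian f x = jacobian (grad f) (at x)"

definition C2 :: "(real ^ 'd \<Rightarrow> real) \<Rightarrow> bool" where
  "C2 f \<longleftrightarrow> (\<forall>x. f differentiable at x) \<and> (\<forall>x. grad f differentiable at x) \<and>
     continuous_on UNIV (hessian f)"

definition iid :: "'w measure \<Rightarrow> (nat \<Rightarrow> 'w \<Rightarrow> 'b::topological_space) \<Rightarrow> nat set \<Rightarrow> bool" where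
  "iid M Z I \<longleftrightarrow> prob_space.indep_vars M (\<lambda>_. borel) Z I \<and>
     (\<forall>m\<in>I. \<forall>n\<in>I. distr M borel (Z m) = distr M borel (Z n))"

primrec sgd ::
  "(nat \<Rightarrow> real) \<Rightarrow> (real ^ 'd \<Rightarrow> real ^ 'k \<Rightarrow> real ^ 'd) \<Rightarrow> (nat \<Rightarrow> 'w \<Rightarrow> real ^ 'k) \<Rightarrow> real ^ 'd
    \<Rightarrow> nat \<Rightarrow> 'w \<Rightarrow> real ^ 'd" where
  "sgd step \<Lambda> Z \<theta>0 0 \<omega> = \<theta>0"
| "sgd step \<Lambda> Z \<theta>0 (Suc n) \<omega> =
     sgd step \<Lambda> Z \<theta>0 n \<omega> - step (Suc n) *\<^sub>R \<Lambda> (sgd step \<Lambda> Z \<theta>0 n \<omega>) (Z (Suc n) \<omega>)"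

text \<open>The sigma-algebra generated by \<open>X 1, \<dots>, X n\<close>; the index \<open>0\<close> is excluded, so that it is
  trivial for \<open>n = 0\<close>.\<close>

definition nat_filt :: "'w measure \<Rightarrow> (nat \<Rightarrow> 'w \<Rightarrow> 'b::topological_space) \<Rightarrow> nat \<Rightarrow> 'w measure" where
  "nat_filt M X n = sigma (space M) {X k -` A \<inter> space M | k A. k \<in> {1..n} \<and> A \<in> sets borel}"

text \<open>\<open>mart_incr f \<Lambda> Z \<theta> n\<close> is the increment \<open>\<Delta>M\<^sub>n\<close>, meaningful for \<open>n \<ge> 1\<close> only.\<close>

definition mart_incr ::
  "(real ^ 'd \<Rightarrow> real) \<Rightarrow> (real ^ 'd \<Rightarrow> real ^ 'k \<Rightarrow> real ^ 'd) \<Rightarrow> (nat \<Rightarrow> 'w \<Rightarrow> real ^ 'k)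
    \<Rightarrow> (nat \<Rightarrow> 'w \<Rightarrow> real ^ 'd) \<Rightarrow> nat \<Rightarrow> 'w \<Rightarrow> real ^ 'd" where
  "mart_incr f \<Lambda> Z \<theta> n \<omega> = grad f (\<theta> (n - 1) \<omega>) - \<Lambda> (\<theta> (n - 1) \<omega>) (Z n \<omega>)"

definition rp_average :: "(nat \<Rightarrow> 'w \<Rightarrow> real ^ 'd) \<Rightarrow> nat \<Rightarrow> 'w \<Rightarrow> real ^ 'd" where
  "rp_average \<theta> n \<omega> = (1 / real n) *\<^sub>R (\<Sum>k=1..n. \<theta> k \<omega>)"

definition outer_prod :: "real ^ 'd \<Rightarrow> real ^ 'd \<Rightarrow> real ^ 'd ^ 'd" where
  "outer_prod x y = (\<chi> i j. x $ i * y $ j)"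

text \<open>Meaningful when all entries of \<open>X\<close> are integrable, as \<open>real_cond_exp\<close> is a
  difference of the \<open>enn2real\<close> values of the two nonnegative parts.\<close>

definition mat_cond_exp ::
  "'w measure \<Rightarrow> 'w measure \<Rightarrow> ('w \<Rightarrow> real ^ 'd ^ 'd) \<Rightarrow> 'w \<Rightarrow> real ^ 'd ^ 'd" where
  "mat_cond_exp M F X \<omega> = (\<chi> i j. real_cond_exp M F (\<lambda>w. X w $ i $ j) \<omega>)"

definition phi :: "real \<Rightarrow> real \<Rightarrow> real" where
  "phi r t = (1 + t\<^sup>2) powr ((1 - 2 * r) / 2)"

end

theory Submission
  imports Defs "HOL-Real_Asymp.Real_Asymp"
begin

text \<open>Write \<open>\<tau>\<^sub>k = \<theta>\<^sub>k - \<theta>star\<close>, let \<open>H\<close> be the Hessian at \<open>\<theta>star\<close>, and let \<open>R\<^sub>k = O(|\<tau>\<^sub>k|\<^sup>2)\<close> be the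
  remainder in \<open>grad f (\<theta>\<^sub>k) = H \<tau>\<^sub>k + R\<^sub>k\<close>. Summing
  \<open>H \<tau>\<^sub>k = \<Delta>M\<^sub>k\<^sub>+\<^sub>1 + (\<tau>\<^sub>k - \<tau>\<^sub>k\<^sub>+\<^sub>1) / \<gamma>\<^sub>k\<^sub>+\<^sub>1 - R\<^sub>k\<close> expresses the average through a martingale, which gives the
  leading term, a telescoping sum treated by Abel summation, and a quadratic remainder. All error terms are
  controlled once \<open>E |\<tau>\<^sub>n|\<^sup>4 = O(\<gamma>\<^sub>n\<^sup>2)\<close>.

  This moment bound comes from the Lyapunov functions \<open>f\<^sup>p\<close>. For \<open>r = 1/2\<close> one has \<open>|grad f|\<^sup>2 \<ge> c f\<close>, hence a
  geometric contraction, with \<open>p = 2\<close>. For \<open>r < 1/2\<close> only \<open>|grad f|\<^sup>2 \<ge> c min f 1\<close> is used, but all polynomial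
  moments of the noise are bounded. As the squared steps are summable, those of \<open>f(\<theta>\<^sub>n)\<close> are bounded too. Then
  \<open>f\<^sup>p \<le> l f\<^sup>p\<^sup>-\<^sup>1 min f 1 + f\<^sup>p\<^sup>+\<^sup>q / l\<^sup>q\<close> with \<open>l = n\<^sup>d\<close>, small \<open>d\<close> and large \<open>q\<close> yields a contraction that is only
  slightly slower; it gives \<open>E f(\<theta>\<^sub>n)\<^sup>4 = O(\<gamma>\<^sub>n\<^sup>2)\<close>, which makes the case \<open>f > 1\<close> negligible for \<open>p = 2\<close>.\<close>

section \<open>Potentials with a nondegenerate minimum\<close>

text \<open>The exponent \<open>min (\<beta> + 1/2) (2 - \<beta>)\<close> comes from two cross terms
  in the square of the summed errors. Martingale against remainder costs n^(1/2) n^(1-\<beta>) =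
  n^(3/2-\<beta>), martingale against telescoping part costs n^\<beta>, and no other error term is
  larger; division by n^2 gives the two exponents. The dichotomy in r has a reason on each side. For
  r = 1/2 the function \<open>phi\<close> is constant, so only six moments of the noise are
  available, but the gradient is strong. For r < 1/2 the drift of a power of f need not be
  proportional to that power far out, but the exponential controls every moment of the noise.
  Conditional statements about the noise are carried as identities and bounds tested against weights
  that are measurable with respect to the past, so that conditional expectations appear only where
  the hypotheses are converted. The Hessian is given merely as the Jacobian of the gradient; its
  symmetry and positivity at the minimum are derived from second-order expansions of f.\<close>

lemma norm_matrix_vector_mult_le:
  fixes A :: "real ^ 'n ^ 'm"
  shows "norm (A *v x) \<le> norm A * norm x"
proof -
  have "norm (A *v x) = L2_set (\<lambda>i. norm ((A *v x) $ i)) UNIV"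
    by (simp add: norm_vec_def)
  also have "\<dots> \<le> L2_set (\<lambda>i. norm (A $ i) * norm x) UNIV"
    by (rule L2_set_mono) (auto simp: matrix_vector_mul_component Cauchy_Schwarz_ineq2)
  also have "\<dots> = norm A * norm x"
    by (simp add: norm_vec_def[of A] L2_set_left_distrib)
  finally show ?thesis .
qed

text \<open>The mean value inequality is applied to \<open>g\<close> minus its linear part at
  \<open>x\<close>, whose derivative is at most \<open>B * norm (y - x)\<close> on the ball. This
  loses the factor 1/2 of the integral form, which is why \<open>K\<close> and not
  \<open>K / 2\<close> appears in the descent inequality.\<close>

lemma first_order_taylor_bound:
  fixes g :: "'a::euclidean_space \<Rightarrow> 'b::euclidean_space"
  assumes "\<And>z. (g has_derivative D z) (at z)"
    and "\<And>z v. norm (D z v - D x v) \<le> B * norm (z - x) * norm v" and "B \<ge> 0"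
  shows "norm (g y - g x - D x (y - x)) \<le> B * (norm (y - x))\<^sup>2"
proof -
  let ?S = "cball x (norm (y - x))"
  have lin: "linear (D x)" using assms(1) has_derivative_linear by blast
  have "norm ((g y - D x y) - (g x - D x x)) \<le> (B * norm (y - x)) * norm (y - x)"
  proof (rule differentiable_bound[where S="?S" and f'="\<lambda>z v. D z v - D x v"])
    fix z assume z: "z \<in> ?S"
    have "((\<lambda>z. D x z) has_derivative D x) (at z)"
      using assms(1) bounded_linear_imp_has_derivative has_derivative_bounded_linear by blast
    then show "((\<lambda>z. g z - D x z) has_derivative (\<lambda>v. D z v - D x v)) (at z within ?S)"
      using has_derivative_diff[OF assms(1)[of z]] has_derivative_at_withinI by blast
    show "onorm (\<lambda>v. D z v - D x v) \<le> B * norm (y - x)"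
    proof (rule onorm_le)
      fix v :: 'a
      have "norm (z - x) \<le> norm (y - x)" using z by (simp add: dist_norm norm_minus_commute)
      then have "B * norm (z - x) * norm v \<le> B * norm (y - x) * norm v"
        using assms(3) by (intro mult_mono) auto
      with assms(2)[of z v] show "norm (D z v - D x v) \<le> B * norm (y - x) * norm v" by linarith
    qed
  qed (auto simp: dist_norm norm_minus_commute)
  then show ?thesis by (simp add: linear_diff[OF lin] algebra_simps power2_eq_square)
qed

text \<open>Ekeland's principle: at a minimiser \<open>y\<close> of \<open>h z + (c/2) |z - x|\<close> the gradient of \<open>h\<close> has norm at
  most \<open>c/2\<close>, so \<open>y\<close> lies in the ball, while \<open>|x - y| \<le> 2 h x / c\<close>.\<close>

lemma linear_growth:
  fixes h :: "'a::euclidean_space \<Rightarrow> real"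
  assumes cont: "continuous_on UNIV h" and nn: "\<And>x. h x \<ge> 0" and c: "c > 0"
    and deriv: "\<And>x. norm (x - a) > R \<Longrightarrow> GDERIV h x :> D x \<and> norm (D x) \<ge> c"
  shows "norm (x - a) \<le> R + 2 * h x / c"
proof -
  define g where "g z = h z + (c/2) * norm (z - x)" for z
  have cg: "continuous_on UNIV g" unfolding g_def using cont by (intro continuous_intros)
  let ?B = "cball x (2 * h x / c)"
  have xB: "x \<in> ?B" using nn[of x] c by simp
  have "\<exists>y\<in>?B. \<forall>z\<in>?B. g y \<le> g z"
    by (rule continuous_attains_inf) (use xB continuous_on_subset[OF cg] in auto)
  then obtain y where y: "y \<in> ?B" "\<And>z. z \<in> ?B \<Longrightarrow> g y \<le> g z" by blast
  \<comment> \<open>Outside the ball the penalty alone exceeds \<open>h x = g x\<close>, so the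
    minimum over the compact ball is a global one.\<close>
  have ymin: "g y \<le> g z" for z
  proof (cases "z \<in> ?B")
    case False
    then have "norm (z - x) > 2 * h x / c" by (simp add: dist_norm norm_minus_commute)
    then have "(c/2) * norm (z - x) > h x" using c by (simp add: field_simps)
    then have "g z > h x" unfolding g_def using nn[of z] by linarith
    moreover have "g y \<le> g x" using y(2)[OF xB] .
    ultimately show ?thesis by (simp add: g_def)
  qed (rule y(2))
  have "norm (y - a) \<le> R"
  proof (rule ccontr)
    assume "\<not> ?thesis"
    then have D: "GDERIV h y :> D y" "norm (D y) \<ge> c" using deriv[of y] by auto
    define u where "u = D y"
    have u0: "u \<noteq> 0" using D c unfolding u_def by auto
    \<comment> \<open>Moving from \<open>y\<close> along \<open>- u\<close>, \<open>h\<close> falls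
      at rate \<open>u \<bullet> u \<ge> c * norm u\<close> while the penalty grows at most at rate
      \<open>c / 2 * norm u\<close>, so \<open>y\<close> could not minimise
      \<open>g\<close>.\<close>
    have "((\<lambda>t. y - t *\<^sub>R u) has_derivative (\<lambda>t. - (t *\<^sub>R u))) (at 0)"
      by (auto intro!: derivative_eq_intros)
    moreover have "(h has_derivative (\<lambda>v. v \<bullet> D y)) (at (y - 0 *\<^sub>R u))"
      using D(1) by (simp add: gderiv_def)
    ultimately have "((\<lambda>t. h (y - t *\<^sub>R u)) has_derivative (\<lambda>t. (- (t *\<^sub>R u)) \<bullet> D y)) (at 0)"
      by (rule has_derivative_compose)
    moreover have "(\<lambda>t. (- (t *\<^sub>R u)) \<bullet> D y) = (*) (- (u \<bullet> u))" by (auto simp: u_def)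
    ultimately have "((\<lambda>t. h (y - t *\<^sub>R u)) has_real_derivative (- (u \<bullet> u))) (at 0)"
      by (simp add: has_field_derivative_def)
    then have d2: "((\<lambda>t. h (y - t *\<^sub>R u) + (c/2) * (t * norm u)) has_real_derivative (- (u \<bullet> u) + (c/2) * norm u)) (at 0)"
      by (auto intro!: derivative_eq_intros)
    have "- (u \<bullet> u) + (c/2) * norm u < 0"
    proof -
      have "c * norm u \<le> norm u * norm u" using D(2) unfolding u_def by (intro mult_right_mono) auto
      moreover have "u \<bullet> u = norm u * norm u" by (simp add: power2_norm_eq_inner[symmetric] power2_eq_square)
      moreover have "c * norm u > 0" using c u0 by simp
      ultimately show ?thesis by linarith
    qed
    from DERIV_neg_dec_right[OF d2 this] obtain d where d: "d > 0"
      "\<And>t. t > 0 \<Longrightarrow> t < d \<Longrightarrow> h (y - (0 + t) *\<^sub>R u) + (c/2) * ((0 + t) * norm u) < h (y - 0 *\<^sub>R u) + (c/2) * (0 * norm u)"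
      by blast
    define t where "t = d/2"
    have t: "t > 0" "t < d" using d(1) unfolding t_def by auto
    have "h (y - t *\<^sub>R u) + (c/2) * (t * norm u) < h y" using d(2)[OF t] by simp
    moreover have "g y \<le> g (y - t *\<^sub>R u)" by (rule ymin)
    moreover have "norm (y - t *\<^sub>R u - x) \<le> norm (y - x) + t * norm u"
      using norm_triangle_ineq4[of "y - x" "t *\<^sub>R u"] t by (simp add: algebra_simps)
    then have "(c/2) * norm (y - t *\<^sub>R u - x) \<le> (c/2) * (norm (y - x) + t * norm u)"
      using c by (intro mult_left_mono) auto
    then have "(c/2) * norm (y - t *\<^sub>R u - x) \<le> (c/2) * norm (y - x) + (c/2) * (t * norm u)"
      by (simp only: distrib_left)
    ultimately show False unfolding g_def by linarith
  qed
  moreover have "norm (x - y) \<le> 2 * h x / c" using y(1) by (simp add: dist_norm)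
  moreover have "norm (x - a) \<le> norm (x - y) + norm (y - a)"
    using norm_triangle_ineq[of "x - y" "y - a"] by simp
  ultimately show ?thesis by linarith
qed

section \<open>Taylor expansions, positivity of the Hessian at the minimum, growth of the
  potential\<close>

locale smooth_potential =
  fixes f :: "real ^ 'd \<Rightarrow> real" and x0 :: "real ^ 'd" and K L :: real
  assumes f_deriv: "\<And>x. GDERIV f x :> grad f x"
    and grad_deriv: "\<And>x. (grad f has_derivative (*v) (hessian f x)) (at x)"
    and K_pos: "K > 0" and hess_le: "\<And>x. norm (hessian f x) \<le> K"
    and L_pos: "L > 0" and hess_lip: "\<And>x y. norm (hessian f x - hessian f y) \<le> L * norm (x - y)"
    and coercive: "filterlim f at_top at_infinity"
    and crit: "\<And>x. grad f x = 0 \<longleftrightarrow> x = x0"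
    and f_x0: "f x0 = 0"
    and hess_inv: "invertible (hessian f x0)"
begin

abbreviation "H \<equiv> hessian f x0"

lemma f_cont: "continuous_on UNIV f"
  using f_deriv by (auto simp: gderiv_def continuous_on_eq_continuous_at intro: has_derivative_continuous)

lemma grad_cont: "continuous_on UNIV (grad f)"
  using grad_deriv by (auto simp: continuous_on_eq_continuous_at intro: has_derivative_continuous)

lemma global_min_imp_x0:
  assumes "\<And>z. f y \<le> f z"
  shows "y = x0"
proof -
  have "(\<lambda>h. h \<bullet> grad f y) = (\<lambda>v. 0)"
    using differential_zero_maxmin[of y UNIV f] f_deriv[of y] assms by (auto simp: gderiv_def)
  then have "grad f y \<bullet> grad f y = 0" by metis
  then show ?thesis using crit by simp
qed

text \<open>The ball of radius \<open>R\<close> contains \<open>x0\<close>, so its minimum is at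
  most \<open>f x0 = 0\<close>, while \<open>f \<ge> 1\<close> outside. The minimum is therefore
  global, and a global minimiser is critical, hence equal to \<open>x0\<close>.\<close>

lemma f_nonneg: "f x \<ge> 0"
proof -
  have "eventually (\<lambda>x. f x \<ge> 1) at_infinity"
    using coercive by (auto simp: filterlim_at_top)
  then obtain b where b: "\<And>x. norm x \<ge> b \<Longrightarrow> f x \<ge> 1" by (auto simp: eventually_at_infinity)
  define R where "R = max b (norm x0)"
  have "\<exists>y\<in>cball 0 R. \<forall>z\<in>cball 0 R. f y \<le> f z"
    by (rule continuous_attains_inf) (auto simp: R_def le_max_iff_disj intro: continuous_on_subset[OF f_cont])
  then obtain y where y: "\<And>z. z \<in> cball 0 R \<Longrightarrow> f y \<le> f z" by blast
  have x0: "f y \<le> 0" using y[of x0] f_x0 by (simp add: R_def)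
  have "f y \<le> f z" for z
  proof (cases "z \<in> cball 0 R")
    case False
    then have "f z \<ge> 1" using b[of z] by (simp add: R_def)
    then show ?thesis using x0 by linarith
  qed (rule y)
  then show ?thesis using global_min_imp_x0[of y] f_x0 by metis
qed

lemma f_pos: "x \<noteq> x0 \<Longrightarrow> f x > 0"
  using global_min_imp_x0[of x] f_nonneg[of x] f_nonneg by fastforce

lemma grad_lip: "norm (grad f x - grad f y) \<le> K * norm (x - y)"
proof (rule differentiable_bound[of UNIV "grad f" "\<lambda>x. (*v) (hessian f x)"])
  show "onorm ((*v) (hessian f x)) \<le> K" for x
  proof (rule onorm_le)
    fix v :: "real^'d"
    show "norm (hessian f x *v v) \<le> K * norm v"
      using norm_matrix_vector_mult_le[of "hessian f x" v] mult_right_mono[OF hess_le[of x], of "norm v"]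
      by simp
  qed
qed (use grad_deriv in auto)

lemma descent: "\<bar>f y - f x - (y - x) \<bullet> grad f x\<bar> \<le> K * (norm (y - x))\<^sup>2"
proof -
  have "norm (v \<bullet> grad f z - v \<bullet> grad f x) \<le> K * norm (z - x) * norm v" for z v
  proof -
    have "norm (v \<bullet> grad f z - v \<bullet> grad f x) \<le> norm v * norm (grad f z - grad f x)"
      by (simp add: Cauchy_Schwarz_ineq2 flip: inner_diff_right)
    also have "\<dots> \<le> norm v * (K * norm (z - x))" using grad_lip by (intro mult_left_mono) auto
    finally show ?thesis by (simp add: mult_ac)
  qed
  from first_order_taylor_bound[OF f_deriv[unfolded gderiv_def] this] K_pos
  show ?thesis by simp
qed

text \<open>The gradient step of length \<open>1 / (2 * K)\<close> minimises the quadratic majorant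
  of \<open>descent\<close>; it lowers \<open>f\<close> by at least the squared gradient over
  \<open>4 * K\<close>, and the value reached is still nonnegative.\<close>

lemma grad_sq_le: "(norm (grad f x))\<^sup>2 \<le> 4 * K * f x"
proof -
  define u where "u = grad f x"
  define y where "y = x - (1 / (2 * K)) *\<^sub>R u"
  have "f y \<le> f x + (y - x) \<bullet> u + K * (norm (y - x))\<^sup>2" using descent[of y x] by (simp add: u_def abs_le_iff)
  moreover have "(y - x) \<bullet> u = - (norm u)\<^sup>2 / (2 * K)"
    by (simp add: y_def power2_norm_eq_inner)
  moreover have "K * (norm (y - x))\<^sup>2 = (norm u)\<^sup>2 / (4 * K)"
    using K_pos by (simp add: y_def power_divide power2_eq_square field_simps)
  ultimately have "0 \<le> f x - (norm u)\<^sup>2 / (2 * K) + (norm u)\<^sup>2 / (4 * K)"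
    using f_nonneg[of y] by linarith
  then show ?thesis using K_pos by (simp add: u_def field_simps)
qed

lemma grad_linearization: "norm (grad f x - H *v (x - x0)) \<le> L * (norm (x - x0))\<^sup>2"
proof -
  have "norm (hessian f z *v v - H *v v) \<le> L * norm (z - x0) * norm v" for z v
  proof -
    have "norm (hessian f z *v v - H *v v) \<le> norm (hessian f z - H) * norm v"
      using norm_matrix_vector_mult_le[of "hessian f z - H" v] by (simp add: matrix_vector_mult_diff_rdistrib)
    then show ?thesis using mult_right_mono[OF hess_lip[of z x0], of "norm v"] by simp
  qed
  from first_order_taylor_bound[OF grad_deriv this] L_pos crit[of x0]
  show ?thesis by simp
qed

lemma f_shift_deriv: "((\<lambda>w. f (a + w)) has_derivative (\<lambda>h. h \<bullet> grad f (a + w))) (at w)"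
proof -
  have "((\<lambda>w. a + w) has_derivative (\<lambda>h. h)) (at w)" by (auto intro!: derivative_eq_intros)
  from has_derivative_compose[OF this f_deriv[of "a + w", unfolded gderiv_def]] show ?thesis by simp
qed

text \<open>Since \<open>f x0 = 0\<close>, the three values of \<open>f\<close> form its mixed
  second difference at \<open>x0\<close>, which is symmetric in \<open>v\<close> and
  \<open>w\<close>; it is compared here with the bilinear form of \<open>H\<close>. Its derivative
  in \<open>w\<close> is a difference of two gradients, each of which is linearised at
  \<open>x0\<close>.\<close>

lemma second_difference:
  "\<bar>f (x0 + v + w) - f (x0 + w) - f (x0 + v) - w \<bullet> (H *v v)\<bar> \<le> 2 * L * (norm v + norm w) ^ 3"
proof -
  have "norm ((f ((x0 + v) + w) - f (x0 + w) - w \<bullet> (H *v v)) - (f ((x0 + v) + 0) - f (x0 + 0) - 0 \<bullet> (H *v v)))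
    \<le> (2 * L * (norm v + norm w)\<^sup>2) * norm (w - 0)"
  proof (rule differentiable_bound[where S="cball 0 (norm w)" and
        f'="\<lambda>z h. h \<bullet> grad f ((x0 + v) + z) - h \<bullet> grad f (x0 + z) - h \<bullet> (H *v v)"])
    fix z :: "real^'d" assume z: "z \<in> cball 0 (norm w)"
    have "((\<lambda>w. f ((x0 + v) + w) - f (x0 + w) - w \<bullet> (H *v v)) has_derivative
      (\<lambda>h. h \<bullet> grad f ((x0 + v) + z) - h \<bullet> grad f (x0 + z) - h \<bullet> (H *v v))) (at z)"
      by (intro derivative_intros f_shift_deriv)
    then show "((\<lambda>w. f ((x0 + v) + w) - f (x0 + w) - w \<bullet> (H *v v)) has_derivative
      (\<lambda>h. h \<bullet> grad f ((x0 + v) + z) - h \<bullet> grad f (x0 + z) - h \<bullet> (H *v v))) (at z within cball 0 (norm w))"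
      by (rule has_derivative_at_withinI)
    show "onorm (\<lambda>h. h \<bullet> grad f ((x0 + v) + z) - h \<bullet> grad f (x0 + z) - h \<bullet> (H *v v))
        \<le> 2 * L * (norm v + norm w)\<^sup>2"
    proof (rule onorm_le)
      fix h :: "real^'d"
      define A where "A = grad f (x0 + v + z) - H *v (v + z)"
      define B where "B = grad f (x0 + z) - H *v z"
      have s: "norm (v + z) \<le> norm v + norm w" "norm z \<le> norm v + norm w"
        using norm_triangle_ineq[of v z] z norm_ge_zero[of v] by (simp_all add: dist_norm, linarith+)
      have "norm A \<le> L * (norm (v + z))\<^sup>2" using grad_linearization[of "x0 + v + z"] by (simp add: A_def add.assoc)
      also have "\<dots> \<le> L * (norm v + norm w)\<^sup>2" using s L_pos by (intro mult_left_mono power_mono) auto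
      finally have A: "norm A \<le> L * (norm v + norm w)\<^sup>2" .
      have "norm B \<le> L * (norm z)\<^sup>2" using grad_linearization[of "x0 + z"] by (simp add: B_def)
      also have "\<dots> \<le> L * (norm v + norm w)\<^sup>2" using s L_pos by (intro mult_left_mono power_mono) auto
      finally have B: "norm B \<le> L * (norm v + norm w)\<^sup>2" .
      have "h \<bullet> grad f ((x0 + v) + z) - h \<bullet> grad f (x0 + z) - h \<bullet> (H *v v) = h \<bullet> (A - B)"
        by (simp add: A_def B_def inner_diff_right inner_add_right matrix_vector_right_distrib algebra_simps)
      moreover have "\<bar>h \<bullet> (A - B)\<bar> \<le> norm h * norm (A - B)" by (rule Cauchy_Schwarz_ineq2)
      moreover have "norm (A - B) \<le> 2 * L * (norm v + norm w)\<^sup>2"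
        using norm_triangle_ineq4[of A B] A B by linarith
      then have "norm h * norm (A - B) \<le> norm h * (2 * L * (norm v + norm w)\<^sup>2)" by (intro mult_left_mono) auto
      ultimately show "norm (h \<bullet> grad f ((x0 + v) + z) - h \<bullet> grad f (x0 + z) - h \<bullet> (H *v v))
          \<le> 2 * L * (norm v + norm w)\<^sup>2 * norm h" by (simp add: mult_ac)
    qed
  qed auto
  also have "\<dots> \<le> (2 * L * (norm v + norm w)\<^sup>2) * (norm v + norm w)"
    using L_pos by (intro mult_left_mono) auto
  finally show ?thesis by (simp add: f_x0 power3_eq_cube power2_eq_square mult_ac)
qed

text \<open>Schwarz's theorem at \<open>x0\<close>. The second difference does not change when
  \<open>v\<close> and \<open>w\<close> are exchanged; after scaling both by \<open>t\<close> the
  antisymmetric part of the form is of order t^2 and the errors are of order t^3, so it vanishes as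
  t tends to 0.\<close>

lemma hess_sym: "w \<bullet> (H *v v) = v \<bullet> (H *v w)"
proof -
  define a where "a = w \<bullet> (H *v v) - v \<bullet> (H *v w)"
  define b where "b = 4 * L * (norm v + norm w) ^ 3"
  have "\<bar>w \<bullet> (H *v v) - v \<bullet> (H *v w)\<bar> \<le> 4 * L * (norm v + norm w) ^ 3" for v w
    using second_difference[of v w] second_difference[of w v]
    by (simp add: add.commute add.left_commute abs_le_iff)
  note * = this
  have **: "\<bar>a\<bar> \<le> t * b" if t: "t > 0" for t
  proof -
    have "\<bar>t\<^sup>2 * a\<bar> \<le> t ^ 3 * b"
      using *[of "t *\<^sub>R w" "t *\<^sub>R v"] t
      by (simp add: a_def b_def matrix_vector_mult_scaleR power2_eq_square power3_eq_cube algebra_simps)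
    then have "t\<^sup>2 * \<bar>a\<bar> \<le> t\<^sup>2 * (t * b)" by (simp add: abs_mult power2_eq_square power3_eq_cube mult_ac)
    then show ?thesis using t by simp
  qed
  have "\<bar>a\<bar> \<le> 0"
  proof (rule ccontr)
    assume n: "\<not> ?thesis"
    have b: "b \<ge> 0" unfolding b_def using L_pos by simp
    \<comment> \<open>This \<open>t\<close> makes \<open>t * b\<close> smaller than half of
      \<open>\<bar>a\<bar>\<close>; the 1 in \<open>b + 1\<close> covers
      \<open>b = 0\<close>.\<close>
    have "\<bar>a\<bar> \<le> (\<bar>a\<bar> / (2 * (b + 1))) * b" using n b by (intro **) auto
    also have "\<dots> < \<bar>a\<bar>"
    proof -
      have "\<bar>a\<bar> * b < \<bar>a\<bar> * (2 * (b + 1))" using n b by (intro mult_strict_left_mono) auto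
      then show ?thesis using b by (simp add: field_simps)
    qed
    finally show False by simp
  qed
  then show ?thesis by (simp add: a_def)
qed

lemma f_quadratic: "\<bar>f (x0 + v) - (v \<bullet> (H *v v)) / 2\<bar> \<le> L * (norm v) ^ 3"
proof -
  have lin: "((*v) H has_derivative (*v) H) (at z within S)" for z S
    using bounded_linear_imp_has_derivative matrix_vector_mul_bounded_linear by blast
  have "norm ((f (x0 + v) - (v \<bullet> (H *v v)) / 2) - (f (x0 + 0) - (0 \<bullet> (H *v 0)) / 2))
    \<le> (L * (norm v)\<^sup>2) * norm (v - 0)"
  proof (rule differentiable_bound[where S="cball 0 (norm v)" and
        f'="\<lambda>z h. h \<bullet> grad f (x0 + z) - (z \<bullet> (H *v h) + h \<bullet> (H *v z)) / 2"])
    fix z :: "real^'d" assume z: "z \<in> cball 0 (norm v)"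
    have "((\<lambda>v. (1/2) * (v \<bullet> (H *v v))) has_derivative
       (\<lambda>h. (1/2) * (z \<bullet> (H *v h) + h \<bullet> (H *v z)))) (at z within cball 0 (norm v))"
      by (intro has_derivative_mult_right has_derivative_inner has_derivative_ident lin)
    then have "((\<lambda>v. (v \<bullet> (H *v v)) / 2) has_derivative
       (\<lambda>h. (z \<bullet> (H *v h) + h \<bullet> (H *v z)) / 2)) (at z within cball 0 (norm v))" by simp
    then show "((\<lambda>v. f (x0 + v) - (v \<bullet> (H *v v)) / 2) has_derivative
       (\<lambda>h. h \<bullet> grad f (x0 + z) - (z \<bullet> (H *v h) + h \<bullet> (H *v z)) / 2)) (at z within cball 0 (norm v))"
      by (intro has_derivative_diff has_derivative_at_withinI[OF f_shift_deriv])
    show "onorm (\<lambda>h. h \<bullet> grad f (x0 + z) - (z \<bullet> (H *v h) + h \<bullet> (H *v z)) / 2) \<le> L * (norm v)\<^sup>2"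
    proof (rule onorm_le)
      fix h :: "real^'d"
      \<comment> \<open>Symmetry of \<open>H\<close> merges the two halves of the derivative of the
        quadratic form, which leaves exactly the linearisation error of the gradient.\<close>
      have "h \<bullet> grad f (x0 + z) - (z \<bullet> (H *v h) + h \<bullet> (H *v z)) / 2 = h \<bullet> (grad f (x0 + z) - H *v z)"
        using hess_sym[of z h] by (simp add: inner_diff_right)
      moreover have "\<bar>h \<bullet> (grad f (x0 + z) - H *v z)\<bar> \<le> norm h * norm (grad f (x0 + z) - H *v z)"
        by (rule Cauchy_Schwarz_ineq2)
      moreover have "norm (grad f (x0 + z) - H *v z) \<le> L * (norm z)\<^sup>2" using grad_linearization[of "x0 + z"] by simp
      moreover have "L * (norm z)\<^sup>2 \<le> L * (norm v)\<^sup>2" using z L_pos by (intro mult_left_mono power_mono) auto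
      ultimately show "norm (h \<bullet> grad f (x0 + z) - (z \<bullet> (H *v h) + h \<bullet> (H *v z)) / 2) \<le> L * (norm v)\<^sup>2 * norm h"
        by (smt (verit) mult.commute mult_left_mono norm_ge_zero real_norm_def)
    qed
  qed auto
  then show ?thesis by (simp add: f_x0 power3_eq_cube power2_eq_square mult_ac)
qed

text \<open>Along a direction of negative curvature the quadratic term beats the cubic error for
  small \<open>t\<close> and would make \<open>f\<close> negative; the \<open>t\<close> chosen below
  achieves \<open>t * b < a\<close>.\<close>

lemma hess_psd: "v \<bullet> (H *v v) \<ge> 0"
proof (rule ccontr)
  assume n: "\<not> ?thesis"
  define a where "a = - (v \<bullet> (H *v v)) / 2"
  have a: "a > 0" using n by (simp add: a_def)
  define b where "b = L * norm v ^ 3"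
  have b: "b \<ge> 0" using L_pos by (simp add: b_def)
  define t where "t = a / (2 * (b + 1))"
  have t: "t > 0" using a b by (simp add: t_def)
  have "\<bar>f (x0 + t *\<^sub>R v) + t\<^sup>2 * a\<bar> \<le> t ^ 3 * b"
    using f_quadratic[of "t *\<^sub>R v"] t
    by (simp add: a_def b_def matrix_vector_mult_scaleR power2_eq_square power3_eq_cube algebra_simps)
  then have "t\<^sup>2 * a \<le> t\<^sup>2 * (t * b)" using f_nonneg[of "x0 + t *\<^sub>R v"]
    by (simp add: power2_eq_square power3_eq_cube mult_ac)
  then have "a \<le> t * b" using t by simp
  also have "\<dots> < a"
  proof -
    have "a * b < a * (2 * (b + 1))" using a b by (intro mult_strict_left_mono) auto
    then show ?thesis using b by (simp add: t_def field_simps)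
  qed
  finally show False by simp
qed

text \<open>The constant is the minimum of the quadratic form over the unit sphere. It is positive
  because a symmetric semidefinite form vanishes only on the kernel of its matrix, and
  \<open>H\<close> is invertible.\<close>

lemma hess_pd: "\<exists>l>0. \<forall>v. v \<bullet> (H *v v) \<ge> l * (norm v)\<^sup>2"
proof -
  have ker: "v = 0" if v: "v \<bullet> (H *v v) = 0" for v
  proof -
    define w where "w = H *v v"
    have "norm (H *v w) \<le> K * norm w"
      using norm_matrix_vector_mult_le[of H w] mult_right_mono[OF hess_le[of x0], of "norm w"] by simp
    then have "w \<bullet> (H *v w) \<le> K * (w \<bullet> w)"
      using Cauchy_Schwarz_ineq2[of w "H *v w"] mult_left_mono[of "norm (H *v w)" "K * norm w" "norm w"]
      by (simp add: power2_norm_eq_inner[symmetric] power2_eq_square mult_ac)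
    then have "(1/K)\<^sup>2 * (w \<bullet> (H *v w)) \<le> (1/K)\<^sup>2 * (K * (w \<bullet> w))" by (intro mult_left_mono) auto
    then have 1: "(1/K)\<^sup>2 * (w \<bullet> (H *v w)) \<le> (1/K) * (w \<bullet> w)" using K_pos by (simp add: power2_eq_square)
    \<comment> \<open>Semidefiniteness at \<open>v - (1/K) w\<close> forces \<open>w = 0\<close>:
      the mixed terms contribute \<open>- 2 * (w \<bullet> w) / K\<close>, the last one at most
      \<open>(w \<bullet> w) / K\<close>.\<close>
    have "0 \<le> (v - (1/K) *\<^sub>R w) \<bullet> (H *v (v - (1/K) *\<^sub>R w))" by (rule hess_psd)
    also have "\<dots> = v \<bullet> (H *v v) - (1/K) * (v \<bullet> (H *v w)) - (1/K) * (w \<bullet> (H *v v)) + (1/K)\<^sup>2 * (w \<bullet> (H *v w))"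
      by (simp add: matrix_vector_mult_diff_distrib matrix_vector_mult_scaleR inner_diff_left
          inner_diff_right power2_eq_square right_diff_distrib)
    also have "\<dots> = - 2 * ((1/K) * (w \<bullet> w)) + (1/K)\<^sup>2 * (w \<bullet> (H *v w))"
      using v hess_sym[of v w] by (simp add: w_def[symmetric])
    finally have "(1/K) * (w \<bullet> w) \<le> 0" using 1 by linarith
    then have "w \<bullet> w \<le> 0" using K_pos by (simp add: divide_le_0_iff)
    then have "w = 0" by (meson inner_gt_zero_iff not_le)
    then show "v = 0" using hess_inv unfolding w_def
      by (metis invertible_def matrix_vector_mul_assoc matrix_vector_mul_lid matrix_vector_mult_0_right)
  qed
  have ne: "sphere (0::real^'d) 1 \<noteq> {}" by simp
  have "continuous_on (sphere 0 1) (\<lambda>v. v \<bullet> (H *v v))"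
    by (intro continuous_intros linear_continuous_on matrix_vector_mul_bounded_linear)
  from continuous_attains_inf[OF compact_sphere ne this]
  obtain u where u: "norm u = 1" "\<And>v. norm v = 1 \<Longrightarrow> u \<bullet> (H *v u) \<le> v \<bullet> (H *v v)" by auto
  define l where "l = u \<bullet> (H *v u)"
  have "l \<noteq> 0" using ker[of u] u(1) l_def by auto
  then have l: "l > 0" using hess_psd[of u] l_def by simp
  have "v \<bullet> (H *v v) \<ge> l * (norm v)\<^sup>2" for v
  proof (cases "v = 0")
    case False
    have "l \<le> (v /\<^sub>R norm v) \<bullet> (H *v (v /\<^sub>R norm v))" unfolding l_def using False by (intro u(2)) simp
    also have "\<dots> = (v \<bullet> (H *v v)) / (norm v)\<^sup>2"
      by (simp add: matrix_vector_mult_scaleR power2_eq_square divide_inverse)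
    finally show ?thesis using False by (simp add: field_simps)
  qed simp
  then show ?thesis using l by blast
qed

lemma f_le: "f x \<le> K * (norm (x - x0))\<^sup>2"
  using descent[of x x0] crit[of x0] f_x0 by simp

lemma local_bounds:
  "\<exists>d>0. \<exists>c>0. \<forall>x. norm (x - x0) \<le> d \<longrightarrow> c * f x \<le> (norm (grad f x))\<^sup>2 \<and> c * (norm (x - x0))\<^sup>2 \<le> f x"
proof -
  obtain l where l: "l > 0" "\<And>v. v \<bullet> (H *v v) \<ge> l * (norm v)\<^sup>2" using hess_pd by blast
  \<comment> \<open>Within this radius the linearisation error is at most a quarter of
    \<open>l * norm v\<close>, and the cubic error of \<open>f\<close> at most half of the
    guaranteed quadratic term.\<close>
  define d where "d = l / (4 * L)"
  define c where "c = min (l\<^sup>2 / (4 * K)) (l / 4)"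
  have pos: "d > 0" "c > 0" using l L_pos K_pos by (auto simp: d_def c_def)
  have "c * f x \<le> (norm (grad f x))\<^sup>2 \<and> c * (norm (x - x0))\<^sup>2 \<le> f x" if x: "norm (x - x0) \<le> d" for x
  proof -
    define v where "v = x - x0"
    have Lv: "L * norm v \<le> l / 4" using x L_pos by (simp add: v_def d_def field_simps)
    have "l * (norm v)\<^sup>2 \<le> norm v * norm (H *v v)" using l(2)[of v] Cauchy_Schwarz_ineq2[of v "H *v v"] by linarith
    then have lv: "l * norm v \<le> norm (H *v v)"
      by (cases "v = 0") (auto simp: power2_eq_square)
    have "norm (H *v v) \<le> norm (grad f x) + L * (norm v)\<^sup>2"
      using grad_linearization[of x] norm_triangle_ineq2[of "H *v v" "grad f x"]
      by (simp add: v_def norm_minus_commute)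
    moreover have "L * (norm v)\<^sup>2 \<le> (l / 4) * norm v"
      using mult_right_mono[OF Lv, of "norm v"] by (simp add: power2_eq_square mult_ac)
    moreover have "l * norm v \<ge> 0" using l by simp
    ultimately have "norm (grad f x) \<ge> (l / 2) * norm v" using lv by (simp add: field_simps)
    then have "(norm (grad f x))\<^sup>2 \<ge> ((l / 2) * norm v)\<^sup>2" using l by (intro power_mono) auto
    then have g: "(norm (grad f x))\<^sup>2 \<ge> l\<^sup>2 / 4 * (norm v)\<^sup>2" by (simp add: power_mult_distrib power_divide)
    have "c * f x \<le> (l\<^sup>2 / (4 * K)) * (K * (norm v)\<^sup>2)"
      using f_le[of x] f_nonneg[of x] K_pos unfolding v_def[symmetric]
      by (intro mult_mono) (auto simp: c_def)
    also have "\<dots> = l\<^sup>2 / 4 * (norm v)\<^sup>2" using K_pos by simp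
    finally have 1: "c * f x \<le> (norm (grad f x))\<^sup>2" using g by linarith
    have "f x \<ge> (v \<bullet> (H *v v)) / 2 - L * norm v ^ 3" using f_quadratic[of v] by (simp add: v_def abs_le_iff)
    moreover have "L * norm v ^ 3 \<le> (l / 4) * (norm v)\<^sup>2"
      using mult_right_mono[OF Lv, of "(norm v)\<^sup>2"] by (simp add: power2_eq_square power3_eq_cube mult_ac)
    moreover have "c * (norm v)\<^sup>2 \<le> l / 4 * (norm v)\<^sup>2" by (intro mult_right_mono) (auto simp: c_def)
    ultimately have 2: "c * (norm v)\<^sup>2 \<le> f x" using l(2)[of v] by (simp add: field_simps)
    show ?thesis using 1 2 by (simp add: v_def)
  qed
  then show ?thesis using pos by blast
qed

text \<open>Near \<open>x0\<close> the Hessian decides. On the remaining compact shell neither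
  \<open>f\<close> nor its gradient vanishes, so both have a common positive lower bound
  \<open>m\<close>, which is compared with upper bounds for \<open>f\<close> and for the
  distance.\<close>

lemma compact_bounds:
  "\<exists>c>0. \<forall>x. norm (x - x0) \<le> R \<longrightarrow> c * f x \<le> (norm (grad f x))\<^sup>2 \<and> c * (norm (x - x0))\<^sup>2 \<le> f x"
proof -
  obtain d c where dc: "d > 0" "c > 0"
    "\<And>x. norm (x - x0) \<le> d \<Longrightarrow> c * f x \<le> (norm (grad f x))\<^sup>2 \<and> c * (norm (x - x0))\<^sup>2 \<le> f x"
    using local_bounds by blast
  define A where "A = cball x0 R - ball x0 d"
  have cA: "compact A" unfolding A_def by (intro compact_diff) auto
  have "\<exists>m>0. \<forall>x\<in>A. m \<le> (norm (grad f x))\<^sup>2 \<and> m \<le> f x"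
  proof (cases "A = {}")
    case False
    have "continuous_on A (\<lambda>x. min ((norm (grad f x))\<^sup>2) (f x))"
      using continuous_on_subset[OF grad_cont] continuous_on_subset[OF f_cont]
      by (intro continuous_intros) auto
    from continuous_attains_inf[OF cA False this]
    obtain y where y: "y \<in> A"
      "\<And>x. x \<in> A \<Longrightarrow> min ((norm (grad f y))\<^sup>2) (f y) \<le> min ((norm (grad f x))\<^sup>2) (f x)" by blast
    have "y \<noteq> x0" using y(1) dc(1) by (auto simp: A_def)
    then have "min ((norm (grad f y))\<^sup>2) (f y) > 0" using f_pos crit[of y] by simp
    then show ?thesis using y(2) by (intro exI[of _ "min ((norm (grad f y))\<^sup>2) (f y)"]) auto
  qed (auto intro: exI[of _ 1])
  then obtain m where m: "m > 0" "\<And>x. x \<in> A \<Longrightarrow> m \<le> (norm (grad f x))\<^sup>2 \<and> m \<le> f x" by blast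
  \<comment> \<open>The 1 in \<open>R\<^sup>2 + 1\<close> keeps the denominators positive.\<close>
  define c' where "c' = min c (min (m / (K * (R\<^sup>2 + 1))) (m / (R\<^sup>2 + 1)))"
  have R1: "R\<^sup>2 + 1 > 0" by (simp add: add_nonneg_pos)
  have c': "c' > 0" using dc m K_pos R1 by (simp add: c'_def)
  have "c' * f x \<le> (norm (grad f x))\<^sup>2 \<and> c' * (norm (x - x0))\<^sup>2 \<le> f x" if x: "norm (x - x0) \<le> R" for x
  proof (cases "norm (x - x0) \<le> d")
    case True
    have "c' * f x \<le> c * f x" "c' * (norm (x - x0))\<^sup>2 \<le> c * (norm (x - x0))\<^sup>2"
      using f_nonneg[of x] by (auto intro!: mult_right_mono simp: c'_def)
    then show ?thesis using dc(3)[OF True] by linarith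
  next
    case False
    then have "x \<in> A" using x by (auto simp: A_def dist_norm norm_minus_commute)
    then have mx: "m \<le> (norm (grad f x))\<^sup>2" "m \<le> f x" using m by auto
    have R2: "(norm (x - x0))\<^sup>2 \<le> R\<^sup>2 + 1" using power_mono[OF x, of 2] by simp
    have "c' * f x \<le> (m / (K * (R\<^sup>2 + 1))) * (K * (R\<^sup>2 + 1))"
    proof (rule mult_mono)
      show "f x \<le> K * (R\<^sup>2 + 1)" using f_le[of x] mult_left_mono[OF R2, of K] K_pos by linarith
    qed (use f_nonneg m K_pos R1 in \<open>auto simp: c'_def\<close>)
    also have "\<dots> = m" using K_pos R1 by simp
    finally have 1: "c' * f x \<le> m" .
    have "c' * (norm (x - x0))\<^sup>2 \<le> (m / (R\<^sup>2 + 1)) * (R\<^sup>2 + 1)"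
      using R2 m R1 by (intro mult_mono) (auto simp: c'_def)
    also have "\<dots> = m" using R1 by simp
    finally show ?thesis using 1 mx by linarith
  qed
  then show ?thesis using c' by blast
qed

text \<open>The hypothesis says that \<open>sqrt f\<close> has a gradient of norm at least
  \<open>c / 2\<close> far out, so \<open>sqrt f\<close> grows at least linearly; the compact
  estimate covers the rest. This serves \<open>r = 1/2\<close>.\<close>

lemma quadratic_growth:
  assumes c: "c > 0" and far: "\<And>x. norm (x - x0) > R \<Longrightarrow> c * sqrt (f x) \<le> norm (grad f x)"
  shows "\<exists>c>0. \<forall>x. c * f x \<le> (norm (grad f x))\<^sup>2" and "\<exists>C>0. \<forall>x. (norm (x - x0))\<^sup>2 \<le> C * f x"
proof -
  define R' where "R' = max R 1"
  obtain c1 where c1: "c1 > 0"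
    "\<And>x. norm (x - x0) \<le> 2 * R' \<Longrightarrow> c1 * f x \<le> (norm (grad f x))\<^sup>2 \<and> c1 * (norm (x - x0))\<^sup>2 \<le> f x"
    using compact_bounds[of "2 * R'"] by blast
  have "min c1 (c\<^sup>2) * f x \<le> (norm (grad f x))\<^sup>2" for x
  proof (cases "norm (x - x0) \<le> R'")
    case True
    then have "norm (x - x0) \<le> 2 * R'" by (simp add: R'_def)
    then have "c1 * f x \<le> (norm (grad f x))\<^sup>2" using c1 by blast
    moreover have "min c1 (c\<^sup>2) * f x \<le> c1 * f x" using f_nonneg by (intro mult_right_mono) auto
    ultimately show ?thesis by linarith
  next
    case False
    then have "(c * sqrt (f x))\<^sup>2 \<le> (norm (grad f x))\<^sup>2" using far[of x] c f_nonneg[of x]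
      by (intro power_mono) (auto simp: R'_def)
    then have "c\<^sup>2 * f x \<le> (norm (grad f x))\<^sup>2" using f_nonneg[of x] by (simp add: power_mult_distrib power_divide)
    moreover have "min c1 (c\<^sup>2) * f x \<le> c\<^sup>2 * f x" using f_nonneg by (intro mult_right_mono) auto
    ultimately show ?thesis by linarith
  qed
  then show "\<exists>c>0. \<forall>x. c * f x \<le> (norm (grad f x))\<^sup>2" using c c1 by (intro exI[of _ "min c1 (c\<^sup>2)"]) auto
  have gr: "norm (x - x0) \<le> R' + 2 * sqrt (f x) / (c / 2)" for x
  proof (rule linear_growth[where D="\<lambda>x. (inverse (sqrt (f x)) / 2) *\<^sub>R grad f x"])
    show "continuous_on UNIV (\<lambda>x. sqrt (f x))" using f_cont by (intro continuous_intros)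
    show "sqrt (f x) \<ge> 0" for x using f_nonneg by simp
    fix x assume x: "norm (x - x0) > R'"
    then have "x \<noteq> x0" by (auto simp: R'_def)
    then have fx: "f x > 0" by (rule f_pos)
    show "GDERIV (\<lambda>x. sqrt (f x)) x :> (inverse (sqrt (f x)) / 2) *\<^sub>R grad f x \<and>
        c / 2 \<le> norm ((inverse (sqrt (f x)) / 2) *\<^sub>R grad f x)"
    proof
      show "GDERIV (\<lambda>x. sqrt (f x)) x :> (inverse (sqrt (f x)) / 2) *\<^sub>R grad f x"
        by (rule GDERIV_DERIV_compose[OF f_deriv DERIV_real_sqrt[OF fx]])
      show "c / 2 \<le> norm ((inverse (sqrt (f x)) / 2) *\<^sub>R grad f x)"
        using far[of x] x fx by (simp add: R'_def field_simps)
    qed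
  qed (use c in simp)
  \<comment> \<open>Beyond \<open>2 * R'\<close> the offset \<open>R'\<close> is at most half of
    \<open>norm (x - x0)\<close>, which turns the slope \<open>4 / c\<close> from linear growth into
    \<open>8 / c\<close>.\<close>
  define C where "C = max (1 / c1) ((8 / c)\<^sup>2)"
  have "(norm (x - x0))\<^sup>2 \<le> C * f x" for x
  proof (cases "norm (x - x0) \<le> 2 * R'")
    case True
    then have "c1 * (norm (x - x0))\<^sup>2 \<le> f x" using c1(2)[OF True] by blast
    then have "(norm (x - x0))\<^sup>2 \<le> (1 / c1) * f x" using c1(1) by (simp add: field_simps)
    also have "\<dots> \<le> C * f x" using f_nonneg by (intro mult_right_mono) (auto simp: C_def)
    finally show ?thesis .
  next
    case False
    then have "norm (x - x0) \<le> (8 / c) * sqrt (f x)" using gr[of x] by simp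
    then have "(norm (x - x0))\<^sup>2 \<le> ((8 / c) * sqrt (f x))\<^sup>2" by (intro power_mono) auto
    also have "\<dots> = (8 / c)\<^sup>2 * f x" using f_nonneg by (simp add: power_mult_distrib power_divide)
    also have "\<dots> \<le> C * f x" using f_nonneg by (intro mult_right_mono) (auto simp: C_def)
    finally show ?thesis .
  qed
  moreover have "C > 0" using c1 by (simp add: C_def less_max_iff_disj)
  ultimately show "\<exists>C>0. \<forall>x. (norm (x - x0))\<^sup>2 \<le> C * f x" by blast
qed

text \<open>Far out only a constant lower bound on the gradient is available, so linear growth
  applies to \<open>f\<close> itself. Hence the fourth power of the distance is controlled by
  \<open>f^2\<close> near the minimum but only by \<open>f^4\<close> far away, and both powers have
  to be estimated later.\<close>

lemma weak_growth:
  assumes c: "c > 0" and far: "\<And>x. norm (x - x0) > R \<Longrightarrow> c \<le> norm (grad f x)"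
  shows "\<exists>c>0. \<forall>x. c * min (f x) 1 \<le> (norm (grad f x))\<^sup>2"
    and "\<exists>C>0. \<forall>x. (norm (x - x0)) ^ 4 \<le> C * ((f x)\<^sup>2 + f x ^ 4)"
proof -
  define R' where "R' = max R 1"
  obtain c1 where c1: "c1 > 0"
    "\<And>x. norm (x - x0) \<le> 2 * R' \<Longrightarrow> c1 * f x \<le> (norm (grad f x))\<^sup>2 \<and> c1 * (norm (x - x0))\<^sup>2 \<le> f x"
    using compact_bounds[of "2 * R'"] by blast
  have "min c1 (c\<^sup>2) * min (f x) 1 \<le> (norm (grad f x))\<^sup>2" for x
  proof (cases "norm (x - x0) \<le> R'")
    case True
    then have "norm (x - x0) \<le> 2 * R'" by (simp add: R'_def)
    then have "c1 * f x \<le> (norm (grad f x))\<^sup>2" using c1 by blast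
    moreover have "min c1 (c\<^sup>2) * min (f x) 1 \<le> c1 * f x" using f_nonneg c1(1) by (intro mult_mono) auto
    ultimately show ?thesis by linarith
  next
    case False
    then have "c\<^sup>2 \<le> (norm (grad f x))\<^sup>2" using far[of x] c
      by (intro power_mono) (auto simp: R'_def)
    moreover have "min c1 (c\<^sup>2) * min (f x) 1 \<le> c\<^sup>2 * 1" using f_nonneg by (intro mult_mono) auto
    ultimately show ?thesis by linarith
  qed
  then show "\<exists>c>0. \<forall>x. c * min (f x) 1 \<le> (norm (grad f x))\<^sup>2"
    using c c1 by (intro exI[of _ "min c1 (c\<^sup>2)"]) auto
  have gr: "norm (x - x0) \<le> R' + 2 * f x / c" for x
    by (rule linear_growth[OF f_cont f_nonneg c]) (use f_deriv far in \<open>auto simp: R'_def\<close>)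
  define C where "C = max ((1 / c1)\<^sup>2) ((4 / c) ^ 4)"
  have C0: "C > 0" using c1 by (simp add: C_def less_max_iff_disj)
  have "(norm (x - x0)) ^ 4 \<le> C * ((f x)\<^sup>2 + f x ^ 4)" for x
  proof (cases "norm (x - x0) \<le> 2 * R'")
    case True
    then have "c1 * (norm (x - x0))\<^sup>2 \<le> f x" using c1(2)[OF True] by blast
    then have "(norm (x - x0))\<^sup>2 \<le> (1 / c1) * f x" using c1(1) by (simp add: field_simps)
    then have "((norm (x - x0))\<^sup>2)\<^sup>2 \<le> ((1 / c1) * f x)\<^sup>2" by (intro power_mono) auto
    also have "\<dots> = (1 / c1)\<^sup>2 * (f x)\<^sup>2" by (simp add: power_mult_distrib power_divide)
    also have "\<dots> \<le> C * ((f x)\<^sup>2 + f x ^ 4)" using C0 by (intro mult_mono) (auto simp: C_def)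
    finally show ?thesis by simp
  next
    case False
    then have "norm (x - x0) \<le> (4 / c) * f x" using gr[of x] by simp
    then have "(norm (x - x0)) ^ 4 \<le> ((4 / c) * f x) ^ 4" by (intro power_mono) auto
    also have "\<dots> = (4 / c) ^ 4 * f x ^ 4" by (simp add: power_mult_distrib power_divide)
    also have "\<dots> \<le> C * ((f x)\<^sup>2 + f x ^ 4)" using f_nonneg C0 by (intro mult_mono) (auto simp: C_def)
    finally show ?thesis .
  qed
  then show "\<exists>C>0. \<forall>x. (norm (x - x0)) ^ 4 \<le> C * ((f x)\<^sup>2 + f x ^ 4)" using C0 by blast
qed

end

section \<open>Power inequalities and recursions\<close>

text \<open>In the binomial expansion each term of degree at least two in \<open>d\<close> is
  bounded by \<open>a ^ (p - 2) * d^2\<close> if \<open>\<bar>d\<bar> \<le> a\<close> and by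
  \<open>\<bar>d\<bar> ^ p\<close> otherwise, and the coefficients sum to at most
  \<open>2 ^ p\<close>. The first-order term is kept exact, because the noise in it has mean
  zero.\<close>

lemma power_add_le_second_order:
  fixes a d :: real
  assumes a: "a \<ge> 0" and p: "p \<ge> 2"
  shows "(a + d) ^ p \<le> a ^ p + real p * a ^ (p - 1) * d + 2 ^ p * (a ^ (p - 2) * d\<^sup>2 + \<bar>d\<bar> ^ p)"
proof -
  obtain m where m: "p = Suc (Suc m)" using p by (metis Suc_diff_le add_2_eq_Suc diff_Suc_Suc le_add_diff_inverse numeral_2_eq_2)
  define E where "E = a ^ (p - 2) * d\<^sup>2 + \<bar>d\<bar> ^ p"
  have E: "E \<ge> 0" using a by (simp add: E_def)
  have term_le: "d ^ (k + 2) * a ^ (p - (k + 2)) \<le> E" if k: "k \<le> m" for k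
  proof (cases "\<bar>d\<bar> \<le> a")
    case True
    have "d ^ (k + 2) * a ^ (p - (k + 2)) \<le> \<bar>d\<bar> ^ (k + 2) * a ^ (m - k)"
      using a m by (intro mult_mono) (auto simp: power_abs[symmetric] simp del: power_Suc)
    also have "\<dots> = (\<bar>d\<bar> ^ k * a ^ (m - k)) * d\<^sup>2" by (simp add: power_add power2_eq_square)
    also have "\<dots> \<le> (a ^ k * a ^ (m - k)) * d\<^sup>2"
      using True a by (intro mult_right_mono power_mono) auto
    also have "\<dots> = a ^ (p - 2) * d\<^sup>2" using k m by (simp add: power_add[symmetric])
    finally show ?thesis by (simp add: E_def add_increasing2)
  next
    case False
    have "d ^ (k + 2) * a ^ (p - (k + 2)) \<le> \<bar>d\<bar> ^ (k + 2) * \<bar>d\<bar> ^ (m - k)"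
    proof (rule mult_mono)
      show "d ^ (k + 2) \<le> \<bar>d\<bar> ^ (k + 2)" by (metis abs_ge_self power_abs)
      show "a ^ (p - (k + 2)) \<le> \<bar>d\<bar> ^ (m - k)" using a m False by (simp add: power_mono del: power_abs)
    qed (use a in auto)
    also have "\<dots> = \<bar>d\<bar> ^ p" using k m by (simp add: power_add[symmetric] del: power_Suc)
    finally show ?thesis using a by (simp add: E_def add_increasing)
  qed
  have "(a + d) ^ p = (d + a) ^ p" by (simp add: add.commute)
  also have "\<dots> = (\<Sum>k\<le>p. real (p choose k) * d ^ k * a ^ (p - k))" by (rule binomial_ring)
  also have "\<dots> = a ^ p + real p * d * a ^ (p - 1)
      + (\<Sum>k\<le>m. real (p choose (k + 2)) * (d ^ (k + 2) * a ^ (p - (k + 2))))"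
    unfolding m by (simp add: sum.atMost_Suc_shift mult.assoc del: sum.atMost_Suc binomial_Suc_Suc power_Suc)
  also have "(\<Sum>k\<le>m. real (p choose (k + 2)) * (d ^ (k + 2) * a ^ (p - (k + 2))))
      \<le> (\<Sum>k\<le>m. real (p choose (k + 2)) * E)"
    by (intro sum_mono mult_left_mono term_le) auto
  also have "\<dots> = real (\<Sum>k\<le>m. p choose (k + 2)) * E" by (simp add: sum_distrib_right)
  also have "\<dots> \<le> real (2 ^ p) * E"
  proof -
    have "(\<Sum>k\<le>m. p choose (k + 2)) \<le> (\<Sum>k\<le>p. p choose k)"
      unfolding m by (subst sum.atMost_Suc_shift, subst sum.atMost_Suc_shift) simp
    then have "(\<Sum>k\<le>m. p choose (k + 2)) \<le> 2 ^ p" by (simp add: choose_row_sum)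
    then show ?thesis using E by (intro mult_right_mono of_nat_mono) auto
  qed
  finally show ?thesis by (simp add: E_def mult_ac)
qed

lemma power_add_le_two_power:
  fixes x y :: real
  assumes "x \<ge> 0" "y \<ge> 0"
  shows "(x + y) ^ p \<le> 2 ^ p * (x ^ p + y ^ p)"
proof -
  have "(x + y) ^ p \<le> (2 * max x y) ^ p" using assms by (intro power_mono) auto
  also have "\<dots> = 2 ^ p * (max x y) ^ p" by (simp add: power_mult_distrib)
  also have "\<dots> \<le> 2 ^ p * (x ^ p + y ^ p)"
    using assms by (intro mult_left_mono) (auto simp: max_def)
  finally show ?thesis .
qed

text \<open>\<open>B\<close> stands for the noisy part of an increment and \<open>M\<close> for the
  step times the size of the noise. If \<open>M \<le> sqrt F\<close> the mixed term dominates and a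
  factor \<open>M^2\<close> can be split off; otherwise \<open>F \<le> M^2\<close> and everything is
  bounded by a power of \<open>M\<close>.\<close>

lemma sq_plus_power_bound:
  fixes F M b B :: real
  assumes F: "F \<ge> 0" and M: "M \<ge> 0" and b: "b \<ge> 0" and p: "p \<ge> 2"
    and B: "0 \<le> B" "B \<le> b / 2 * (sqrt F * M + M\<^sup>2)"
  shows "F ^ (p - 2) * B\<^sup>2 + B ^ p \<le> (b\<^sup>2 + b ^ p) * (F ^ (p - 1) * M\<^sup>2 + M ^ (2 * p))"
proof -
  obtain m where m: "p = m + 2" using p by (metis le_add_diff_inverse2)
  show ?thesis
  proof (cases "M \<le> sqrt F")
    case True
    have "M\<^sup>2 \<le> sqrt F * M" using True M by (simp add: power2_eq_square mult_right_mono)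
    then have "sqrt F * M + M\<^sup>2 \<le> 2 * (sqrt F * M)" by linarith
    then have "b / 2 * (sqrt F * M + M\<^sup>2) \<le> b / 2 * (2 * (sqrt F * M))" using b by (intro mult_left_mono) auto
    then have Bb: "B \<le> b * (sqrt F * M)" using B by simp
    have "B\<^sup>2 \<le> (b * (sqrt F * M))\<^sup>2" using Bb B by (intro power_mono) auto
    also have "\<dots> = b\<^sup>2 * (F * M\<^sup>2)" using F by (simp add: power_mult_distrib)
    finally have "F ^ m * B\<^sup>2 \<le> F ^ m * (b\<^sup>2 * (F * M\<^sup>2))" using F by (intro mult_left_mono) auto
    then have 1: "F ^ (p - 2) * B\<^sup>2 \<le> b\<^sup>2 * (F ^ (p - 1) * M\<^sup>2)" by (simp add: m mult_ac)
    have "B ^ p \<le> (b * (sqrt F * M)) ^ p" using Bb B by (intro power_mono) auto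
    also have "\<dots> = b ^ p * (sqrt F ^ p * (M ^ m * M\<^sup>2))"
      by (simp add: power_mult_distrib m power_add power2_eq_square)
    also have "\<dots> \<le> b ^ p * (sqrt F ^ p * (sqrt F ^ m * M\<^sup>2))"
      using True M b F by (intro mult_left_mono mult_right_mono power_mono) auto
    also have "sqrt F ^ p * (sqrt F ^ m * M\<^sup>2) = (sqrt F ^ (p + m)) * M\<^sup>2" by (simp add: power_add)
    also have "sqrt F ^ (p + m) = F ^ (p - 1)"
    proof -
      have "p + m = 2 * (p - 1)" using m by simp
      then show ?thesis using F by (simp only: power_mult real_sqrt_pow2)
    qed
    finally have 2: "B ^ p \<le> b ^ p * (F ^ (p - 1) * M\<^sup>2)" .
    have "b\<^sup>2 * (F ^ (p - 1) * M\<^sup>2) + b ^ p * (F ^ (p - 1) * M\<^sup>2) + 0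
       \<le> b\<^sup>2 * (F ^ (p - 1) * M\<^sup>2) + b ^ p * (F ^ (p - 1) * M\<^sup>2) + (b\<^sup>2 + b ^ p) * M ^ (2 * p)"
      using b by (intro add_left_mono) simp
    then show ?thesis using 1 2 by (simp add: algebra_simps)
  next
    case False
    then have sM: "sqrt F \<le> M" by simp
    then have FM: "F \<le> M\<^sup>2" using F M by (simp add: real_le_lsqrt sqrt_le_D)
    have "sqrt F * M \<le> M * M" using sM M by (intro mult_right_mono) auto
    then have "b / 2 * (sqrt F * M + M\<^sup>2) \<le> b / 2 * (2 * M\<^sup>2)" using b
      by (intro mult_left_mono) (auto simp: power2_eq_square)
    then have Bb: "B \<le> b * M\<^sup>2" using B by simp
    have "F ^ m * B\<^sup>2 \<le> (M\<^sup>2) ^ m * (b * M\<^sup>2)\<^sup>2"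
      using FM Bb B F by (intro mult_mono power_mono) auto
    also have "\<dots> = b\<^sup>2 * M ^ (2 * p)"
      unfolding m power_mult power_add power_mult_distrib by (simp only: mult_ac)
    finally have 1: "F ^ (p - 2) * B\<^sup>2 \<le> b\<^sup>2 * M ^ (2 * p)" by (simp add: m)
    have "B ^ p \<le> (b * M\<^sup>2) ^ p" using Bb B by (intro power_mono) auto
    also have "\<dots> = b ^ p * M ^ (2 * p)" by (simp add: power_mult_distrib power_mult)
    finally have 2: "B ^ p \<le> b ^ p * M ^ (2 * p)" .
    have "0 \<le> (b\<^sup>2 + b ^ p) * (F ^ (p - 1) * M\<^sup>2)" using b F by simp
    then show ?thesis using 1 2 by (simp add: algebra_simps)
  qed
qed

text \<open>A pathwise inequality in real variables: \<open>F\<close> and \<open>X\<close> are the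
  old and new values of the potential, \<open>g\<close> is the squared gradient, \<open>N\<close>
  the size of the noise and \<open>s\<close> its inner product with the gradient. Part of the drift
  pays for its own second-order effects, and \<open>s\<close> survives only linearly, so that it
  disappears in the mean.\<close>

lemma lyapunov_step:
  fixes K :: real
  assumes K: "K > 0" and p: "p \<ge> 2"
  shows "\<exists>C>0. \<exists>\<gamma>0>0. \<forall>\<gamma> F g s N X. 0 < \<gamma> \<longrightarrow> \<gamma> \<le> \<gamma>0 \<longrightarrow> 0 \<le> F \<longrightarrow> 0 \<le> g \<longrightarrow> 0 \<le> N \<longrightarrow> 0 \<le> X
     \<longrightarrow> g \<le> 4 * K * F \<longrightarrow> \<bar>s\<bar> \<le> sqrt g * N \<longrightarrow> X \<le> F - \<gamma> * g + \<gamma> * s + K * \<gamma>\<^sup>2 * (2 * g + 2 * N\<^sup>2)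
     \<longrightarrow> X ^ p \<le> F ^ p - (\<gamma> / 4) * (F ^ (p - 1) * g) + real p * \<gamma> * (F ^ (p - 1) * s)
        + C * (\<gamma>\<^sup>2 * (F ^ (p - 1) * N\<^sup>2) + \<gamma> ^ (2 * p) * N ^ (2 * p))"
proof -
  define b where "b = 4 * (sqrt K + K)"
  define P :: real where "P = 2 ^ p * (2 + 2 ^ p)"
  define C where "C = P * (b\<^sup>2 + b ^ p) + 2 * K * real p"
  \<comment> \<open>The first bound lets half of the drift \<open>\<gamma> * g\<close> absorb
    \<open>2 * K * \<gamma>^2 * g\<close>; the second keeps the higher-order contribution of the
    drift below \<open>\<gamma> / 4 * F ^ (p - 1) * g\<close>.\<close>
  define \<gamma>0 where "\<gamma>0 = min (1 / (4 * K)) (1 / (4 * (P * K)))"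
  have b: "b > 0" using K by (simp add: b_def add_pos_pos)
  have P: "P > 0" by (simp add: P_def add_pos_pos)
  have "P * (b\<^sup>2 + b ^ p) > 0" using P b by (simp add: add_pos_pos)
  then have C: "C > 0" using K by (simp add: C_def add_pos_nonneg)
  have \<gamma>0: "\<gamma>0 > 0" using K P by (simp add: \<gamma>0_def)
  have main: "X ^ p \<le> F ^ p - (\<gamma> / 4) * (F ^ (p - 1) * g) + real p * \<gamma> * (F ^ (p - 1) * s)
        + C * (\<gamma>\<^sup>2 * (F ^ (p - 1) * N\<^sup>2) + \<gamma> ^ (2 * p) * N ^ (2 * p))"
    if \<gamma>: "0 < \<gamma>" "\<gamma> \<le> \<gamma>0" and F: "0 \<le> F" and g: "0 \<le> g" "g \<le> 4 * K * F" and N: "0 \<le> N" and X: "0 \<le> X"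
      and s: "\<bar>s\<bar> \<le> sqrt g * N" and XF: "X \<le> F - \<gamma> * g + \<gamma> * s + K * \<gamma>\<^sup>2 * (2 * g + 2 * N\<^sup>2)"
    for \<gamma> F g s N X
  proof -
    have \<gamma>K: "4 * K * \<gamma> \<le> 1" and \<gamma>P: "4 * (P * K) * \<gamma> \<le> 1"
      using \<gamma> K P by (auto simp: \<gamma>0_def field_simps)
    define M where "M = \<gamma> * N"
    \<comment> \<open>\<open>x\<close> is the half of the drift that survives, \<open>B\<close> the
      size of the noise terms, and \<open>d\<close> the resulting upper bound for the increment of
      the potential.\<close>
    define x where "x = \<gamma> * g / 2"
    define B where "B = \<gamma> * \<bar>s\<bar> + 2 * K * M\<^sup>2"
    define d where "d = - x + \<gamma> * s + 2 * K * M\<^sup>2"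
    have M: "M \<ge> 0" using \<gamma> N by (simp add: M_def)
    have x0: "x \<ge> 0" using \<gamma> g by (simp add: x_def)
    have B0: "B \<ge> 0" using \<gamma> K by (simp add: B_def)
    have "\<gamma> * (4 * K * \<gamma>) * g \<le> \<gamma> * 1 * g" using \<gamma>K \<gamma> g by (intro mult_right_mono mult_left_mono) auto
    then have "X \<le> F + d" using XF by (simp add: d_def x_def M_def power2_eq_square algebra_simps)
    then have "X ^ p \<le> (F + d) ^ p" using X by (intro power_mono)
    also have "\<dots> \<le> F ^ p + real p * F ^ (p - 1) * d + 2 ^ p * (F ^ (p - 2) * d\<^sup>2 + \<bar>d\<bar> ^ p)"
      by (rule power_add_le_second_order[OF F p])
    finally have step: "X ^ p \<le> F ^ p + real p * F ^ (p - 1) * d + 2 ^ p * (F ^ (p - 2) * d\<^sup>2 + \<bar>d\<bar> ^ p)" .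
    have dle: "\<bar>d\<bar> \<le> x + B"
    proof -
      have "\<bar>\<gamma> * s\<bar> = \<gamma> * \<bar>s\<bar>" using \<gamma> by (simp add: abs_mult)
      moreover have "0 \<le> 2 * K * M\<^sup>2" using K by simp
      ultimately show ?thesis unfolding d_def B_def using x0 by linarith
    qed
    have xF: "x \<le> 2 * K * \<gamma> * F" using mult_left_mono[OF g(2), of "\<gamma> / 2"] \<gamma> by (simp add: x_def mult_ac)
    have "2 * K * \<gamma> * F \<le> 1 * F" using \<gamma>K F by (intro mult_right_mono) auto
    then have xF': "x \<le> F" using xF by simp
    have "sqrt g \<le> 2 * sqrt K * sqrt F"
      using g by (intro real_le_lsqrt) (auto simp: power_mult_distrib F K less_imp_le)
    then have "sqrt g * N \<le> 2 * sqrt K * sqrt F * N" using N by (intro mult_right_mono) auto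
    then have "\<bar>s\<bar> \<le> 2 * sqrt K * sqrt F * N" using s by linarith
    then have "\<gamma> * \<bar>s\<bar> \<le> \<gamma> * (2 * sqrt K * sqrt F * N)" using \<gamma> by (intro mult_left_mono) auto
    then have "B \<le> 2 * sqrt K * (sqrt F * M) + 2 * K * M\<^sup>2" by (simp add: B_def M_def mult_ac)
    also have "\<dots> \<le> b / 2 * (sqrt F * M) + b / 2 * M\<^sup>2"
      using M F K by (intro add_mono mult_right_mono) (auto simp: b_def)
    finally have BB: "B \<le> b / 2 * (sqrt F * M + M\<^sup>2)" by (simp add: distrib_left)
    have Bfin: "F ^ (p - 2) * B\<^sup>2 + B ^ p \<le> (b\<^sup>2 + b ^ p) * (F ^ (p - 1) * M\<^sup>2 + M ^ (2 * p))"
      using sq_plus_power_bound[OF F M _ p B0 BB] b by simp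
    obtain m where m: "p = m + 2" using p by (metis le_add_diff_inverse2)
    have "x * x \<le> (2 * K * \<gamma> * F) * x" using xF x0 by (intro mult_right_mono)
    then have "F ^ m * (x * x) \<le> F ^ m * ((2 * K * \<gamma> * F) * x)" using F by (intro mult_left_mono) auto
    then have x1: "F ^ (p - 2) * x\<^sup>2 \<le> K * \<gamma>\<^sup>2 * (F ^ (p - 1) * g)"
      by (simp add: m x_def power2_eq_square mult_ac)
    have "x ^ m * x\<^sup>2 \<le> F ^ m * x\<^sup>2" using xF' x0 by (intro mult_right_mono power_mono) auto
    then have x2: "x ^ p \<le> K * \<gamma>\<^sup>2 * (F ^ (p - 1) * g)" using x1 by (simp add: m power_add power2_eq_square mult_ac)
    have "d\<^sup>2 \<le> (x + B)\<^sup>2" using dle power_mono[OF dle, of 2] by simp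
    also have "\<dots> \<le> 2 * x\<^sup>2 + 2 * B\<^sup>2" using sum_squares_bound[of x B] by (simp add: power2_sum)
    finally have "F ^ (p - 2) * d\<^sup>2 \<le> F ^ (p - 2) * (2 * x\<^sup>2 + 2 * B\<^sup>2)" using F by (intro mult_left_mono) auto
    then have e1: "F ^ (p - 2) * d\<^sup>2 \<le> 2 * (F ^ (p - 2) * x\<^sup>2) + 2 * (F ^ (p - 2) * B\<^sup>2)" by (simp add: algebra_simps)
    have e2: "\<bar>d\<bar> ^ p \<le> 2 ^ p * (x ^ p + B ^ p)"
      using power_mono[OF dle, of p] power_add_le_two_power[OF x0 B0, of p] by simp
    define Q where "Q = F ^ (p - 2) * B\<^sup>2 + B ^ p"
    define G where "G = K * \<gamma>\<^sup>2 * (F ^ (p - 1) * g)"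
    have Q1: "F ^ (p - 2) * B\<^sup>2 \<le> Q" "B ^ p \<le> Q" using F B0 by (auto simp: Q_def)
    have "F ^ (p - 2) * d\<^sup>2 + \<bar>d\<bar> ^ p \<le> (2 * G + 2 * Q) + 2 ^ p * (G + Q)"
    proof -
      have "2 ^ p * (x ^ p + B ^ p) \<le> 2 ^ p * (G + Q)" using x2 Q1 by (intro mult_left_mono add_mono) (auto simp: G_def)
      then show ?thesis using e1 e2 x1 Q1 unfolding G_def by linarith
    qed
    also have "\<dots> = (2 + 2 ^ p) * (G + Q)" by (simp add: algebra_simps)
    finally have "2 ^ p * (F ^ (p - 2) * d\<^sup>2 + \<bar>d\<bar> ^ p) \<le> 2 ^ p * ((2 + 2 ^ p) * (G + Q))"
      by (intro mult_left_mono) auto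
    then have t1: "2 ^ p * (F ^ (p - 2) * d\<^sup>2 + \<bar>d\<bar> ^ p) \<le> P * G + P * Q" by (simp add: P_def algebra_simps)
    have W: "F ^ (p - 1) * g \<ge> 0" using F g by simp
    have "P * G = (4 * (P * K) * \<gamma>) * (\<gamma> / 4 * (F ^ (p - 1) * g))" by (simp add: G_def power2_eq_square)
    also have "\<dots> \<le> 1 * (\<gamma> / 4 * (F ^ (p - 1) * g))" using \<gamma>P \<gamma> W by (intro mult_right_mono) auto
    finally have t2: "P * G \<le> \<gamma> / 4 * (F ^ (p - 1) * g)" by simp
    have t3: "P * Q \<le> P * ((b\<^sup>2 + b ^ p) * (F ^ (p - 1) * M\<^sup>2 + M ^ (2 * p)))"
      using Bfin P unfolding Q_def by (intro mult_left_mono) auto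
    have t4: "real p * F ^ (p - 1) * d = - (real p * (\<gamma> / 2 * (F ^ (p - 1) * g))) + real p * \<gamma> * (F ^ (p - 1) * s)
        + 2 * K * real p * (F ^ (p - 1) * M\<^sup>2)"
      by (simp add: d_def x_def algebra_simps)
    have t5: "1 * (\<gamma> / 2 * (F ^ (p - 1) * g)) \<le> real p * (\<gamma> / 2 * (F ^ (p - 1) * g))"
      using p W \<gamma> by (intro mult_right_mono) auto
    have t6: "2 * K * real p * (F ^ (p - 1) * M\<^sup>2) \<le> 2 * K * real p * (F ^ (p - 1) * M\<^sup>2 + M ^ (2 * p))"
      using K M by (intro mult_left_mono) auto
    have "C * (F ^ (p - 1) * M\<^sup>2 + M ^ (2 * p)) = P * ((b\<^sup>2 + b ^ p) * (F ^ (p - 1) * M\<^sup>2 + M ^ (2 * p)))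
        + 2 * K * real p * (F ^ (p - 1) * M\<^sup>2 + M ^ (2 * p))"
      by (simp add: C_def algebra_simps)
    then have "X ^ p \<le> F ^ p - \<gamma> / 4 * (F ^ (p - 1) * g) + real p * \<gamma> * (F ^ (p - 1) * s)
        + C * (F ^ (p - 1) * M\<^sup>2 + M ^ (2 * p))"
      using step t1 t2 t3 t4 t5 t6 by (simp add: field_simps)
    then show ?thesis by (simp add: M_def power_mult_distrib mult_ac)
  qed
  show ?thesis
    by (rule exI[of _ C], rule conjI[OF C], rule exI[of _ \<gamma>0], rule conjI[OF \<gamma>0]) (use main in blast)
qed

section \<open>Scalar recursions with polynomially decreasing coefficients\<close>

lemma bounded_of_summable_increments:
  fixes u e :: "nat \<Rightarrow> real"
  assumes e: "summable e" "\<And>n. e n \<ge> 0" and u: "\<And>n. n \<ge> n0 \<Longrightarrow> u (Suc n) \<le> u n + e n"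
  shows "\<exists>B. \<forall>n. u n \<le> B"
proof -
  have tail: "u (n0 + k) \<le> u n0 + (\<Sum>i<n0 + k. e i)" for k
  proof (induction k)
    case 0
    then show ?case using e by (simp add: sum_nonneg)
  next
    case (Suc k)
    then show ?case using u[of "n0 + k"] by simp
  qed
  have "u n \<le> (\<Sum>k\<le>n0. \<bar>u k\<bar>) + suminf e" for n
  proof (cases "n \<le> n0")
    case True
    then have "\<bar>u n\<bar> \<le> (\<Sum>k\<le>n0. \<bar>u k\<bar>)" by (intro member_le_sum) auto
    then show ?thesis using suminf_nonneg[OF e] by linarith
  next
    case False
    then obtain k where k: "n = n0 + k" by (metis le_add_diff_inverse nat_le_linear)
    have "\<bar>u n0\<bar> \<le> (\<Sum>k\<le>n0. \<bar>u k\<bar>)" by (intro member_le_sum) auto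
    moreover have "(\<Sum>i<n0 + k. e i) \<le> suminf e" using e by (intro sum_le_suminf) auto
    ultimately show ?thesis using tail[of k] unfolding k by linarith
  qed
  then show ?thesis by blast
qed

text \<open>The relative loss of n^(-b) in one step is at most b/n; this is what a contraction has
  to outweigh in order to reproduce the rate.\<close>

lemma powr_Suc_ge:
  fixes b :: real
  assumes b: "b \<ge> 0" and n: "n \<ge> 1"
  shows "real (Suc n) powr (- b) \<ge> real n powr (- b) * (1 - b / real n)"
proof -
  have x: "real n > 0" using n by simp
  have "1 - b / real n \<le> 1 + (- b) * ln (1 + 1 / real n)"
    using mult_left_mono[OF ln_add_one_self_le_self[of "1 / real n"] b] x by simp
  also have "\<dots> \<le> exp ((- b) * ln (1 + 1 / real n))" by (rule exp_ge_add_one_self)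
  also have "\<dots> = (1 + 1 / real n) powr (- b)" using x by (simp add: powr_def add_pos_pos[THEN less_imp_neq, symmetric])
  finally have "real n powr (- b) * (1 - b / real n) \<le> real n powr (- b) * (1 + 1 / real n) powr (- b)"
    by (intro mult_left_mono) auto
  also have "\<dots> = (real n * (1 + 1 / real n)) powr (- b)" using x by (simp add: powr_mult)
  also have "real n * (1 + 1 / real n) = real (Suc n)" using x by (simp add: field_simps)
  finally show ?thesis .
qed

text \<open>Induction on the claimed bound. Since \<open>a < 1\<close>, the relative loss b/n of
  n^(-b) is eventually below half of the contraction c n^(-a); this half pays for the loss and the
  other half for the source. With \<open>b = 0\<close> the conclusion is mere boundedness.\<close>

lemma contraction_rate:
  fixes u :: "nat \<Rightarrow> real" and a b c C :: real
  assumes a: "0 < a" "a < 1" and b: "b \<ge> 0" and c: "c > 0" and C: "C \<ge> 0"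
    and u: "\<And>n. n \<ge> n0 \<Longrightarrow> u (Suc n) \<le> (1 - c * real (Suc n) powr (- a)) * u n + C * real (Suc n) powr (- a - b)"
  shows "\<exists>B\<ge>0. \<forall>n. u n \<le> B * real (Suc n) powr (- b)"
proof -
  have "(\<lambda>n. real n powr (- a)) \<longlonglongrightarrow> 0" using a by real_asymp
  then have "eventually (\<lambda>n. real n powr (- a) < 1 / c) sequentially"
    using c by (intro order_tendstoD) auto
  moreover have "(\<lambda>n. real n powr (a - 1)) \<longlonglongrightarrow> 0" using a by real_asymp
  then have "eventually (\<lambda>n. real n powr (a - 1) < c / (2 * (b + 1))) sequentially"
    using c b by (intro order_tendstoD) auto
  ultimately have "eventually (\<lambda>n. real n powr (- a) < 1 / c \<and> real n powr (a - 1) < c / (2 * (b + 1))) sequentially"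
    by eventually_elim auto
  then obtain N0 where N0: "\<And>n. n \<ge> N0 \<Longrightarrow> real n powr (- a) < 1 / c \<and> real n powr (a - 1) < c / (2 * (b + 1))"
    by (auto simp: eventually_sequentially)
  define N where "N = max N0 n0"
  \<comment> \<open>The first entry gives \<open>C \<le> B * c / 2\<close>, the second makes the
    bound hold for all indices up to \<open>N\<close>.\<close>
  define B where "B = max (2 * C / c) (\<Sum>k\<le>N. \<bar>u k\<bar> * real (Suc k) powr b)"
  have B0: "B \<ge> 0" using C c by (simp add: B_def le_max_iff_disj)
  have small: "u k \<le> B * real (Suc k) powr (- b)" if "k \<le> N" for k
  proof -
    have "\<bar>u k\<bar> * real (Suc k) powr b \<le> (\<Sum>k\<le>N. \<bar>u k\<bar> * real (Suc k) powr b)"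
      using that by (intro member_le_sum) auto
    then have "\<bar>u k\<bar> * real (Suc k) powr b \<le> B" by (simp add: B_def)
    then have "\<bar>u k\<bar> * real (Suc k) powr b * real (Suc k) powr (- b) \<le> B * real (Suc k) powr (- b)"
      by (intro mult_right_mono) auto
    then show ?thesis by (simp add: powr_minus mult.assoc)
  qed
  have tail: "u (N + k) \<le> B * real (Suc (N + k)) powr (- b)" for k
  proof (induction k)
    case 0
    then show ?case using small[of N] by simp
  next
    case (Suc k)
    define m where "m = Suc (N + k)"
    define s where "s = real m powr (- a)"
    have m1: "m \<ge> 1" and mN: "m \<ge> N0" "N + k \<ge> n0" by (auto simp: m_def N_def)
    have s: "s > 0" using m1 by (simp add: s_def)
    have cs: "c * s \<le> 1" using N0[OF mN(1)] c by (simp add: s_def field_simps)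
    have "1 / real m = s * real m powr (a - 1)"
      using m1 by (simp add: s_def powr_add[symmetric] powr_minus_divide powr_diff)
    also have "\<dots> \<le> s * (c / (2 * (b + 1)))" using N0[OF mN(1)] s by (intro mult_left_mono) auto
    finally have "b * (1 / real m) \<le> b * (s * (c / (2 * (b + 1))))" using b by (intro mult_left_mono)
    also have "\<dots> \<le> c * s / 2"
    proof -
      have "b / (b + 1) \<le> 1" using b by simp
      then have "(c * s / 2) * (b / (b + 1)) \<le> (c * s / 2) * 1" using c s by (intro mult_left_mono) auto
      moreover have "b * (s * (c / (2 * (b + 1)))) = (c * s / 2) * (b / (b + 1))" using b by (simp add: field_simps)
      ultimately show ?thesis by (simp only: mult_1_right)
    qed
    finally have bm: "b / real m \<le> c * s / 2" by simp
    have CB: "C \<le> B * c / 2" using c by (simp add: B_def field_simps max_def)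
    have "u (N + Suc k) \<le> (1 - c * s) * u (N + k) + C * (s * real m powr (- b))"
      using u[OF mN(2)] by (simp add: m_def s_def powr_diff powr_minus divide_inverse powr_add)
    also have "\<dots> \<le> (1 - c * s) * (B * real m powr (- b)) + (B * c / 2) * (s * real m powr (- b))"
      using Suc cs CB s by (intro add_mono mult_left_mono mult_right_mono) (auto simp: m_def)
    also have "\<dots> = B * (real m powr (- b) * (1 - c * s / 2))" by (simp add: algebra_simps)
    also have "\<dots> \<le> B * (real m powr (- b) * (1 - b / real m))"
      using B0 bm by (intro mult_left_mono) auto
    also have "\<dots> \<le> B * real (Suc m) powr (- b)"
      using powr_Suc_ge[OF b m1] B0 by (intro mult_left_mono) auto
    finally show ?case by (simp add: m_def)
  qed
  have "u n \<le> B * real (Suc n) powr (- b)" for n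
  proof (cases "n \<le> N")
    case False
    then have "n = N + (n - N)" by simp
    then show ?thesis using tail[of "n - N"] by metis
  qed (rule small)
  then show ?thesis using B0 by blast
qed

lemma sum_powr_le:
  fixes s :: real
  assumes s: "0 \<le> s" "s < 1"
  shows "(\<Sum>k=1..n. real k powr (- s)) \<le> real n powr (1 - s) / (1 - s)"
proof (induction n)
  case (Suc n)
  define x where "x = real (Suc n)"
  have x: "x > 0" by (simp add: x_def)
  have step: "(1 - s) * x powr (- s) \<le> x powr (1 - s) - real n powr (1 - s)"
  proof (cases "n = 0")
    case True
    then show ?thesis using s by (simp add: x_def)
  next
    case False
    then have n: "real n > 0" by simp
    define w where "w = real n / x"
    have w: "w > 0" using n x by (simp add: w_def)
    \<comment> \<open>The weighted arithmetic-geometric mean inequality, that is, the tangent at 1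
      of the concave function w^(1-s); it replaces a comparison with an integral.\<close>
    have "w powr (1 - s) * 1 powr s \<le> (1 - s) * w + s * 1"
      using s w by (intro Youngs_inequality_0) auto
    then have "w powr (1 - s) \<le> 1 - (1 - s) * (1 - w)" by (simp add: algebra_simps)
    then have "x powr (1 - s) * w powr (1 - s) \<le> x powr (1 - s) * (1 - (1 - s) * (1 - w))"
      by (intro mult_left_mono) auto
    moreover have "x powr (1 - s) * w powr (1 - s) = real n powr (1 - s)"
      using x n by (simp add: w_def powr_mult[symmetric])
    moreover have "x powr (1 - s) * (1 - w) = x powr (- s)"
    proof -
      have "1 - w = 1 / x" using x by (simp add: w_def x_def field_simps)
      then show ?thesis using x by (simp add: powr_diff powr_minus_divide)
    qed
    moreover have "x powr (1 - s) * (1 - (1 - s) * (1 - w)) = x powr (1 - s) - (1 - s) * (x powr (1 - s) * (1 - w))"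
      by (simp add: algebra_simps)
    ultimately show ?thesis by simp
  qed
  then have "x powr (- s) \<le> (x powr (1 - s) - real n powr (1 - s)) / (1 - s)"
    using s by (simp add: field_simps)
  then show ?case using Suc by (simp add: x_def[symmetric] diff_divide_distrib del: of_nat_Suc)
qed simp

section \<open>Moments of the potential along the noisy descent\<close>

text \<open>A weighted Young inequality, split at \<open>g = e * F\<close>. With \<open>g\<close>
  the step size it trades the step times \<open>F ^ (p - 1)\<close> for a small multiple of
  \<open>F ^ p\<close> and a multiple of the \<open>p\<close>-th power of the step.\<close>

lemma young_power:
  fixes e F g :: real
  assumes e: "e > 0" and F: "F \<ge> 0" and g: "g \<ge> 0" and p: "p \<ge> 1"
  shows "g * F ^ (p - 1) \<le> e * F ^ p + (1 / e) ^ (p - 1) * g ^ p"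
proof -
  obtain m where m: "p = Suc m" using p by (metis Suc_le_D One_nat_def)
  show ?thesis
  proof (cases "g \<le> e * F")
    case True
    then have "g * F ^ m \<le> (e * F) * F ^ m" using F by (intro mult_right_mono) auto
    then show ?thesis using e g by (simp add: m mult.assoc add_increasing2)
  next
    case False
    then have "F \<le> g / e" using e by (simp add: field_simps)
    then have "g * F ^ m \<le> g * (g / e) ^ m" using F g by (intro mult_left_mono power_mono) auto
    also have "\<dots> = (1 / e) ^ m * g ^ p" by (simp add: m power_divide)
    finally show ?thesis using e F by (simp add: m add_increasing)
  qed
qed

lemma power_le_one_plus_power:
  fixes x :: real
  assumes "x \<ge> 0" "q \<le> p"
  shows "x ^ q \<le> 1 + x ^ p"
proof (cases "x \<le> 1")
  case True
  then have "x ^ q \<le> 1" using assms by (intro power_le_one) auto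
  then show ?thesis using assms by (simp add: add_increasing2)
next
  case False
  then have "x ^ q \<le> x ^ p" using assms by (intro power_increasing) auto
  then show ?thesis by simp
qed

lemma integrable_dominated:
  fixes h :: "'a \<Rightarrow> 'b::{banach, second_countable_topology}"
  assumes "integrable M g" "h \<in> borel_measurable M" "\<And>x. norm (h x) \<le> g x"
  shows "integrable M h"
  using assms(1,2) proof (rule Bochner_Integration.integrable_bound)
  show "AE x in M. norm (h x) \<le> norm (g x)"
    using assms(3) by (intro AE_I2) (metis abs_ge_self order_trans real_norm_def)
qed

lemma borel_measurable_vec_nth [measurable (raw)]:
  fixes h :: "'a \<Rightarrow> real ^ 'n"
  assumes "h \<in> borel_measurable M"
  shows "(\<lambda>x. h x $ i) \<in> borel_measurable M"
  using measurable_compose[OF assms borel_measurable_continuous_onI[OF continuous_on_component[OF continuous_on_id]]] .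

lemma mult_le_sum_squares:
  fixes x y :: real
  assumes "x \<ge> 0" "y \<ge> 0"
  shows "x * y \<le> x\<^sup>2 + y\<^sup>2"
  using sum_squares_bound[of x y] mult_nonneg_nonneg[OF assms] by (simp add: mult.assoc)

text \<open>\<open>D_mean\<close> is the martingale property of the noise in weak form: each
  component has zero correlation with every \<open>Fl n\<close>-measurable weight for which the
  product is integrable.\<close>

locale noisy_descent = prob_space M + smooth_potential f x0 K L
  for M :: "'w measure" and f :: "real ^ 'd \<Rightarrow> real" and x0 K L +
  fixes \<theta> D :: "nat \<Rightarrow> 'w \<Rightarrow> real ^ 'd" and Fl :: "nat \<Rightarrow> 'w measure" and \<gamma> \<beta> :: real
  assumes \<gamma>_pos: "\<gamma> > 0" and \<beta>_bounds: "1/2 < \<beta>" "\<beta> < 1"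
    and Fl_sub: "\<And>n. subalgebra M (Fl n)"
    and Fl_mono: "\<And>m n. m \<le> n \<Longrightarrow> subalgebra (Fl n) (Fl m)"
    and \<theta>_adapted: "\<And>n. \<theta> n \<in> borel_measurable (Fl n)"
    and D_adapted: "\<And>n. D (Suc n) \<in> borel_measurable (Fl (Suc n))"
    and \<theta>_0: "\<And>w w'. \<theta> 0 w = \<theta> 0 w'"
    and \<theta>_step: "\<And>n w. \<theta> (Suc n) w = \<theta> n w - (\<gamma> * real (Suc n) powr (- \<beta>)) *\<^sub>R (grad f (\<theta> n w) - D (Suc n) w)"
    and D_mean: "\<And>n U i. U \<in> borel_measurable (Fl n) \<Longrightarrow> integrable M (\<lambda>w. U w * D (Suc n) w $ i)
      \<Longrightarrow> (\<integral>w. U w * D (Suc n) w $ i \<partial>M) = 0"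
begin

text \<open>\<open>gam n\<close> is the step that leads from \<open>\<theta> n\<close> to
  \<open>\<theta> (Suc n)\<close>, hence the one with index \<open>n + 1\<close>.\<close>

definition gam :: "nat \<Rightarrow> real" where "gam n = \<gamma> * real (Suc n) powr (- \<beta>)"

text \<open>A uniform bound on the conditional \<open>p\<close>-th moments of the noise given the
  past, encoded by nonnegative integrable weights \<open>U\<close> from the past. This is the form
  in which products of powers of the potential with powers of the noise occur.\<close>

definition bounded_moment :: "nat \<Rightarrow> bool" where
  "bounded_moment p \<longleftrightarrow> (\<exists>C>0. \<forall>n U. U \<in> borel_measurable (Fl n) \<longrightarrow> (\<forall>w. U w \<ge> 0) \<longrightarrow> integrable M U \<longrightarrow>
     integrable M (\<lambda>w. U w * norm (D (Suc n) w) ^ p) \<and>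
     (\<integral>w. U w * norm (D (Suc n) w) ^ p \<partial>M) \<le> C * (\<integral>w. U w \<partial>M))"

abbreviation V :: "nat \<Rightarrow> 'w \<Rightarrow> real" where "V n w \<equiv> f (\<theta> n w)"
abbreviation Gr :: "nat \<Rightarrow> 'w \<Rightarrow> real" where "Gr n w \<equiv> (norm (grad f (\<theta> n w)))\<^sup>2"

abbreviation EV :: "nat \<Rightarrow> nat \<Rightarrow> real" where "EV n p \<equiv> (\<integral>w. V n w ^ p \<partial>M)"
abbreviation EG :: "nat \<Rightarrow> nat \<Rightarrow> real" where "EG n p \<equiv> (\<integral>w. V n w ^ (p - 1) * Gr n w \<partial>M)"
text \<open>The drift that remains when the squared gradient only dominates \<open>min f 1\<close>:
  where \<open>f > 1\<close> its integrand is one power of \<open>f\<close> weaker than that of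
  \<open>EV\<close>.\<close>

abbreviation ET :: "nat \<Rightarrow> nat \<Rightarrow> real" where "ET n p \<equiv> (\<integral>w. V n w ^ (p - 1) * min (V n w) 1 \<partial>M)"

lemma gam_pos: "gam n > 0" using \<gamma>_pos by (simp add: gam_def)

lemma gam_le: "gam n \<le> \<gamma>"
proof -
  have "real (Suc n) powr (- \<beta>) \<le> real (Suc n) powr 0" using \<beta>_bounds by (intro powr_mono) auto
  then show ?thesis using \<gamma>_pos by (simp add: gam_def)
qed

lemma gam_power: "gam n ^ k = \<gamma> ^ k * real (Suc n) powr (- (real k * \<beta>))"
  by (simp add: gam_def power_mult_distrib powr_power mult.commute)

lemma gam_tendsto: "gam \<longlonglongrightarrow> 0"
  unfolding gam_def using \<beta>_bounds by real_asymp

lemma gam_eventually_le: "e > 0 \<Longrightarrow> \<exists>n0. \<forall>n\<ge>n0. gam n \<le> e"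
  using order_tendstoD(2)[OF gam_tendsto, of e] unfolding eventually_sequentially by (meson less_imp_le)

lemma f_borel: "f \<in> borel_measurable borel"
  using f_cont by (rule borel_measurable_continuous_onI)

lemma grad_borel: "grad f \<in> borel_measurable borel"
  using grad_cont by (rule borel_measurable_continuous_onI)

lemma \<theta>_meas [measurable]: "\<theta> n \<in> borel_measurable M"
  using measurable_from_subalg[OF Fl_sub \<theta>_adapted] .

lemma D_meas [measurable]: "D (Suc n) \<in> borel_measurable M"
  using measurable_from_subalg[OF Fl_sub D_adapted] .

lemma V_adapted: "V n \<in> borel_measurable (Fl n)"
  using measurable_compose[OF \<theta>_adapted f_borel] .

lemma V_meas [measurable]: "V n \<in> borel_measurable M"
  using measurable_compose[OF \<theta>_meas f_borel] .

lemma grad_\<theta>_adapted: "(\<lambda>w. grad f (\<theta> n w)) \<in> borel_measurable (Fl n)"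
  using measurable_compose[OF \<theta>_adapted grad_borel] .

lemma grad_\<theta>_meas [measurable]: "(\<lambda>w. grad f (\<theta> n w)) \<in> borel_measurable M"
  using measurable_compose[OF \<theta>_meas grad_borel] .

lemma bounded_moment_mono:
  assumes "bounded_moment q" "p \<le> q"
  shows "bounded_moment p"
proof -
  obtain C where C: "C > 0" "\<And>n U. U \<in> borel_measurable (Fl n) \<Longrightarrow> (\<And>w. U w \<ge> 0) \<Longrightarrow> integrable M U \<Longrightarrow>
     integrable M (\<lambda>w. U w * norm (D (Suc n) w) ^ q) \<and>
     (\<integral>w. U w * norm (D (Suc n) w) ^ q \<partial>M) \<le> C * (\<integral>w. U w \<partial>M)"
    using assms(1) unfolding bounded_moment_def by blast
  have "integrable M (\<lambda>w. U w * norm (D (Suc n) w) ^ p) \<and>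
     (\<integral>w. U w * norm (D (Suc n) w) ^ p \<partial>M) \<le> (C + 1) * (\<integral>w. U w \<partial>M)"
    if U: "U \<in> borel_measurable (Fl n)" "\<And>w. U w \<ge> 0" "integrable M U" for n U
  proof
    note q = C(2)[OF U]
    have le: "U w * norm (D (Suc n) w) ^ p \<le> U w + U w * norm (D (Suc n) w) ^ q" for w
      using mult_left_mono[OF power_le_one_plus_power[of "norm (D (Suc n) w)" p q] U(2)[of w]] assms(2)
      by (simp add: distrib_left)
    have [measurable]: "U \<in> borel_measurable M" using U(3) by simp
    show i: "integrable M (\<lambda>w. U w * norm (D (Suc n) w) ^ p)"
      by (rule integrable_dominated[where g="\<lambda>w. U w + U w * norm (D (Suc n) w) ^ q"])
         (use q U le in \<open>auto simp: abs_mult\<close>)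
    have "(\<integral>w. U w * norm (D (Suc n) w) ^ p \<partial>M) \<le> (\<integral>w. U w + U w * norm (D (Suc n) w) ^ q \<partial>M)"
      using q U le i by (intro integral_mono) auto
    also have "\<dots> = (\<integral>w. U w \<partial>M) + (\<integral>w. U w * norm (D (Suc n) w) ^ q \<partial>M)" using q U by simp
    finally show "(\<integral>w. U w * norm (D (Suc n) w) ^ p \<partial>M) \<le> (C + 1) * (\<integral>w. U w \<partial>M)"
      using q by (simp add: algebra_simps)
  qed
  then show ?thesis unfolding bounded_moment_def using C(1) by (intro exI[of _ "C + 1"]) auto
qed

lemma bounded_moment_D:
  assumes "bounded_moment p"
  shows "\<exists>C>0. \<forall>n. integrable M (\<lambda>w. norm (D (Suc n) w) ^ p) \<and> (\<integral>w. norm (D (Suc n) w) ^ p \<partial>M) \<le> C"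
proof -
  obtain C where C: "C > 0" "\<And>n U. U \<in> borel_measurable (Fl n) \<Longrightarrow> (\<And>w. U w \<ge> 0) \<Longrightarrow> integrable M U \<Longrightarrow>
     integrable M (\<lambda>w. U w * norm (D (Suc n) w) ^ p) \<and>
     (\<integral>w. U w * norm (D (Suc n) w) ^ p \<partial>M) \<le> C * (\<integral>w. U w \<partial>M)"
    using assms unfolding bounded_moment_def by blast
  have 1: "(\<lambda>_. 1) \<in> borel_measurable (Fl n)" "integrable M (\<lambda>_. 1::real)" "(\<integral>w. 1 \<partial>M) = (1::real)" for n
    using prob_space by simp_all
  have "integrable M (\<lambda>w. norm (D (Suc n) w) ^ p) \<and> (\<integral>w. norm (D (Suc n) w) ^ p \<partial>M) \<le> C" for n
    using C(2)[of "\<lambda>_. 1", OF 1(1) _ 1(2), unfolded 1(3)] by (simp only: zero_le_one mult_1 mult_1_right)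
  then show ?thesis using C(1) by blast
qed

lemma V_step_le: "V (Suc n) w \<le> V n w - gam n * Gr n w + gam n * (grad f (\<theta> n w) \<bullet> D (Suc n) w)
    + K * (gam n)\<^sup>2 * (2 * Gr n w + 2 * (norm (D (Suc n) w))\<^sup>2)"
proof -
  let ?g = "grad f (\<theta> n w)" and ?D = "D (Suc n) w"
  have d: "\<theta> (Suc n) w - \<theta> n w = - (gam n *\<^sub>R (?g - ?D))" by (simp add: \<theta>_step gam_def)
  have "V (Suc n) w \<le> V n w + (\<theta> (Suc n) w - \<theta> n w) \<bullet> ?g + K * (norm (\<theta> (Suc n) w - \<theta> n w))\<^sup>2"
    using descent[of "\<theta> (Suc n) w" "\<theta> n w"] by (simp add: abs_le_iff)
  also have "(\<theta> (Suc n) w - \<theta> n w) \<bullet> ?g = - gam n * Gr n w + gam n * (?g \<bullet> ?D)"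
    unfolding d by (simp add: inner_diff_left inner_diff_right power2_norm_eq_inner algebra_simps inner_commute)
  also have "(norm (\<theta> (Suc n) w - \<theta> n w))\<^sup>2 = (gam n)\<^sup>2 * (norm (?g - ?D))\<^sup>2"
    unfolding d by (simp add: power_mult_distrib)
  also have "K * ((gam n)\<^sup>2 * (norm (?g - ?D))\<^sup>2) \<le> K * ((gam n)\<^sup>2 * (2 * Gr n w + 2 * (norm ?D)\<^sup>2))"
  proof -
    have "(norm (?g - ?D))\<^sup>2 \<le> (norm ?g + norm ?D)\<^sup>2" by (intro power_mono norm_triangle_ineq4) auto
    also have "\<dots> \<le> 2 * Gr n w + 2 * (norm ?D)\<^sup>2"
      using sum_squares_bound[of "norm ?g" "norm ?D"] by (simp add: power2_sum)
    finally show ?thesis using K_pos by (intro mult_left_mono) auto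
  qed
  finally show ?thesis by (simp add: mult.assoc)
qed

text \<open>No rate is claimed. As the squared gradient is at most \<open>4 * K * f\<close>, the new
  potential is at most a constant, depending on \<open>n\<close>, times the old potential plus the
  squared noise, so integrability passes from \<open>n\<close> to \<open>n + 1\<close>. It starts
  from a deterministic point.\<close>

lemma V_power_integrable:
  assumes m: "bounded_moment (2 * p)"
  shows "integrable M (\<lambda>w. V n w ^ p)"
proof (induction n)
  case 0
  have "(\<lambda>w. V 0 w ^ p) = (\<lambda>w. V 0 undefined ^ p)" using \<theta>_0 by (metis (no_types))
  then show ?case by simp
next
  case (Suc n)
  define c where "c = (4 * K * gam n + 8 * K\<^sup>2 * (gam n)\<^sup>2 + 1) + (gam n + 2 * K * (gam n)\<^sup>2)"
  have c0: "c \<ge> 0" using K_pos gam_pos[of n] by (simp add: c_def)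
  let ?N = "\<lambda>w. norm (D (Suc n) w)"
  have le: "V (Suc n) w ^ p \<le> c ^ p * (2 ^ p * (V n w ^ p + ?N w ^ (2 * p)))" for w
  proof -
    let ?g = "grad f (\<theta> n w)"
    have "?g \<bullet> D (Suc n) w \<le> norm ?g * ?N w" by (rule norm_cauchy_schwarz)
    also have "\<dots> \<le> Gr n w + (?N w)\<^sup>2" by (rule mult_le_sum_squares) auto
    finally have "gam n * (?g \<bullet> D (Suc n) w) \<le> gam n * (Gr n w + (?N w)\<^sup>2)"
      using gam_pos[of n] by (intro mult_left_mono) auto
    moreover have "gam n * Gr n w \<ge> 0" using gam_pos[of n] by simp
    ultimately have "V (Suc n) w \<le> V n w + (gam n + 2 * K * (gam n)\<^sup>2) * Gr n w + (gam n + 2 * K * (gam n)\<^sup>2) * (?N w)\<^sup>2"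
      using V_step_le[of n w] by (simp add: algebra_simps)
    also have "(gam n + 2 * K * (gam n)\<^sup>2) * Gr n w \<le> (gam n + 2 * K * (gam n)\<^sup>2) * (4 * K * V n w)"
      using gam_pos[of n] K_pos grad_sq_le by (intro mult_left_mono) auto
    also have "V n w + (gam n + 2 * K * (gam n)\<^sup>2) * (4 * K * V n w) + (gam n + 2 * K * (gam n)\<^sup>2) * (?N w)\<^sup>2
       = (4 * K * gam n + 8 * K\<^sup>2 * (gam n)\<^sup>2 + 1) * V n w + (gam n + 2 * K * (gam n)\<^sup>2) * (?N w)\<^sup>2"
      by (simp add: algebra_simps power2_eq_square)
    also have "\<dots> \<le> c * V n w + c * (?N w)\<^sup>2"
      using gam_pos[of n] K_pos f_nonneg by (intro add_mono mult_right_mono) (auto simp: c_def)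
    finally have "V (Suc n) w ^ p \<le> (c * (V n w + (?N w)\<^sup>2)) ^ p"
      using f_nonneg by (intro power_mono) (auto simp: distrib_left)
    also have "\<dots> = c ^ p * (V n w + (?N w)\<^sup>2) ^ p" by (simp add: power_mult_distrib)
    also have "\<dots> \<le> c ^ p * (2 ^ p * (V n w ^ p + ((?N w)\<^sup>2) ^ p))"
      using c0 f_nonneg by (intro mult_left_mono power_add_le_two_power) auto
    finally show ?thesis by (simp add: power_mult)
  qed
  have i: "integrable M (\<lambda>w. ?N w ^ (2 * p))" using bounded_moment_D[OF m] by blast
  show ?case
  proof (rule integrable_dominated)
    show "integrable M (\<lambda>w. c ^ p * (2 ^ p * (V n w ^ p + ?N w ^ (2 * p))))"
      by (intro integrable_mult_right Bochner_Integration.integrable_add Suc i)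
    show "norm (V (Suc n) w ^ p) \<le> c ^ p * (2 ^ p * (V n w ^ p + ?N w ^ (2 * p)))" for w
      using le[of w] zero_le_power[OF f_nonneg, of "\<theta> (Suc n) w" p] unfolding real_norm_def by linarith
  qed measurable
qed

lemma V_power_integrable_le:
  assumes m: "bounded_moment (2 * p)" and q: "q \<le> p"
  shows "integrable M (\<lambda>w. V n w ^ q)"
  using V_power_integrable[OF bounded_moment_mono[OF m, of "2 * q"]] q by simp

lemma drift_integrable:
  assumes m: "bounded_moment (2 * p)" and p: "p \<ge> 2"
  shows "integrable M (\<lambda>w. V n w ^ (p - 1) * Gr n w)"
    and "integrable M (\<lambda>w. V n w ^ (p - 1) * (norm (D (Suc n) w))\<^sup>2)"
    and "integrable M (\<lambda>w. V n w ^ (p - 1) * (grad f (\<theta> n w) \<bullet> D (Suc n) w))"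
    and "(\<integral>w. V n w ^ (p - 1) * (grad f (\<theta> n w) \<bullet> D (Suc n) w) \<partial>M) = 0"
proof -
  obtain k where k: "p = Suc k" using p by (metis Suc_le_D One_nat_def Suc_1)
  have V0: "V n w \<ge> 0" for w by (rule f_nonneg)
  have i1: "integrable M (\<lambda>w. V n w ^ p)" by (rule V_power_integrable[OF m])
  have i2: "integrable M (\<lambda>w. V n w ^ (p - 1))" by (rule V_power_integrable_le[OF m]) simp
  have le1: "V n w ^ (p - 1) * Gr n w \<le> 4 * K * V n w ^ p" for w
    using mult_left_mono[OF grad_sq_le[of "\<theta> n w"], of "V n w ^ k"] V0[of w] by (simp add: k mult_ac)
  show I1: "integrable M (\<lambda>w. V n w ^ (p - 1) * Gr n w)"
  proof (rule integrable_dominated)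
    show "integrable M (\<lambda>w. 4 * K * V n w ^ p)" by (intro integrable_mult_right i1)
    show "norm (V n w ^ (p - 1) * Gr n w) \<le> 4 * K * V n w ^ p" for w
      using le1[of w] V0[of w] by (simp add: abs_mult)
  qed measurable
  have "bounded_moment 2" by (rule bounded_moment_mono[OF m]) (use p in simp)
  then show I2: "integrable M (\<lambda>w. V n w ^ (p - 1) * (norm (D (Suc n) w))\<^sup>2)"
    unfolding bounded_moment_def using i2 zero_le_power[OF V0, of _ "p - 1"]
      borel_measurable_power[OF V_adapted[of n], of "p - 1"] by blast
  have le3: "\<bar>V n w ^ (p - 1) * grad f (\<theta> n w) $ i * D (Suc n) w $ i\<bar>
      \<le> V n w ^ (p - 1) * Gr n w + V n w ^ (p - 1) * (norm (D (Suc n) w))\<^sup>2" for w i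
  proof -
    have "\<bar>grad f (\<theta> n w) $ i * D (Suc n) w $ i\<bar> \<le> norm (grad f (\<theta> n w)) * norm (D (Suc n) w)"
      unfolding abs_mult by (intro mult_mono component_le_norm_cart) auto
    also have "\<dots> \<le> Gr n w + (norm (D (Suc n) w))\<^sup>2"
      by (rule mult_le_sum_squares) auto
    finally have "V n w ^ (p - 1) * \<bar>grad f (\<theta> n w) $ i * D (Suc n) w $ i\<bar>
       \<le> V n w ^ (p - 1) * (Gr n w + (norm (D (Suc n) w))\<^sup>2)" using V0 by (intro mult_left_mono) auto
    then show ?thesis using V0 by (simp add: abs_mult distrib_left mult.assoc)
  qed
  have i3: "integrable M (\<lambda>w. V n w ^ (p - 1) * grad f (\<theta> n w) $ i * D (Suc n) w $ i)" for i
  proof (rule integrable_dominated[OF Bochner_Integration.integrable_add[OF I1 I2]])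
    show "norm (V n w ^ (p - 1) * grad f (\<theta> n w) $ i * D (Suc n) w $ i)
      \<le> V n w ^ (p - 1) * Gr n w + V n w ^ (p - 1) * (norm (D (Suc n) w))\<^sup>2" for w
      using le3[of w i] by simp
  qed measurable
  have eq: "V n w ^ (p - 1) * (grad f (\<theta> n w) \<bullet> D (Suc n) w)
      = (\<Sum>i\<in>UNIV. V n w ^ (p - 1) * grad f (\<theta> n w) $ i * D (Suc n) w $ i)" for w
    by (simp add: inner_vec_def sum_distrib_left mult.assoc)
  show "integrable M (\<lambda>w. V n w ^ (p - 1) * (grad f (\<theta> n w) \<bullet> D (Suc n) w))"
    unfolding eq using i3 by (intro Bochner_Integration.integrable_sum)
  \<comment> \<open>The weight belongs to the past, so the mean-zero property applies to each
    coordinate of the inner product.\<close>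
  have "(\<lambda>w. V n w ^ (p - 1) * grad f (\<theta> n w) $ i) \<in> borel_measurable (Fl n)" for i
    using V_adapted[of n] grad_\<theta>_adapted[of n] by measurable
  then have "(\<integral>w. V n w ^ (p - 1) * grad f (\<theta> n w) $ i * D (Suc n) w $ i \<partial>M) = 0" for i
    using D_mean[OF _ i3] by blast
  then show "(\<integral>w. V n w ^ (p - 1) * (grad f (\<theta> n w) \<bullet> D (Suc n) w) \<partial>M) = 0"
    unfolding eq using i3 by (subst Bochner_Integration.integral_sum) auto
qed

lemma drift:
  assumes m: "bounded_moment (2 * p)" and p: "p \<ge> 2"
  shows "\<exists>C>0. \<exists>n0. \<forall>n\<ge>n0. EV (Suc n) p \<le> EV n p
     - gam n / 4 * EG n p
     + C * ((gam n)\<^sup>2 * EV n (p - 1) + gam n ^ (p + 1))"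
proof -
  obtain C \<gamma>0 where C: "C > 0" "\<gamma>0 > 0" and step: "\<And>\<gamma> F g s N X. 0 < \<gamma> \<Longrightarrow> \<gamma> \<le> \<gamma>0 \<Longrightarrow> 0 \<le> F \<Longrightarrow> 0 \<le> g \<Longrightarrow> 0 \<le> N \<Longrightarrow> 0 \<le> X
     \<Longrightarrow> g \<le> 4 * K * F \<Longrightarrow> \<bar>s\<bar> \<le> sqrt g * N \<Longrightarrow> X \<le> F - \<gamma> * g + \<gamma> * s + K * \<gamma>\<^sup>2 * (2 * g + 2 * N\<^sup>2)
     \<Longrightarrow> X ^ p \<le> F ^ p - (\<gamma> / 4) * (F ^ (p - 1) * g) + real p * \<gamma> * (F ^ (p - 1) * s)
        + C * (\<gamma>\<^sup>2 * (F ^ (p - 1) * N\<^sup>2) + \<gamma> ^ (2 * p) * N ^ (2 * p))"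
    using lyapunov_step[OF K_pos p] by metis
  obtain n0 where n0: "\<And>n. n \<ge> n0 \<Longrightarrow> gam n \<le> \<gamma>0" using gam_eventually_le[OF C(2)] by blast
  have b2: "bounded_moment 2" by (rule bounded_moment_mono[OF m]) (use p in simp)
  obtain C2 where C2: "C2 > 0" "\<And>n U. U \<in> borel_measurable (Fl n) \<Longrightarrow> (\<And>w. U w \<ge> 0) \<Longrightarrow> integrable M U \<Longrightarrow>
     (\<integral>w. U w * norm (D (Suc n) w) ^ 2 \<partial>M) \<le> C2 * (\<integral>w. U w \<partial>M)"
    using b2 unfolding bounded_moment_def by blast
  obtain C3 where C3: "C3 > 0" "\<And>n. integrable M (\<lambda>w. norm (D (Suc n) w) ^ (2 * p))"
     "\<And>n. (\<integral>w. norm (D (Suc n) w) ^ (2 * p) \<partial>M) \<le> C3"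
    using bounded_moment_D[OF m] by blast
  define C' where "C' = C * (C2 + C3 * \<gamma> ^ (p - 1))"
  have C': "C' > 0" using C C2 C3 \<gamma>_pos by (simp add: C'_def add_pos_pos)
  have "EV (Suc n) p \<le> EV n p
     - gam n / 4 * EG n p
     + C' * ((gam n)\<^sup>2 * EV n (p - 1) + gam n ^ (p + 1))" if n: "n \<ge> n0" for n
  proof -
    let ?N = "\<lambda>w. norm (D (Suc n) w)"
    let ?s = "\<lambda>w. grad f (\<theta> n w) \<bullet> D (Suc n) w"
    note I = drift_integrable[OF m p, of n] V_power_integrable[OF m] C3(2)[of n]
    have pw: "V (Suc n) w ^ p \<le> V n w ^ p - (gam n / 4) * (V n w ^ (p - 1) * Gr n w)
        + real p * gam n * (V n w ^ (p - 1) * ?s w)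
        + C * ((gam n)\<^sup>2 * (V n w ^ (p - 1) * (?N w)\<^sup>2) + gam n ^ (2 * p) * ?N w ^ (2 * p))" for w
      by (rule step) (use gam_pos n0[OF n] f_nonneg grad_sq_le V_step_le Cauchy_Schwarz_ineq2 in auto)
    have "EV (Suc n) p \<le> (\<integral>w. V n w ^ p - (gam n / 4) * (V n w ^ (p - 1) * Gr n w)
        + real p * gam n * (V n w ^ (p - 1) * ?s w)
        + C * ((gam n)\<^sup>2 * (V n w ^ (p - 1) * (?N w)\<^sup>2) + gam n ^ (2 * p) * ?N w ^ (2 * p)) \<partial>M)"
      using I pw by (intro integral_mono) auto
    also have "\<dots> = EV n p - (gam n / 4) * EG n p
        + C * ((gam n)\<^sup>2 * (\<integral>w. V n w ^ (p - 1) * (?N w)\<^sup>2 \<partial>M) + gam n ^ (2 * p) * (\<integral>w. ?N w ^ (2 * p) \<partial>M))"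
      using I by simp
    also have "\<dots> \<le> EV n p - (gam n / 4) * EG n p
        + C * ((gam n)\<^sup>2 * (C2 * EV n (p - 1)) + gam n ^ (2 * p) * C3)"
    proof -
      have "(\<integral>w. V n w ^ (p - 1) * (?N w)\<^sup>2 \<partial>M) \<le> C2 * EV n (p - 1)"
        by (rule C2(2)) (use f_nonneg borel_measurable_power[OF V_adapted[of n], of "p - 1"]
            V_power_integrable_le[OF m, of "p - 1"] in auto)
      then have "C * ((gam n)\<^sup>2 * (\<integral>w. V n w ^ (p - 1) * (?N w)\<^sup>2 \<partial>M) + gam n ^ (2 * p) * (\<integral>w. ?N w ^ (2 * p) \<partial>M))
         \<le> C * ((gam n)\<^sup>2 * (C2 * EV n (p - 1)) + gam n ^ (2 * p) * C3)"
        using C(1) C3(3)[of n] gam_pos[of n] by (intro mult_left_mono add_mono) auto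
      then show ?thesis by simp
    qed
    also have "\<dots> \<le> EV n p - (gam n / 4) * EG n p
        + C' * ((gam n)\<^sup>2 * EV n (p - 1) + gam n ^ (p + 1))"
    proof -
      have Y: "0 \<le> (gam n)\<^sup>2 * EV n (p - 1)" using f_nonneg by simp
      \<comment> \<open>Of the \<open>2 * p\<close> powers of the step \<open>p + 1\<close> are
        kept: one more than the target order \<open>gam n ^ p\<close>, as a contraction at rate
        \<open>gam n\<close> requires.\<close>
      have "gam n ^ (2 * p) = gam n ^ (p - 1) * gam n ^ (p + 1)" 
      proof -
        have "2 * p = (p - 1) + (p + 1)" using p by simp
        then show ?thesis by (simp only: power_add)
      qed
      also have "\<dots> \<le> \<gamma> ^ (p - 1) * gam n ^ (p + 1)"
        using gam_le gam_pos[of n] by (intro mult_right_mono power_mono) auto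
      finally have "gam n ^ (2 * p) * C3 \<le> (\<gamma> ^ (p - 1) * gam n ^ (p + 1)) * C3" using C3(1) by (intro mult_right_mono) auto
      moreover have "(gam n)\<^sup>2 * (C2 * EV n (p - 1)) \<le> (C2 + C3 * \<gamma> ^ (p - 1)) * ((gam n)\<^sup>2 * EV n (p - 1))"
        using mult_right_mono[OF _ Y, of C2 "C2 + C3 * \<gamma> ^ (p - 1)"] C3(1) \<gamma>_pos by (simp add: mult_ac)
      moreover have "(\<gamma> ^ (p - 1) * gam n ^ (p + 1)) * C3 \<le> (C2 + C3 * \<gamma> ^ (p - 1)) * gam n ^ (p + 1)"
        using C2(1) gam_pos[of n] by (simp add: distrib_right mult_ac)
      ultimately have "(gam n)\<^sup>2 * (C2 * EV n (p - 1)) + gam n ^ (2 * p) * C3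
         \<le> (C2 + C3 * \<gamma> ^ (p - 1)) * ((gam n)\<^sup>2 * EV n (p - 1) + gam n ^ (p + 1))"
        unfolding distrib_left by linarith
      from mult_left_mono[OF this, of C] C(1) show ?thesis by (simp add: C'_def mult.assoc)
    qed
    finally show ?thesis .
  qed
  then show ?thesis using C' by blast
qed


lemma V_power_nonneg: "V n w ^ q \<ge> 0"
  by (rule zero_le_power[OF f_nonneg])

text \<open>\<open>\<psi>\<close> treats both growth regimes at once: it is the identity when the
  squared gradient dominates \<open>f\<close>, and \<open>min F 1\<close> otherwise. The hypothesis
  \<open>young\<close> concerns only \<open>g \<le> e\<close>, which late steps satisfy; in the
  truncated case this restriction is what makes it hold for large \<open>F\<close>.\<close>

lemma lyapunov_drift:
  fixes \<psi> :: "real \<Rightarrow> real"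
  assumes m: "bounded_moment (2 * p)" and p: "p \<ge> 2"
    and c: "c > 0" "\<And>x. c * \<psi> (f x) \<le> (norm (grad f x))\<^sup>2"
    and \<psi>_meas: "\<psi> \<in> borel_measurable borel" and \<psi>: "\<And>F. F \<ge> 0 \<Longrightarrow> 0 \<le> \<psi> F \<and> \<psi> F \<le> F"
    and young: "\<And>e. e > 0 \<Longrightarrow> \<exists>Y\<ge>0. \<forall>g F. 0 < g \<longrightarrow> g \<le> e \<longrightarrow> F \<ge> 0
      \<longrightarrow> g * F ^ (p - 1) \<le> e * (F ^ (p - 1) * \<psi> F) + Y * g ^ p"
  shows "\<exists>c'>0. \<exists>C'\<ge>0. \<exists>n0. \<forall>n\<ge>n0. EV (Suc n) p \<le> EV n p
     - c' * gam n * (\<integral>w. V n w ^ (p - 1) * \<psi> (V n w) \<partial>M) + C' * gam n ^ (p + 1)"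
    and "integrable M (\<lambda>w. V n w ^ (p - 1) * \<psi> (V n w))"
proof -
  obtain C n0 where C: "C > 0" and dr: "\<And>n. n \<ge> n0 \<Longrightarrow> EV (Suc n) p \<le> EV n p
     - gam n / 4 * EG n p + C * ((gam n)\<^sup>2 * EV n (p - 1) + gam n ^ (p + 1))"
    using drift[OF m p] by blast
  obtain k where k: "p = Suc k" using p by (metis Suc_le_D One_nat_def Suc_1)
  \<comment> \<open>With this \<open>e\<close> the second-order noise term uses up half of the drift
    coefficient \<open>c / 4\<close> and leaves \<open>c / 8\<close>.\<close>
  define e where "e = c / (8 * C)"
  have e: "e > 0" using c C by (simp add: e_def)
  obtain Y where Y: "Y \<ge> 0" "\<And>g F. 0 < g \<Longrightarrow> g \<le> e \<Longrightarrow> F \<ge> 0 \<Longrightarrow> g * F ^ (p - 1) \<le> e * (F ^ (p - 1) * \<psi> F) + Y * g ^ p"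
    using young[OF e] by blast
  obtain n1 where n1: "\<And>n. n \<ge> n1 \<Longrightarrow> gam n \<le> e" using gam_eventually_le[OF e] by blast
  have iV: "integrable M (\<lambda>w. V n w ^ p)" "integrable M (\<lambda>w. V n w ^ (p - 1))" for n
    using V_power_integrable_le[OF m, of p] V_power_integrable_le[OF m, of "p - 1"] by simp_all
  have iA: "integrable M (\<lambda>w. V n w ^ (p - 1) * \<psi> (V n w))" for n
  proof (rule integrable_dominated[OF iV(1)[of n]])
    show "norm (V n w ^ (p - 1) * \<psi> (V n w)) \<le> V n w ^ p" for w
      using \<psi>[OF f_nonneg, of "\<theta> n w"] mult_left_mono[OF _ V_power_nonneg[of n w k], of "\<psi> (V n w)" "V n w"]
        V_power_nonneg[of n w k] by (simp add: k abs_mult mult.commute)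
    have "(\<lambda>w. \<psi> (V n w)) \<in> borel_measurable M" by (rule measurable_compose[OF V_meas \<psi>_meas])
    then show "(\<lambda>w. V n w ^ (p - 1) * \<psi> (V n w)) \<in> borel_measurable M" by measurable
  qed
  then show "integrable M (\<lambda>w. V n w ^ (p - 1) * \<psi> (V n w))" .
  have "EV (Suc n) p \<le> EV n p - c / 8 * gam n * (\<integral>w. V n w ^ (p - 1) * \<psi> (V n w) \<partial>M) + C * (Y + 1) * gam n ^ (p + 1)"
    if n: "n \<ge> max n0 n1" for n
  proof -
    define A where "A = (\<integral>w. V n w ^ (p - 1) * \<psi> (V n w) \<partial>M)"
    have "(\<integral>w. gam n * V n w ^ (p - 1) \<partial>M) \<le> (\<integral>w. e * (V n w ^ (p - 1) * \<psi> (V n w)) + Y * gam n ^ p \<partial>M)"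
    proof (rule integral_mono)
      show "integrable M (\<lambda>w. gam n * V n w ^ (p - 1))" by (intro integrable_mult_right iV)
      show "integrable M (\<lambda>w. e * (V n w ^ (p - 1) * \<psi> (V n w)) + Y * gam n ^ p)"
        by (intro Bochner_Integration.integrable_add integrable_mult_right iA integrable_const)
      show "gam n * V n w ^ (p - 1) \<le> e * (V n w ^ (p - 1) * \<psi> (V n w)) + Y * gam n ^ p" for w
        using n by (intro Y(2) gam_pos n1 f_nonneg) simp
    qed
    also have "\<dots> = e * A + Y * gam n ^ p" using iA prob_space by (simp add: A_def)
    finally have "gam n * EV n (p - 1) \<le> e * A + Y * gam n ^ p" using iV by simp
    then have "C * gam n * (gam n * EV n (p - 1)) \<le> C * gam n * (e * A + Y * gam n ^ p)"
      using C gam_pos[of n] by (intro mult_left_mono) auto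
    also have "\<dots> = gam n * c / 8 * A + C * Y * gam n ^ (p + 1)" using C by (simp add: e_def field_simps)
    finally have 1: "C * ((gam n)\<^sup>2 * EV n (p - 1)) \<le> gam n * c / 8 * A + C * Y * gam n ^ (p + 1)"
      by (simp add: power2_eq_square mult_ac)
    have "(\<integral>w. c * (V n w ^ (p - 1) * \<psi> (V n w)) \<partial>M) \<le> EG n p"
    proof (rule integral_mono)
      show "integrable M (\<lambda>w. c * (V n w ^ (p - 1) * \<psi> (V n w)))" by (intro integrable_mult_right iA)
      show "integrable M (\<lambda>w. V n w ^ (p - 1) * Gr n w)" by (rule drift_integrable[OF m p])
      show "c * (V n w ^ (p - 1) * \<psi> (V n w)) \<le> V n w ^ (p - 1) * Gr n w" for w
        using mult_left_mono[OF c(2)[of "\<theta> n w"] V_power_nonneg[of n w "p - 1"]] by (simp add: mult_ac)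
    qed
    then have "c * A \<le> EG n p" using iA by (simp add: A_def)
    then have "gam n / 4 * (c * A) \<le> gam n / 4 * EG n p" using gam_pos[of n] by (intro mult_left_mono) auto
    then show ?thesis using dr[of n] n 1 unfolding A_def[symmetric] by (simp add: algebra_simps)
  qed
  then show "\<exists>c'>0. \<exists>C'\<ge>0. \<exists>n0. \<forall>n\<ge>n0. EV (Suc n) p \<le> EV n p
     - c' * gam n * (\<integral>w. V n w ^ (p - 1) * \<psi> (V n w) \<partial>M) + C' * gam n ^ (p + 1)"
    using c C Y by (intro exI[of _ "c / 8"] conjI exI[of _ "C * (Y + 1)"] exI[of _ "max n0 n1"]) auto
qed

text \<open>With \<open>\<psi>\<close> the identity the drift is proportional to
  \<open>EV n p\<close> itself, so the recursion contracts at rate \<open>gam n\<close> with a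
  source of order \<open>gam n ^ (p + 1)\<close>.\<close>

lemma moment_rate_strong:
  assumes m: "bounded_moment (2 * p)" and p: "p \<ge> 2"
    and c: "c > 0" "\<And>x. c * f x \<le> (norm (grad f x))\<^sup>2"
  shows "\<exists>B\<ge>0. \<forall>n. EV n p \<le> B * real (Suc n) powr (- (real p * \<beta>))"
proof -
  obtain k where k: "p = Suc k" using p by (metis Suc_le_D One_nat_def Suc_1)
  have young: "\<exists>Y\<ge>0. \<forall>g F. 0 < g \<longrightarrow> g \<le> e \<longrightarrow> F \<ge> 0 \<longrightarrow> g * F ^ (p - 1) \<le> e * (F ^ (p - 1) * F) + Y * g ^ p"
    if e: "e > 0" for e :: real
    using young_power[OF e, of _ _ p] e by (intro exI[of _ "(1 / e) ^ (p - 1)"]) (simp add: k mult.commute)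
  obtain c' C' n0 where c': "c' > 0" "C' \<ge> 0" and dr: "\<And>n. n \<ge> n0 \<Longrightarrow> EV (Suc n) p \<le> EV n p
     - c' * gam n * (\<integral>w. V n w ^ (p - 1) * V n w \<partial>M) + C' * gam n ^ (p + 1)"
    using lyapunov_drift(1)[of p c "\<lambda>x. x", OF m p c _ _ young] by auto
  show ?thesis
  proof (rule contraction_rate[where a=\<beta> and c="c' * \<gamma>" and C="C' * \<gamma> ^ (p + 1)" and ?n0.0=n0])
    fix n assume n: "n \<ge> n0"
    have g: "gam n ^ (p + 1) = \<gamma> ^ (p + 1) * real (Suc n) powr (- \<beta> - real p * \<beta>)"
      using gam_power[of n "p + 1"] by (simp add: algebra_simps)
    have "EV (Suc n) p \<le> EV n p - c' * gam n * EV n p + C' * gam n ^ (p + 1)"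
      using dr[OF n] by (simp add: k mult.commute[of _ "V n _"])
    then show "EV (Suc n) p \<le> (1 - c' * \<gamma> * real (Suc n) powr (- \<beta>)) * EV n p
       + C' * \<gamma> ^ (p + 1) * real (Suc n) powr (- \<beta> - real p * \<beta>)"
      unfolding g by (simp add: gam_def algebra_simps)
  qed (use \<beta>_bounds \<gamma>_pos c' in auto)
qed

lemma weak_drift:
  assumes m: "bounded_moment (2 * p)" and p: "p \<ge> 2"
    and c: "c > 0" "\<And>x. c * min (f x) 1 \<le> (norm (grad f x))\<^sup>2"
  shows "\<exists>c'>0. \<exists>C'\<ge>0. \<exists>n0. \<forall>n\<ge>n0. EV (Suc n) p \<le> EV n p - c' * gam n * ET n p + C' * gam n ^ (p + 1)"
    and "integrable M (\<lambda>w. V n w ^ (p - 1) * min (V n w) 1)"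
proof -
  obtain k where k: "p = Suc k" using p by (metis Suc_le_D One_nat_def Suc_1)
  have young: "\<exists>Y\<ge>0. \<forall>g F. 0 < g \<longrightarrow> g \<le> e \<longrightarrow> F \<ge> 0 \<longrightarrow> g * F ^ (p - 1) \<le> e * (F ^ (p - 1) * min F 1) + Y * g ^ p"
    if e: "e > 0" for e :: real
  proof (intro exI[of _ "(1 / e) ^ (p - 1)"] conjI allI impI)
    fix g F :: real assume g: "0 < g" "g \<le> e" and F: "F \<ge> 0"
    show "g * F ^ (p - 1) \<le> e * (F ^ (p - 1) * min F 1) + (1 / e) ^ (p - 1) * g ^ p"
    \<comment> \<open>Up to \<open>F = 1\<close> the truncation is invisible and the weighted Young
      inequality applies; above it \<open>g \<le> e\<close> alone is enough.\<close>
    proof (cases "F \<le> 1")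
      case True
      then show ?thesis using young_power[OF e F, of g p] g by (simp add: k mult.commute)
    next
      case False
      have "g * F ^ k \<le> e * F ^ k" using g F by (intro mult_right_mono) auto
      moreover have "0 \<le> (1 / e) ^ k * g ^ p" using e g by simp
      moreover have "min F 1 = 1" using False by simp
      ultimately show ?thesis unfolding k by (simp only: diff_Suc_1 mult_1_right)
    qed
  qed (use e in simp)
  have mm: "(\<lambda>x::real. min x 1) \<in> borel_measurable borel" by measurable
  have b: "0 \<le> min F 1 \<and> min F 1 \<le> F" if "F \<ge> 0" for F :: real using that by simp
  note * = lyapunov_drift[of p c "\<lambda>x. min x 1", OF m p c mm b young]
  show "\<exists>c'>0. \<exists>C'\<ge>0. \<exists>n0. \<forall>n\<ge>n0. EV (Suc n) p \<le> EV n p - c' * gam n * ET n p + C' * gam n ^ (p + 1)"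
    by (rule *(1))
  show "integrable M (\<lambda>w. V n w ^ (p - 1) * min (V n w) 1)" by (rule *(2))
qed

section \<open>Moment rates when the squared gradient only dominates min f 1\<close>

context
  fixes c :: real
  assumes all_moments: "\<And>p. bounded_moment p"
    and c_pos: "c > 0" and grad_ge: "\<And>x. c * min (f x) 1 \<le> (norm (grad f x))\<^sup>2"
begin

text \<open>The drift has the right sign and is dropped; the remaining increments are of order
  n^(-(p+1)\<beta>), summable because \<open>3 * \<beta> > 1\<close>. Boundedness of arbitrarily
  high moments, even without a rate, is what makes truncation at a slowly growing level
  affordable.\<close>

lemma moment_bounded_weak:
  assumes p: "p \<ge> 2"
  shows "\<exists>B. \<forall>n. EV n p \<le> B"
proof -
  obtain c' C' n0 where c': "c' > 0" "C' \<ge> 0" and dr: "\<And>n. n \<ge> n0 \<Longrightarrow> EV (Suc n) p \<le> EV n p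
     - c' * gam n * ET n p + C' * gam n ^ (p + 1)"
    using weak_drift(1)[OF all_moments p c_pos grad_ge] by blast
  show ?thesis
  proof (rule bounded_of_summable_increments)
    show "C' * gam n ^ (p + 1) \<ge> 0" for n using c' gam_pos[of n] by simp
    have "1 < real (p + 1) * \<beta>"
    proof -
      have "3 * \<beta> \<le> real (p + 1) * \<beta>" using p \<beta>_bounds by (intro mult_right_mono) auto
      then show ?thesis using \<beta>_bounds by linarith
    qed
    then have "summable (\<lambda>n. real n powr (- (real (p + 1) * \<beta>)))" by (subst summable_real_powr_iff) simp
    then have "summable (\<lambda>n. real (Suc n) powr (- (real (p + 1) * \<beta>)))" by (subst summable_Suc_iff)
    then show "summable (\<lambda>n. C' * gam n ^ (p + 1))" unfolding gam_power by (intro summable_mult)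
    fix n assume n: "n \<ge> n0"
    have "0 \<le> ET n p"
      using f_nonneg V_power_nonneg by (intro Bochner_Integration.integral_nonneg mult_nonneg_nonneg) auto
    then have "0 \<le> c' * gam n * ET n p"
      using c' gam_pos[of n] by (intro mult_nonneg_nonneg) auto
    then show "EV (Suc n) p \<le> EV n p + C' * gam n ^ (p + 1)"
      using dr[OF n] by linarith
  qed
qed

lemma truncation_bound:
  assumes p: "p \<ge> 2" and l: "l \<ge> 1"
  shows "EV n p \<le> l * ET n p + EV n (p + q) / l ^ q"
proof -
  obtain k where k: "p = Suc k" using p by (metis Suc_le_D One_nat_def Suc_1)
  have iV: "integrable M (\<lambda>w. V n w ^ p)" for p by (rule V_power_integrable[OF all_moments])
  have iA: "integrable M (\<lambda>w. V n w ^ (p - 1) * min (V n w) 1)"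
    by (rule weak_drift(2)[OF all_moments p c_pos grad_ge])
  have "EV n p \<le> (\<integral>w. l * (V n w ^ (p - 1) * min (V n w) 1) + V n w ^ (p + q) / l ^ q \<partial>M)"
  proof (rule integral_mono)
    show "integrable M (\<lambda>w. l * (V n w ^ (p - 1) * min (V n w) 1) + V n w ^ (p + q) / l ^ q)"
      by (intro Bochner_Integration.integrable_add integrable_mult_right integrable_divide iV iA)
    fix w
    define F where "F = V n w"
    have F: "F \<ge> 0" by (simp add: F_def f_nonneg)
    \<comment> \<open>Below the level one has \<open>F \<le> l * min F 1\<close> because
      \<open>l \<ge> 1\<close>; above it Markov's device \<open>1 \<le> (F / l) ^ q\<close>
      applies.\<close>
    have "F ^ p \<le> l * (F ^ (p - 1) * min F 1) + F ^ (p + q) / l ^ q"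
    proof (cases "F \<le> l")
      case True
      have "F \<le> l * min F 1" using l F True mult_right_mono[OF l F] by (auto simp: min_def)
      then have "F ^ k * F \<le> F ^ k * (l * min F 1)" using F by (intro mult_left_mono) auto
      moreover have "0 \<le> F ^ (p + q) / l ^ q" using F l by simp
      ultimately show ?thesis by (simp add: k mult_ac)
    next
      case False
      then have "l ^ q \<le> F ^ q" using l by (intro power_mono) auto
      then have "F ^ p * l ^ q \<le> F ^ p * F ^ q" using F by (intro mult_left_mono) auto
      then have "F ^ p \<le> F ^ (p + q) / l ^ q" using l by (simp add: power_add field_simps)
      moreover have "0 \<le> l * (F ^ (p - 1) * min F 1)" using F l by simp
      ultimately show ?thesis by linarith
    qed
    then show "V n w ^ p \<le> l * (V n w ^ (p - 1) * min (V n w) 1) + V n w ^ (p + q) / l ^ q" by (simp only: F_def)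
  qed (rule iV)
  also have "\<dots> = l * ET n p + EV n (p + q) / l ^ q"
    using iA iV[of "p + q"] by simp
  finally show ?thesis .
qed

lemma moment_rate_weak:
  assumes p: "p \<ge> 2"
  shows "\<exists>B\<ge>0. \<forall>n. EV n p \<le> B * real (Suc n) powr (- (real p * \<beta> - (1 - \<beta>) / 2))"
proof -
  obtain c' C' n0 where c': "c' > 0" "C' \<ge> 0" and dr: "\<And>n. n \<ge> n0 \<Longrightarrow> EV (Suc n) p \<le> EV n p
     - c' * gam n * ET n p + C' * gam n ^ (p + 1)"
    using weak_drift(1)[OF all_moments p c_pos grad_ge] by blast
  \<comment> \<open>\<open>\<beta> + d = (1 + \<beta>) / 2\<close> stays below 1, as the contraction
    lemma requires; the price is the loss of \<open>d\<close> in the exponent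
    \<open>b\<close>.\<close>
  define d where "d = (1 - \<beta>) / 2"
  define b where "b = real p * \<beta> - d"
  have d: "d > 0" "d < \<beta>" "\<beta> + d < 1" using \<beta>_bounds by (auto simp: d_def field_simps)
  have "2 * \<beta> \<le> real p * \<beta>" using p \<beta>_bounds by (intro mult_right_mono) auto
  then have b: "b \<ge> 0" using \<beta>_bounds d unfolding b_def by linarith
  \<comment> \<open>\<open>q\<close> is so large that the tail beyond \<open>l\<close>, which is at
    most a constant over \<open>l ^ q\<close>, decays at least like n^(-b).\<close>
  obtain q where q: "real q * d \<ge> b" using reals_Archimedean3[OF d(1)] by (meson less_imp_le)
  obtain B0 where B0: "\<And>n. EV n (p + q) \<le> B0" using moment_bounded_weak[of "p + q"] p by auto
  have B00: "B0 \<ge> 0" using B0[of 0] Bochner_Integration.integral_nonneg[of M "\<lambda>w. V 0 w ^ (p + q)"] V_power_nonneg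
    by (meson order_trans)
  have "\<exists>B\<ge>0. \<forall>n. EV n p \<le> B * real (Suc n) powr (- b)"
  proof (rule contraction_rate[where a="\<beta> + d" and c="c' * \<gamma>" and C="c' * \<gamma> * B0 + C' * \<gamma> ^ (p + 1)" and ?n0.0=n0])
    fix n assume n: "n \<ge> n0"
    define x where "x = real (Suc n)"
    define l where "l = x powr d"
    define A where "A = ET n p"
    define E where "E = EV n p"
    have x: "x \<ge> 1" by (simp add: x_def)
    have l: "l \<ge> 1" using x d by (simp add: l_def ge_one_powr_ge_zero)
    have g: "gam n = \<gamma> * x powr (- \<beta>)" by (simp add: gam_def x_def)
    have "E \<le> l * A + B0 / l ^ q"
      using truncation_bound[OF p l, of n q] divide_right_mono[OF B0[of n], of "l ^ q"] l
      by (simp add: A_def E_def)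
    then have "x powr (- d) * E \<le> x powr (- d) * (l * A + B0 / l ^ q)" by (intro mult_left_mono) auto
    also have "\<dots> = A + B0 * (x powr (- d) * x powr (- (real q * d)))"
      using x by (simp add: l_def powr_minus field_simps powr_power)
    also have "x powr (- d) * x powr (- (real q * d)) \<le> x powr (- d) * x powr (- b)"
      using x q by (intro mult_left_mono powr_mono) auto
    finally have A: "A \<ge> x powr (- d) * E - B0 * (x powr (- d) * x powr (- b))"
      using B00 by (smt (verit) mult_left_mono)
    have "c' * gam n * (x powr (- d) * E - B0 * (x powr (- d) * x powr (- b))) \<le> c' * gam n * A"
      using A c' gam_pos[of n] by (intro mult_left_mono) auto
    then have "EV (Suc n) p \<le> E - c' * gam n * (x powr (- d) * E - B0 * (x powr (- d) * x powr (- b))) + C' * gam n ^ (p + 1)"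
      using dr[OF n] by (simp add: A_def E_def)
    also have "\<dots> = (1 - c' * \<gamma> * (x powr (- \<beta>) * x powr (- d))) * E
        + c' * \<gamma> * B0 * (x powr (- \<beta>) * x powr (- d) * x powr (- b)) + C' * \<gamma> ^ (p + 1) * x powr (- (real (p + 1) * \<beta>))"
    proof -
      have gp: "gam n ^ (p + 1) = \<gamma> ^ (p + 1) * x powr (- (real (p + 1) * \<beta>))"
        unfolding x_def by (rule gam_power)
      show ?thesis unfolding gp unfolding g by (simp add: algebra_simps)
    qed
    also have "x powr (- \<beta>) * x powr (- d) = x powr (- (\<beta> + d))" by (simp add: powr_add[symmetric])
    also have "x powr (- (\<beta> + d)) * x powr (- b) = x powr (- (\<beta> + d) - b)" by (simp add: powr_add[symmetric])
    also have "- (real (p + 1) * \<beta>) = - (\<beta> + d) - b" by (simp add: b_def algebra_simps)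
    finally show "EV (Suc n) p \<le> (1 - c' * \<gamma> * real (Suc n) powr (- (\<beta> + d))) * EV n p
       + (c' * \<gamma> * B0 + C' * \<gamma> ^ (p + 1)) * real (Suc n) powr (- (\<beta> + d) - b)"
      by (simp add: E_def x_def distrib_right)
  qed (use d \<beta>_bounds \<gamma>_pos c' B00 b in auto)
  then show ?thesis by (simp add: b_def d_def)
qed

lemma fourth_power_rate_weak:
  "\<exists>B\<ge>0. \<forall>n. EV n 4 \<le> B * real (Suc n) powr (- (2 * \<beta>))"
proof -
  obtain B where B: "B \<ge> 0" "\<And>n. EV n 4 \<le> B * real (Suc n) powr (- (real 4 * \<beta> - (1 - \<beta>) / 2))"
    using moment_rate_weak[of 4] by auto
  have "EV n 4 \<le> B * real (Suc n) powr (- (2 * \<beta>))" for n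
  proof -
    \<comment> \<open>The exponent lost, \<open>(1 - \<beta>) / 2\<close>, is smaller than the
      surplus \<open>2 * \<beta>\<close> of the fourth power over the target.\<close>
    have "real (Suc n) powr (- (real 4 * \<beta> - (1 - \<beta>) / 2)) \<le> real (Suc n) powr (- (2 * \<beta>))"
      using \<beta>_bounds by (intro powr_mono) auto
    then show ?thesis using B(2)[of n] mult_left_mono[OF _ B(1)] by (meson order_trans)
  qed
  then show ?thesis using B(1) by blast
qed

text \<open>Truncation at the fixed level \<open>l = 1\<close> with \<open>q = 2\<close> loses
  nothing: the excess \<open>EV n 4\<close> is already of the target order, so the contraction
  proceeds at the full rate \<open>gam n\<close>.\<close>

lemma second_power_rate_weak:
  "\<exists>B\<ge>0. \<forall>n. EV n 2 \<le> B * real (Suc n) powr (- (2 * \<beta>))"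
proof -
  obtain c' C' n0 where c': "c' > 0" "C' \<ge> 0" and dr: "\<And>n. n \<ge> n0 \<Longrightarrow> EV (Suc n) 2 \<le> EV n 2
     - c' * gam n * ET n 2 + C' * gam n ^ (2 + 1)"
    using weak_drift(1)[OF all_moments order_refl c_pos grad_ge] by blast
  obtain B where B: "B \<ge> 0" "\<And>n. EV n 4 \<le> B * real (Suc n) powr (- (2 * \<beta>))"
    using fourth_power_rate_weak by blast
  show ?thesis
  proof (rule contraction_rate[where a=\<beta> and c="c' * \<gamma>" and C="c' * \<gamma> * B + C' * \<gamma> ^ 3" and ?n0.0=n0])
    fix n assume n: "n \<ge> n0"
    define x where "x = real (Suc n)"
    define A where "A = ET n 2"
    define E where "E = EV n 2"
    have g: "gam n = \<gamma> * x powr (- \<beta>)" by (simp add: gam_def x_def)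
    have g3: "gam n ^ (2 + 1) = \<gamma> ^ 3 * x powr (- (real 3 * \<beta>))"
      using gam_power[of n 3] by (simp add: x_def)
    have "E \<le> A + EV n 4"
      using truncation_bound[of 2 1 n 2] by (simp add: A_def E_def)
    then have "A \<ge> E - B * x powr (- (2 * \<beta>))" using B(2)[of n] by (simp add: x_def)
    then have "c' * gam n * (E - B * x powr (- (2 * \<beta>))) \<le> c' * gam n * A"
      using c' gam_pos[of n] by (intro mult_left_mono) auto
    then have "EV (Suc n) 2 \<le> E - c' * gam n * (E - B * x powr (- (2 * \<beta>))) + C' * gam n ^ (2 + 1)"
      using dr[OF n] by (simp add: A_def E_def)
    also have "\<dots> = (1 - c' * \<gamma> * x powr (- \<beta>)) * E + c' * \<gamma> * B * (x powr (- \<beta>) * x powr (- (2 * \<beta>)))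
        + C' * \<gamma> ^ 3 * x powr (- (real 3 * \<beta>))"
      unfolding g3 unfolding g by (simp add: x_def algebra_simps)
    also have "x powr (- \<beta>) * x powr (- (2 * \<beta>)) = x powr (- \<beta> - 2 * \<beta>)" by (simp add: powr_add[symmetric])
    also have "- (real 3 * \<beta>) = - \<beta> - 2 * \<beta>" by simp
    finally show "EV (Suc n) 2 \<le> (1 - c' * \<gamma> * real (Suc n) powr (- \<beta>)) * EV n 2
       + (c' * \<gamma> * B + C' * \<gamma> ^ 3) * real (Suc n) powr (- \<beta> - 2 * \<beta>)"
      by (simp add: E_def x_def distrib_right)
  qed (use \<beta>_bounds \<gamma>_pos c' B in auto)
qed

end

lemma fourth_moment_of_V:
  assumes i: "\<And>n. integrable M (\<lambda>w. W (\<theta> n w))"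
    and le: "\<And>x. norm (x - x0) ^ 4 \<le> W x"
    and B: "\<And>n. (\<integral>w. W (\<theta> n w) \<partial>M) \<le> B * real (Suc n) powr (- (2 * \<beta>))"
  shows "integrable M (\<lambda>w. norm (\<theta> n w - x0) ^ 4)"
    and "(\<integral>w. norm (\<theta> n w - x0) ^ 4 \<partial>M) \<le> B * real (Suc n) powr (- (2 * \<beta>))"
proof -
  show 1: "integrable M (\<lambda>w. norm (\<theta> n w - x0) ^ 4)"
  proof (rule integrable_dominated[OF i[of n]])
    show "norm (norm (\<theta> n w - x0) ^ 4) \<le> W (\<theta> n w)" for w using le[of "\<theta> n w"] by simp
  qed measurable
  have "(\<integral>w. norm (\<theta> n w - x0) ^ 4 \<partial>M) \<le> (\<integral>w. W (\<theta> n w) \<partial>M)"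
    by (rule integral_mono[OF 1 i le])
  then show "(\<integral>w. norm (\<theta> n w - x0) ^ 4 \<partial>M) \<le> B * real (Suc n) powr (- (2 * \<beta>))"
    using B[of n] by linarith
qed

lemma fourth_moment_strong:
  assumes m: "bounded_moment 4"
    and c: "c > 0" "\<And>x. c * f x \<le> (norm (grad f x))\<^sup>2"
    and C: "C > 0" "\<And>x. (norm (x - x0))\<^sup>2 \<le> C * f x"
  shows "\<exists>B\<ge>0. \<forall>n. integrable M (\<lambda>w. norm (\<theta> n w - x0) ^ 4) \<and>
    (\<integral>w. norm (\<theta> n w - x0) ^ 4 \<partial>M) \<le> B * real (Suc n) powr (- (2 * \<beta>))"
proof -
  have m': "bounded_moment (2 * 2)" using m by simp
  obtain B where B: "B \<ge> 0" "\<And>n. EV n 2 \<le> B * real (Suc n) powr (- (2 * \<beta>))"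
    using moment_rate_strong[OF m' order_refl c] by auto
  have i: "integrable M (\<lambda>w. C\<^sup>2 * (V n w)\<^sup>2)" for n by (intro integrable_mult_right V_power_integrable m')
  have le: "norm (x - x0) ^ 4 \<le> C\<^sup>2 * (f x)\<^sup>2" for x
    using power_mono[OF C(2)[of x], of 2] by (simp add: power_mult_distrib)
  have "(\<integral>w. C\<^sup>2 * (V n w)\<^sup>2 \<partial>M) \<le> (C\<^sup>2 * B) * real (Suc n) powr (- (2 * \<beta>))" for n
    using mult_left_mono[OF B(2)[of n], of "C\<^sup>2"] by (simp add: mult.assoc)
  note * = fourth_moment_of_V[of "\<lambda>x. C\<^sup>2 * (f x)\<^sup>2", OF i le this]
  show ?thesis using * B(1) by (intro exI[of _ "C\<^sup>2 * B"] conjI) auto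
qed

lemma fourth_moment_weak:
  assumes m: "\<And>p. bounded_moment p"
    and c: "c > 0" "\<And>x. c * min (f x) 1 \<le> (norm (grad f x))\<^sup>2"
    and C: "C > 0" "\<And>x. norm (x - x0) ^ 4 \<le> C * ((f x)\<^sup>2 + f x ^ 4)"
  shows "\<exists>B\<ge>0. \<forall>n. integrable M (\<lambda>w. norm (\<theta> n w - x0) ^ 4) \<and>
    (\<integral>w. norm (\<theta> n w - x0) ^ 4 \<partial>M) \<le> B * real (Suc n) powr (- (2 * \<beta>))"
proof -
  obtain B where B: "B \<ge> 0" "\<And>n. EV n 2 \<le> B * real (Suc n) powr (- (2 * \<beta>))"
    using second_power_rate_weak[OF m c] by auto
  obtain B' where B': "B' \<ge> 0" "\<And>n. EV n 4 \<le> B' * real (Suc n) powr (- (2 * \<beta>))"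
    using fourth_power_rate_weak[OF m c] by auto
  have iV: "integrable M (\<lambda>w. V n w ^ p)" for n p by (intro V_power_integrable m)
  have i: "integrable M (\<lambda>w. C * ((V n w)\<^sup>2 + V n w ^ 4))" for n
    by (intro integrable_mult_right Bochner_Integration.integrable_add iV)
  have "(\<integral>w. C * ((V n w)\<^sup>2 + V n w ^ 4) \<partial>M) \<le> (C * (B + B')) * real (Suc n) powr (- (2 * \<beta>))" for n
  proof -
    have "(\<integral>w. C * ((V n w)\<^sup>2 + V n w ^ 4) \<partial>M) = C * (EV n 2 + EV n 4)"
      using iV by simp
    also have "\<dots> \<le> C * (B * real (Suc n) powr (- (2 * \<beta>)) + B' * real (Suc n) powr (- (2 * \<beta>)))"
      using B(2) B'(2) C(1) by (intro mult_left_mono add_mono) auto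
    finally show ?thesis by (simp add: algebra_simps)
  qed
  note * = fourth_moment_of_V[of "\<lambda>x. C * ((f x)\<^sup>2 + f x ^ 4)", OF i C(2) this]
  show ?thesis using * B(1) B'(1) C(1) by (intro exI[of _ "C * (B + B')"] conjI) auto
qed

end

section \<open>The averaged sequence\<close>

definition square_integrable :: "'a measure \<Rightarrow> ('a \<Rightarrow> 'b::euclidean_space) \<Rightarrow> bool" where
  "square_integrable M X \<longleftrightarrow> X \<in> borel_measurable M \<and> integrable M (\<lambda>w. (norm (X w))\<^sup>2)"

lemma square_integrableD:
  assumes "square_integrable M X"
  shows "X \<in> borel_measurable M" "integrable M (\<lambda>w. (norm (X w))\<^sup>2)"
  using assms by (auto simp: square_integrable_def)

lemma norm_add_sq_le: "(norm (x + y :: 'a::real_normed_vector))\<^sup>2 \<le> 2 * (norm x)\<^sup>2 + 2 * (norm y)\<^sup>2"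
proof -
  have "(norm (x + y))\<^sup>2 \<le> (norm x + norm y)\<^sup>2" by (intro power_mono norm_triangle_ineq) auto
  also have "\<dots> \<le> 2 * (norm x)\<^sup>2 + 2 * (norm y)\<^sup>2"
    using sum_squares_bound[of "norm x" "norm y"] by (simp add: power2_sum)
  finally show ?thesis .
qed

lemma square_integrable_add:
  assumes X: "square_integrable M X" and Y: "square_integrable M Y"
  shows "square_integrable M (\<lambda>w. X w + Y w)"
  unfolding square_integrable_def
proof
  note [measurable] = square_integrableD(1)[OF X] square_integrableD(1)[OF Y]
  show "(\<lambda>w. X w + Y w) \<in> borel_measurable M" by measurable
  show "integrable M (\<lambda>w. (norm (X w + Y w))\<^sup>2)"
  proof (rule integrable_dominated)
    show "integrable M (\<lambda>w. 2 * (norm (X w))\<^sup>2 + 2 * (norm (Y w))\<^sup>2)"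
      by (intro Bochner_Integration.integrable_add integrable_mult_right square_integrableD(2)[OF X] square_integrableD(2)[OF Y])
    show "norm ((norm (X w + Y w))\<^sup>2) \<le> 2 * (norm (X w))\<^sup>2 + 2 * (norm (Y w))\<^sup>2" for w
      using norm_add_sq_le[of "X w" "Y w"] by simp
  qed measurable
qed

lemma square_integrable_linear:
  assumes X: "square_integrable M X" and l: "bounded_linear l"
  shows "square_integrable M (\<lambda>w. l (X w))"
  unfolding square_integrable_def
proof
  obtain K where K: "\<And>x. norm (l x) \<le> norm x * K" using bounded_linear.bounded[OF l] by blast
  show m: "(\<lambda>w. l (X w)) \<in> borel_measurable M"
    using borel_measurable_continuous_onI[OF linear_continuous_on[OF l]] square_integrableD(1)[OF X]
    by (rule measurable_compose[rotated])
  note [measurable] = m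
  show "integrable M (\<lambda>w. (norm (l (X w)))\<^sup>2)"
  proof (rule integrable_dominated)
    show "integrable M (\<lambda>w. K\<^sup>2 * (norm (X w))\<^sup>2)" by (intro integrable_mult_right square_integrableD(2)[OF X])
    show "norm ((norm (l (X w)))\<^sup>2) \<le> K\<^sup>2 * (norm (X w))\<^sup>2" for w
      using power_mono[OF K[of "X w"], of 2] by (simp add: power_mult_distrib mult.commute)
  qed measurable
qed

lemma square_integrable_scaleR: "square_integrable M X \<Longrightarrow> square_integrable M (\<lambda>w. c *\<^sub>R X w)"
  using square_integrable_linear[OF _ bounded_linear_scaleR_right] .

lemma square_integrable_matrix:
  fixes X :: "'a \<Rightarrow> real ^ 'n"
  shows "square_integrable M X \<Longrightarrow> square_integrable M (\<lambda>w. A *v X w)"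
  using square_integrable_linear[OF _ matrix_vector_mul_bounded_linear] .

lemma square_integrable_diff:
  assumes "square_integrable M X" "square_integrable M Y"
  shows "square_integrable M (\<lambda>w. X w - Y w)"
  using square_integrable_add[OF assms(1) square_integrable_scaleR[OF assms(2), of "-1"]] by simp

lemma square_integrable_sum:
  assumes "finite I" "\<And>i. i \<in> I \<Longrightarrow> square_integrable M (X i)"
  shows "square_integrable M (\<lambda>w. \<Sum>i\<in>I. X i w)"
  using assms by (induction I rule: finite_induct) (simp_all add: square_integrable_add, simp add: square_integrable_def)

lemma square_integrable_norm_mult:
  assumes X: "square_integrable M X" and Y: "square_integrable M Y"
  shows "integrable M (\<lambda>w. norm (X w) * norm (Y w))"
proof (rule integrable_dominated)
  note [measurable] = square_integrableD(1)[OF X] square_integrableD(1)[OF Y]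
  show "integrable M (\<lambda>w. (norm (X w))\<^sup>2 + (norm (Y w))\<^sup>2)"
    by (intro Bochner_Integration.integrable_add square_integrableD(2)[OF X] square_integrableD(2)[OF Y])
  show "norm (norm (X w) * norm (Y w)) \<le> (norm (X w))\<^sup>2 + (norm (Y w))\<^sup>2" for w
    using mult_le_sum_squares[of "norm (X w)" "norm (Y w)"] by simp
  show "(\<lambda>w. norm (X w) * norm (Y w)) \<in> borel_measurable M" by measurable
qed

lemma square_integrable_inner:
  assumes X: "square_integrable M X" and Y: "square_integrable M Y"
  shows "integrable M (\<lambda>w. X w \<bullet> Y w)"
proof (rule integrable_dominated[OF square_integrable_norm_mult[OF X Y]])
  note [measurable] = square_integrableD(1)[OF X] square_integrableD(1)[OF Y]
  show "norm (X w \<bullet> Y w) \<le> norm (X w) * norm (Y w)" for w by (simp add: Cauchy_Schwarz_ineq2)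
  show "(\<lambda>w. X w \<bullet> Y w) \<in> borel_measurable M" by measurable
qed

lemma norm_component_scaleR_le: "norm ((x :: real ^ 'n) $ j *\<^sub>R y) \<le> norm x * norm y"
  by (simp add: mult_right_mono component_le_norm_cart)

lemma square_integrable_component_scaleR:
  fixes X :: "'a \<Rightarrow> real ^ 'n"
  assumes X: "square_integrable M X" and Y: "square_integrable M Y"
  shows "integrable M (\<lambda>w. X w $ j *\<^sub>R Y w)"
proof (rule integrable_dominated[OF square_integrable_norm_mult[OF X Y]])
  note [measurable] = square_integrableD(1)[OF X] square_integrableD(1)[OF Y]
  show "norm (X w $ j *\<^sub>R Y w) \<le> norm (X w) * norm (Y w)" for w by (rule norm_component_scaleR_le)
  show "(\<lambda>w. X w $ j *\<^sub>R Y w) \<in> borel_measurable M" by measurable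
qed

lemma square_integrable_component_mult:
  fixes X :: "'a \<Rightarrow> real ^ 'n" and Y :: "'a \<Rightarrow> real ^ 'm"
  assumes X: "square_integrable M X" and Y: "square_integrable M Y"
  shows "integrable M (\<lambda>w. X w $ j * Y w $ i)"
  using integrable_bounded_linear[OF bounded_linear_vec_nth square_integrable_component_scaleR[OF X Y, of j], of i]
  by simp

text \<open>Minkowski's inequality in \<open>L\<^sup>2\<close>, obtained from a weighted Cauchy-Schwarz inequality.\<close>

lemma second_moment_sum_le:
  assumes I: "finite I" and c: "\<And>i. i \<in> I \<Longrightarrow> c i > 0"
    and X: "\<And>i. i \<in> I \<Longrightarrow> square_integrable M (X i)"
    and B: "\<And>i. i \<in> I \<Longrightarrow> (\<integral>w. (norm (X i w))\<^sup>2 \<partial>M) \<le> B * (c i)\<^sup>2"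
  shows "(\<integral>w. (norm (\<Sum>i\<in>I. X i w))\<^sup>2 \<partial>M) \<le> B * (\<Sum>i\<in>I. c i)\<^sup>2"
proof -
  have pw: "(norm (\<Sum>i\<in>I. X i w))\<^sup>2 \<le> (\<Sum>i\<in>I. c i) * (\<Sum>i\<in>I. (norm (X i w))\<^sup>2 / c i)" for w
  proof -
    have "(norm (\<Sum>i\<in>I. X i w))\<^sup>2 \<le> (\<Sum>i\<in>I. norm (X i w))\<^sup>2" by (intro power_mono norm_sum) auto
    also have "(\<Sum>i\<in>I. norm (X i w)) = (\<Sum>i\<in>I. sqrt (c i) * (norm (X i w) / sqrt (c i)))"
      using c by (intro sum.cong) (auto simp: less_imp_neq[symmetric])
    also have "\<dots>\<^sup>2 \<le> (\<Sum>i\<in>I. (sqrt (c i))\<^sup>2) * (\<Sum>i\<in>I. (norm (X i w) / sqrt (c i))\<^sup>2)"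
      by (rule Cauchy_Schwarz_ineq_sum)
    also have "(\<Sum>i\<in>I. (sqrt (c i))\<^sup>2) = (\<Sum>i\<in>I. c i)"
      using c by (intro sum.cong) (auto simp: less_imp_le)
    also have "(\<Sum>i\<in>I. (norm (X i w) / sqrt (c i))\<^sup>2) = (\<Sum>i\<in>I. (norm (X i w))\<^sup>2 / c i)"
      using c by (intro sum.cong) (auto simp: less_imp_le power_divide)
    finally show ?thesis .
  qed
  have i: "integrable M (\<lambda>w. (norm (X i w))\<^sup>2 / c i)" if "i \<in> I" for i
    using square_integrableD(2)[OF X[OF that]] by (rule integrable_divide)
  have "(\<integral>w. (norm (\<Sum>i\<in>I. X i w))\<^sup>2 \<partial>M) \<le> (\<integral>w. (\<Sum>i\<in>I. c i) * (\<Sum>i\<in>I. (norm (X i w))\<^sup>2 / c i) \<partial>M)"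
  proof (rule integral_mono[OF _ _ pw])
    show "integrable M (\<lambda>w. (norm (\<Sum>i\<in>I. X i w))\<^sup>2)"
      using square_integrableD(2)[OF square_integrable_sum[OF I X]] .
    show "integrable M (\<lambda>w. (\<Sum>i\<in>I. c i) * (\<Sum>i\<in>I. (norm (X i w))\<^sup>2 / c i))"
      by (intro integrable_mult_right Bochner_Integration.integrable_sum i)
  qed
  also have "\<dots> = (\<Sum>i\<in>I. c i) * (\<Sum>i\<in>I. (\<integral>w. (norm (X i w))\<^sup>2 \<partial>M) / c i)"
    using i by (simp add: Bochner_Integration.integral_sum)
  also have "\<dots> \<le> (\<Sum>i\<in>I. c i) * (\<Sum>i\<in>I. B * c i)"
  proof (intro mult_left_mono sum_mono)
    fix i assume "i \<in> I"
    then show "(\<integral>w. (norm (X i w))\<^sup>2 \<partial>M) / c i \<le> B * c i"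
      using B[of i] c[of i] by (simp add: divide_le_eq power2_eq_square mult.assoc)
  qed (use c in \<open>simp add: sum_nonneg less_imp_le\<close>)
  finally show ?thesis by (simp add: sum_distrib_left[symmetric] power2_eq_square mult_ac)
qed

text \<open>Moves the differences from the vectors to the weights. Including \<open>a 0\<close> lets
  the differences of the weights start at \<open>k = 1\<close> and makes the identity true for
  \<open>n = 0\<close>.\<close>

lemma abel_summation:
  fixes x :: "nat \<Rightarrow> 'a::real_vector"
  shows "(\<Sum>k=1..n. a k *\<^sub>R (x k - x (Suc k)))
    = a 0 *\<^sub>R x 1 + (\<Sum>k=1..n. (a k - a (k - 1)) *\<^sub>R x k) - a n *\<^sub>R x (Suc n)"
  by (induction n) (simp_all add: algebra_simps)

text \<open>\<open>D_cov\<close> is the integrated form of the conditional covariance: the leading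
  term is a sum of expectations of quadratic forms in single increments.\<close>

locale averaged_descent = noisy_descent M f x0 K L \<theta> D Fl \<gamma> \<beta>
  for M :: "'w measure" and f :: "real ^ 'd \<Rightarrow> real" and x0 K L \<theta> D Fl \<gamma> \<beta> +
  fixes S :: "real ^ 'd \<Rightarrow> real ^ 'd ^ 'd" and LS B4 :: real
  assumes B4_nonneg: "B4 \<ge> 0"
    and fourth_integrable: "\<And>n. integrable M (\<lambda>w. norm (\<theta> n w - x0) ^ 4)"
    and fourth_moment: "\<And>n. (\<integral>w. norm (\<theta> n w - x0) ^ 4 \<partial>M) \<le> B4 * real (Suc n) powr (- (2 * \<beta>))"
    and D_second_moment: "bounded_moment 2"
    and LS_nonneg: "LS \<ge> 0" and S_lip: "\<And>x y. norm (S x - S y) \<le> LS * norm (x - y)"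
    and D_cov: "\<And>n i j. (\<integral>w. D (Suc n) w $ i * D (Suc n) w $ j \<partial>M) = (\<integral>w. S (\<theta> n w) $ i $ j \<partial>M)"
begin

abbreviation m2 :: "('w \<Rightarrow> real ^ 'n) \<Rightarrow> real" where "m2 X \<equiv> (\<integral>w. (norm (X w))\<^sup>2 \<partial>M)"

definition \<tau> :: "nat \<Rightarrow> 'w \<Rightarrow> real ^ 'd" where "\<tau> n w = \<theta> n w - x0"

definition R :: "nat \<Rightarrow> 'w \<Rightarrow> real ^ 'd" where "R n w = grad f (\<theta> n w) - H *v \<tau> n w"

text \<open>The sum runs from \<open>D 2\<close> to \<open>D n\<close>: the average starts at
  \<open>\<theta> 1\<close>, so the first increment does not enter, and \<open>Mart n\<close> is
  known at time \<open>n\<close>. In particular \<open>Mart 0\<close> and \<open>Mart 1\<close>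
  vanish.\<close>

definition Mart :: "nat \<Rightarrow> 'w \<Rightarrow> real ^ 'd" where "Mart n w = (\<Sum>j\<in>{1..<n}. D (Suc j) w)"

abbreviation "G \<equiv> matrix_inv H"

lemma \<tau>_meas [measurable]: "\<tau> n \<in> borel_measurable M"
  unfolding \<tau>_def by measurable

lemma \<tau>_adapted: "\<tau> n \<in> borel_measurable (Fl n)"
  unfolding \<tau>_def using \<theta>_adapted[of n] by measurable

lemma R_meas [measurable]: "R n \<in> borel_measurable M"
proof -
  have "(\<lambda>w. H *v \<tau> n w) \<in> borel_measurable M"
    using \<tau>_meas borel_measurable_continuous_onI[OF linear_continuous_on[OF matrix_vector_mul_bounded_linear]]
    by (rule measurable_compose)
  then show ?thesis unfolding R_def by measurable
qed

lemma \<tau>_step: "\<tau> (Suc n) w = \<tau> n w - gam n *\<^sub>R (H *v \<tau> n w) - gam n *\<^sub>R R n w + gam n *\<^sub>R D (Suc n) w"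
  unfolding \<tau>_def by (simp add: \<theta>_step gam_def R_def \<tau>_def algebra_simps)

lemma norm_R_le: "norm (R n w) \<le> L * (norm (\<tau> n w))\<^sup>2"
  unfolding R_def \<tau>_def by (rule grad_linearization)

lemma \<tau>_square_integrable: "square_integrable M (\<tau> n)"
  unfolding square_integrable_def
proof
  show "integrable M (\<lambda>w. (norm (\<tau> n w))\<^sup>2)"
  proof (rule integrable_dominated)
    show "integrable M (\<lambda>w. 1 + norm (\<tau> n w) ^ 4)"
      using fourth_integrable[of n] by (simp add: \<tau>_def)
    show "norm ((norm (\<tau> n w))\<^sup>2) \<le> 1 + norm (\<tau> n w) ^ 4" for w
      using power_le_one_plus_power[of "norm (\<tau> n w)" 2 4] by simp
  qed measurable
qed measurable

text \<open>A substitute for Jensen's inequality, from the pointwise bound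
  \<open>X \<le> s + X^2 / s\<close>; choosing \<open>s\<close> of the expected size of
  \<open>X\<close> loses only a constant.\<close>

lemma expectation_le_square:
  fixes X :: "'w \<Rightarrow> real"
  assumes s: "s > 0" and X: "\<And>w. X w \<ge> 0" "integrable M X" "integrable M (\<lambda>w. (X w)\<^sup>2)"
  shows "(\<integral>w. X w \<partial>M) \<le> s + (1 / s) * (\<integral>w. (X w)\<^sup>2 \<partial>M)"
proof -
  have "(\<integral>w. X w \<partial>M) \<le> (\<integral>w. s + (1 / s) * (X w)\<^sup>2 \<partial>M)"
  proof (rule integral_mono[OF X(2)])
    show "integrable M (\<lambda>w. s + (1 / s) * (X w)\<^sup>2)"
      by (intro Bochner_Integration.integrable_add integrable_const integrable_mult_right X)
    show "X w \<le> s + (1 / s) * (X w)\<^sup>2" for w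
      using mult_le_sum_squares[of s "X w"] s X(1)[of w] by (simp add: field_simps power2_eq_square)
  qed
  also have "\<dots> = s + (1 / s) * (\<integral>w. (X w)\<^sup>2 \<partial>M)" using X prob_space by simp
  finally show ?thesis .
qed

lemma \<tau>_second_moment: "m2 (\<tau> n) \<le> (1 + B4) * real (Suc n) powr (- \<beta>)"
proof -
  define s where "s = real (Suc n) powr (- \<beta>)"
  have s: "s > 0" by (simp add: s_def)
  have i4: "integrable M (\<lambda>w. norm (\<tau> n w) ^ 4)" using fourth_integrable[of n] by (simp add: \<tau>_def)
  have "m2 (\<tau> n) \<le> s + (1 / s) * (\<integral>w. norm (\<tau> n w) ^ 4 \<partial>M)"
    using expectation_le_square[OF s, of "\<lambda>w. (norm (\<tau> n w))\<^sup>2"] i4 square_integrableD(2)[OF \<tau>_square_integrable] by simp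
  also have "\<dots> \<le> s + (1 / s) * (B4 * s\<^sup>2)"
    using fourth_moment[of n] s
    by (intro add_left_mono mult_left_mono) (simp_all add: \<tau>_def s_def powr_power)
  also have "\<dots> = (1 + B4) * s" using s by (simp add: power2_eq_square field_simps)
  finally show ?thesis by (simp add: s_def)
qed

lemma \<tau>_first_moment:
  "integrable M (\<lambda>w. norm (\<tau> n w))"
  "(\<integral>w. norm (\<tau> n w) \<partial>M) \<le> (2 + B4) * real (Suc n) powr (- (\<beta> / 2))"
proof -
  define s where "s = real (Suc n) powr (- (\<beta> / 2))"
  have s: "s > 0" by (simp add: s_def)
  have i2: "integrable M (\<lambda>w. (norm (\<tau> n w))\<^sup>2)" by (rule square_integrableD(2)[OF \<tau>_square_integrable])
  show i1: "integrable M (\<lambda>w. norm (\<tau> n w))"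
  proof (rule integrable_dominated)
    show "integrable M (\<lambda>w. 1 + (norm (\<tau> n w))\<^sup>2)" using i2 by simp
    show "norm (norm (\<tau> n w)) \<le> 1 + (norm (\<tau> n w))\<^sup>2" for w
      using power_le_one_plus_power[of "norm (\<tau> n w)" 1 2] by simp
  qed measurable
  have "(\<integral>w. norm (\<tau> n w) \<partial>M) \<le> s + (1 / s) * m2 (\<tau> n)"
    using expectation_le_square[OF s, of "\<lambda>w. norm (\<tau> n w)"] i1 i2 by simp
  also have "\<dots> \<le> s + (1 / s) * ((1 + B4) * s\<^sup>2)"
    using \<tau>_second_moment[of n] s
    by (intro add_left_mono mult_left_mono) (simp_all add: s_def powr_power)
  also have "\<dots> = (2 + B4) * s" using s by (simp add: power2_eq_square field_simps)
  finally show "(\<integral>w. norm (\<tau> n w) \<partial>M) \<le> (2 + B4) * real (Suc n) powr (- (\<beta> / 2))" by (simp add: s_def)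
qed

lemma R_square_integrable: "square_integrable M (R n)"
  and R_second_moment: "m2 (R n) \<le> L\<^sup>2 * B4 * (real (Suc n) powr (- \<beta>))\<^sup>2"
proof -
  have i4: "integrable M (\<lambda>w. L\<^sup>2 * norm (\<tau> n w) ^ 4)" using fourth_integrable[of n] by (simp add: \<tau>_def)
  have le: "(norm (R n w))\<^sup>2 \<le> L\<^sup>2 * norm (\<tau> n w) ^ 4" for w
    using power_mono[OF norm_R_le[of n w], of 2] by (simp add: power_mult_distrib)
  have i: "integrable M (\<lambda>w. (norm (R n w))\<^sup>2)"
  proof (rule integrable_dominated[OF i4])
    show "norm ((norm (R n w))\<^sup>2) \<le> L\<^sup>2 * norm (\<tau> n w) ^ 4" for w using le[of w] by simp
  qed measurable
  show "square_integrable M (R n)" unfolding square_integrable_def using i R_meas by blast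
  have "m2 (R n) \<le> (\<integral>w. L\<^sup>2 * norm (\<tau> n w) ^ 4 \<partial>M)"
    by (rule integral_mono[OF i i4 le])
  also have "\<dots> \<le> L\<^sup>2 * (B4 * real (Suc n) powr (- (2 * \<beta>)))"
    using mult_left_mono[OF fourth_moment[of n], of "L\<^sup>2"] by (simp add: \<tau>_def)
  finally show "m2 (R n) \<le> L\<^sup>2 * B4 * (real (Suc n) powr (- \<beta>))\<^sup>2"
    by (simp add: powr_power mult.assoc)
qed

lemma D_square_integrable: "square_integrable M (D (Suc n))"
  unfolding square_integrable_def using bounded_moment_D[OF D_second_moment] D_meas by blast

lemma D_bound: "\<exists>C>0. \<forall>n. m2 (D (Suc n)) \<le> C"
  using bounded_moment_D[OF D_second_moment] by blast

lemma D_orthogonal_component: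
  fixes U :: "'w \<Rightarrow> real ^ 'm"
  assumes "U \<in> borel_measurable (Fl n)" "square_integrable M U"
  shows "(\<integral>w. U w $ j * D (Suc n) w $ i \<partial>M) = 0"
proof (rule D_mean)
  show "(\<lambda>w. U w $ j) \<in> borel_measurable (Fl n)" using assms(1) by measurable
  show "integrable M (\<lambda>w. U w $ j * D (Suc n) w $ i)"
    by (rule square_integrable_component_mult[OF assms(2) D_square_integrable])
qed

lemma D_orthogonal_inner:
  fixes U :: "'w \<Rightarrow> real ^ 'm"
  assumes "U \<in> borel_measurable (Fl n)" "square_integrable M U"
  shows "(\<integral>w. U w \<bullet> (A *v D (Suc n) w) \<partial>M) = 0"
proof -
  have "U w \<bullet> (A *v D (Suc n) w) = (\<Sum>i\<in>UNIV. \<Sum>j\<in>UNIV. A $ i $ j * (U w $ i * D (Suc n) w $ j))" for w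
    by (simp add: inner_vec_def matrix_vector_mult_def sum_distrib_left mult_ac)
  moreover have "integrable M (\<lambda>w. U w $ i * D (Suc n) w $ j)" for i j
    by (rule square_integrable_component_mult[OF assms(2) D_square_integrable])
  ultimately show ?thesis
    by (simp add: Bochner_Integration.integral_sum D_orthogonal_component[OF assms])
qed

lemma Mart_Suc: "n \<ge> 1 \<Longrightarrow> Mart (Suc n) w = Mart n w + D (Suc n) w"
  by (simp add: Mart_def)

lemma Mart_square_integrable: "square_integrable M (Mart n)"
proof -
  have "square_integrable M (\<lambda>w. \<Sum>j\<in>{1..<n}. D (Suc j) w)"
    by (rule square_integrable_sum) (auto intro: D_square_integrable)
  then show ?thesis by (simp add: Mart_def[abs_def])
qed

lemma Mart_adapted: "Mart n \<in> borel_measurable (Fl n)"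
  unfolding Mart_def[abs_def]
proof (rule borel_measurable_sum)
  fix j assume "j \<in> {1..<n}"
  then show "D (Suc j) \<in> borel_measurable (Fl n)"
    using measurable_from_subalg[OF Fl_mono D_adapted, of j n] by simp
qed

lemma matrix_adapted:
  fixes U :: "'w \<Rightarrow> real ^ 'm"
  assumes "U \<in> borel_measurable (Fl n)"
  shows "(\<lambda>w. A *v U w) \<in> borel_measurable (Fl n)"
  using assms borel_measurable_continuous_onI[OF linear_continuous_on[OF matrix_vector_mul_bounded_linear]]
  by (rule measurable_compose)

text \<open>Pythagoras for martingale increments: the cross term vanishes because the image of
  \<open>Mart n\<close> under \<open>A\<close> is known at time \<open>n\<close>. It is used with
  the identity matrix and with \<open>G\<close>.\<close>

lemma Mart_second_moment_eq:
  "m2 (\<lambda>w. A *v Mart n w) = (\<Sum>j\<in>{1..<n}. m2 (\<lambda>w. A *v D (Suc j) w))"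
proof (induction n)
  case (Suc n)
  show ?case
  proof (cases "n \<ge> 1")
    case True
    note sq = square_integrable_matrix[OF Mart_square_integrable[of n], of A]
      square_integrable_matrix[OF D_square_integrable[of n], of A]
    have "(norm (A *v Mart (Suc n) w))\<^sup>2 = (norm (A *v Mart n w))\<^sup>2 + 2 * ((A *v Mart n w) \<bullet> (A *v D (Suc n) w))
       + (norm (A *v D (Suc n) w))\<^sup>2" for w
      unfolding Mart_Suc[OF True] matrix_vector_right_distrib power2_norm_eq_inner
      by (simp add: inner_add_left inner_add_right inner_commute)
    then have "m2 (\<lambda>w. A *v Mart (Suc n) w) = m2 (\<lambda>w. A *v Mart n w)
       + 2 * (\<integral>w. (A *v Mart n w) \<bullet> (A *v D (Suc n) w) \<partial>M) + m2 (\<lambda>w. A *v D (Suc n) w)"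
      using square_integrableD(2)[OF sq(1)] square_integrableD(2)[OF sq(2)] square_integrable_inner[OF sq]
      by simp
    also have "(\<integral>w. (A *v Mart n w) \<bullet> (A *v D (Suc n) w) \<partial>M) = 0"
      by (rule D_orthogonal_inner[OF matrix_adapted[OF Mart_adapted] sq(1)])
    finally show ?thesis using Suc True by simp
  qed (simp add: Mart_def)
qed (simp add: Mart_def)

lemma Mart_second_moment: "\<exists>C>0. \<forall>n. m2 (Mart n) \<le> C * real n"
proof -
  obtain C where C: "C > 0" "\<And>n. m2 (D (Suc n)) \<le> C" using D_bound by blast
  have "m2 (Mart n) \<le> C * real n" for n
  proof -
    have "m2 (Mart n) = (\<Sum>j\<in>{1..<n}. m2 (D (Suc j)))"
      using Mart_second_moment_eq[of "mat 1" n] by simp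
    also have "\<dots> \<le> (\<Sum>j\<in>{1..<n}. C)" by (intro sum_mono C)
    also have "\<dots> \<le> C * real n" using C(1) by (simp add: mult.commute)
    finally show ?thesis .
  qed
  then show ?thesis using C(1) by blast
qed

lemma G_inv: "G ** H = mat 1" "H ** G = mat 1"
proof -
  have "\<exists>B. H ** B = mat 1 \<and> B ** H = mat 1" using hess_inv by (simp add: invertible_def)
  then have "H ** G = mat 1 \<and> G ** H = mat 1" unfolding matrix_inv_def by (rule someI_ex)
  then show "G ** H = mat 1" "H ** G = mat 1" by auto
qed

text \<open>The inverse inherits symmetry from \<open>H\<close>. This identifies
  \<open>G S G\<close> with the covariance of the noise transformed by \<open>G\<close>, where the
  transpose of \<open>G\<close> stands on the right.\<close>

lemma G_sym: "G $ i $ j = G $ j $ i"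
proof -
  have "x \<bullet> (G *v y) = y \<bullet> (G *v x)" for x y :: "real ^ 'd"
  proof -
    have Hx: "H *v (G *v x) = x" for x by (simp add: matrix_vector_mul_assoc G_inv)
    have "x \<bullet> (G *v y) = (G *v y) \<bullet> (H *v (G *v x))" by (simp add: Hx inner_commute)
    also have "\<dots> = (G *v x) \<bullet> (H *v (G *v y))" by (rule hess_sym)
    finally show ?thesis by (simp add: Hx inner_commute)
  qed
  from this[of "axis i 1" "axis j 1"] show ?thesis
    by (simp add: inner_axis' matrix_vector_mult_basis column_def)
qed

lemma trace_sandwich: "trace (G ** B ** G) = (\<Sum>i\<in>UNIV. \<Sum>a\<in>UNIV. \<Sum>b\<in>UNIV. G $ i $ a * G $ i $ b * B $ a $ b)"
proof -
  have "trace (G ** B ** G) = (\<Sum>i\<in>UNIV. \<Sum>b\<in>UNIV. \<Sum>a\<in>UNIV. G $ i $ a * G $ i $ b * B $ a $ b)"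
    by (simp add: trace_def matrix_matrix_mult_def sum_distrib_right G_sym[of _ i for i] sum_distrib_left mult_ac)
  also have "\<dots> = (\<Sum>i\<in>UNIV. \<Sum>a\<in>UNIV. \<Sum>b\<in>UNIV. G $ i $ a * G $ i $ b * B $ a $ b)"
    by (intro sum.cong refl sum.swap)
  finally show ?thesis .
qed

lemma norm_sq_matrix_vec: "(norm (A *v (x :: real ^ 'n)))\<^sup>2
   = (\<Sum>i\<in>UNIV. \<Sum>a\<in>UNIV. \<Sum>b\<in>UNIV. A $ i $ a * A $ i $ b * (x $ a * x $ b))"
  unfolding power2_norm_eq_inner inner_vec_def
  by (simp add: matrix_vector_mult_def sum_product mult_ac)

lemma S_meas [measurable]: "S \<in> borel_measurable borel"
proof (rule borel_measurable_continuous_onI)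
  have "LS-lipschitz_on UNIV S" using S_lip LS_nonneg by (intro lipschitz_onI) (auto simp: dist_norm)
  then show "continuous_on UNIV S" by (rule lipschitz_on_continuous_on)
qed

lemma S_component_diff: "\<bar>S x $ a $ b - S x0 $ a $ b\<bar> \<le> LS * norm (x - x0)"
proof -
  have "\<bar>S x $ a $ b - S x0 $ a $ b\<bar> \<le> norm ((S x - S x0) $ a)"
    using component_le_norm_cart[of "(S x - S x0) $ a" b] by simp
  also have "\<dots> \<le> norm (S x - S x0)" by (rule Finite_Cartesian_Product.norm_nth_le)
  also have "\<dots> \<le> LS * norm (x - x0)" by (rule S_lip)
  finally show ?thesis .
qed

text \<open>The left side is linear in the covariance of the increment, which is the mean of
  \<open>S (\<theta> n w)\<close>. The Lipschitz property replaces \<open>\<theta> n w\<close> by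
  \<open>x0\<close> at the cost of the first moment of \<open>\<tau> n\<close>, of order
  n^(-\<beta>/2).\<close>

lemma G_D_second_moment:
  "\<exists>C>0. \<forall>n. m2 (\<lambda>w. G *v D (Suc n) w) \<le> trace (G ** S x0 ** G) + C * real (Suc n) powr (- (\<beta> / 2))"
proof -
  define Cg where "Cg = (\<Sum>i\<in>UNIV. \<Sum>a\<in>UNIV. \<Sum>b\<in>UNIV. \<bar>G $ i $ a * G $ i $ b\<bar>)"
  have Cg: "Cg \<ge> 0" unfolding Cg_def by (intro sum_nonneg) auto
  have "m2 (\<lambda>w. G *v D (Suc n) w) \<le> trace (G ** S x0 ** G) + (Cg * (LS * (2 + B4)) + 1) * real (Suc n) powr (- (\<beta> / 2))" for n
  proof -
    define e where "e = LS * (2 + B4) * real (Suc n) powr (- (\<beta> / 2))"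
    have iD: "integrable M (\<lambda>w. D (Suc n) w $ a * D (Suc n) w $ b)" for a b
      by (rule square_integrable_component_mult[OF D_square_integrable D_square_integrable])
    have iS: "integrable M (\<lambda>w. S (\<theta> n w) $ a $ b - S x0 $ a $ b)" for a b
    proof (rule integrable_dominated)
      show "integrable M (\<lambda>w. LS * norm (\<tau> n w))" by (intro integrable_mult_right \<tau>_first_moment(1))
      show "norm (S (\<theta> n w) $ a $ b - S x0 $ a $ b) \<le> LS * norm (\<tau> n w)" for w
        using S_component_diff[of "\<theta> n w" a b] by (simp add: \<tau>_def)
      have "(\<lambda>x. S x $ a) \<in> borel_measurable borel"
        using measurable_compose[OF S_meas borel_measurable_continuous_onI[OF continuous_on_component[OF continuous_on_id]]] .
      then have "(\<lambda>w. S (\<theta> n w) $ a) \<in> borel_measurable M" by measurable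
      then show "(\<lambda>w. S (\<theta> n w) $ a $ b - S x0 $ a $ b) \<in> borel_measurable M" by measurable
    qed
    have dS: "\<bar>(\<integral>w. S (\<theta> n w) $ a $ b \<partial>M) - S x0 $ a $ b\<bar> \<le> e" for a b
    proof -
      have "integrable M (\<lambda>w. (S (\<theta> n w) $ a $ b - S x0 $ a $ b) + S x0 $ a $ b)"
        by (intro Bochner_Integration.integrable_add iS integrable_const)
      then have "(\<integral>w. S (\<theta> n w) $ a $ b \<partial>M) - S x0 $ a $ b = (\<integral>w. S (\<theta> n w) $ a $ b - S x0 $ a $ b \<partial>M)"
        using prob_space by simp
      also have "\<bar>\<dots>\<bar> \<le> (\<integral>w. \<bar>S (\<theta> n w) $ a $ b - S x0 $ a $ b\<bar> \<partial>M)" by (rule integral_abs_bound)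
      also have "\<dots> \<le> (\<integral>w. LS * norm (\<tau> n w) \<partial>M)"
        by (rule integral_mono[OF integrable_abs[OF iS] integrable_mult_right[OF \<tau>_first_moment(1)]])
           (use S_component_diff in \<open>simp add: \<tau>_def\<close>)
      also have "\<dots> \<le> e" using mult_left_mono[OF \<tau>_first_moment(2)[of n] LS_nonneg] by (simp add: e_def mult.assoc)
      finally show ?thesis .
    qed
    have "m2 (\<lambda>w. G *v D (Suc n) w)
        = (\<Sum>i\<in>UNIV. \<Sum>a\<in>UNIV. \<Sum>b\<in>UNIV. G $ i $ a * G $ i $ b * (\<integral>w. D (Suc n) w $ a * D (Suc n) w $ b \<partial>M))"
      unfolding norm_sq_matrix_vec using iD by (simp add: Bochner_Integration.integral_sum)
    also have "\<dots> = (\<Sum>i\<in>UNIV. \<Sum>a\<in>UNIV. \<Sum>b\<in>UNIV. G $ i $ a * G $ i $ b * (\<integral>w. S (\<theta> n w) $ a $ b \<partial>M))"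
      by (simp only: D_cov)
    also have "\<dots> \<le> (\<Sum>i\<in>UNIV. \<Sum>a\<in>UNIV. \<Sum>b\<in>UNIV. G $ i $ a * G $ i $ b * S x0 $ a $ b + \<bar>G $ i $ a * G $ i $ b\<bar> * e)"
    proof (intro sum_mono)
      fix i a b
      have "G $ i $ a * G $ i $ b * ((\<integral>w. S (\<theta> n w) $ a $ b \<partial>M) - S x0 $ a $ b) \<le> \<bar>G $ i $ a * G $ i $ b\<bar> * e"
      proof -
        have "\<bar>G $ i $ a * G $ i $ b * ((\<integral>w. S (\<theta> n w) $ a $ b \<partial>M) - S x0 $ a $ b)\<bar> \<le> \<bar>G $ i $ a * G $ i $ b\<bar> * e"
          unfolding abs_mult[of "G $ i $ a * G $ i $ b"] by (intro mult_left_mono dS abs_ge_zero)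
        then show ?thesis by linarith
      qed
      then show "G $ i $ a * G $ i $ b * (\<integral>w. S (\<theta> n w) $ a $ b \<partial>M)
          \<le> G $ i $ a * G $ i $ b * S x0 $ a $ b + \<bar>G $ i $ a * G $ i $ b\<bar> * e"
        by (simp only: right_diff_distrib)
    qed
    also have "\<dots> = trace (G ** S x0 ** G) + Cg * e"
      by (simp only: trace_sandwich Cg_def sum.distrib sum_distrib_right)
    also have "\<dots> \<le> trace (G ** S x0 ** G) + (Cg * (LS * (2 + B4)) + 1) * real (Suc n) powr (- (\<beta> / 2))"
      by (simp add: e_def distrib_right mult.assoc)
    finally show ?thesis .
  qed
  moreover have "Cg * (LS * (2 + B4)) + 1 > 0" using Cg LS_nonneg B4_nonneg by (intro add_nonneg_pos mult_nonneg_nonneg) auto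
  ultimately show ?thesis by blast
qed


text \<open>In the square of the left side the term of order \<open>s^2\<close> is absorbed by half
  of \<open>2 * s * l\<close>; what is left is the factor \<open>1 - s * l\<close>, at most
  \<open>(1 - s * l / 2)^2\<close>. This uses \<open>s * K^2 \<le> l\<close>, while
  \<open>s * l \<le> 1\<close> keeps the final factor nonnegative.\<close>

lemma hess_contraction: "\<exists>l>0. \<exists>n0. \<forall>n\<ge>n0. \<forall>v. norm (v - gam n *\<^sub>R (H *v v)) \<le> (1 - gam n * l) * norm v"
proof -
  obtain l where l: "l > 0" "\<And>v. v \<bullet> (H *v v) \<ge> l * (norm v)\<^sup>2" using hess_pd by blast
  obtain n0 where n0: "\<And>n. n \<ge> n0 \<Longrightarrow> gam n \<le> min (l / K\<^sup>2) (1 / l)"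
    using gam_eventually_le[of "min (l / K\<^sup>2) (1 / l)"] l K_pos by auto
  have "norm (v - gam n *\<^sub>R (H *v v)) \<le> (1 - gam n * (l / 2)) * norm v" if n: "n \<ge> n0" for n v
  proof (rule power2_le_imp_le)
    define s where "s = gam n"
    have s: "s > 0" "s * K\<^sup>2 \<le> l" "s * l \<le> 1"
      using n0[OF n] gam_pos[of n] l K_pos by (auto simp: s_def field_simps)
    have "norm (H *v v) \<le> K * norm v"
      using norm_matrix_vector_mult_le[of H v] mult_right_mono[OF hess_le[of x0], of "norm v"] by simp
    then have "(norm (H *v v))\<^sup>2 \<le> K\<^sup>2 * (norm v)\<^sup>2"
      using power_mono[of "norm (H *v v)" "K * norm v" 2] by (simp add: power_mult_distrib)
    then have "s\<^sup>2 * (norm (H *v v))\<^sup>2 \<le> s\<^sup>2 * (K\<^sup>2 * (norm v)\<^sup>2)" by (intro mult_left_mono) auto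
    also have "\<dots> = s * (norm v)\<^sup>2 * (s * K\<^sup>2)" by (simp add: power2_eq_square)
    also have "\<dots> \<le> s * (norm v)\<^sup>2 * l" using s by (intro mult_left_mono) auto
    finally have 1: "s\<^sup>2 * (norm (H *v v))\<^sup>2 \<le> s * l * (norm v)\<^sup>2" by (simp add: mult_ac)
    have "s * (l * (norm v)\<^sup>2) \<le> s * (v \<bullet> (H *v v))" using s l by (intro mult_left_mono) auto
    moreover have "(norm (v - s *\<^sub>R (H *v v)))\<^sup>2 = (norm v)\<^sup>2 - 2 * (s * (v \<bullet> (H *v v))) + s\<^sup>2 * (norm (H *v v))\<^sup>2"
      unfolding power2_norm_eq_inner by (simp add: inner_diff_left inner_diff_right inner_commute power2_eq_square)
    ultimately have "(norm (v - s *\<^sub>R (H *v v)))\<^sup>2 \<le> (1 - s * l) * (norm v)\<^sup>2"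
      using 1 by (simp add: algebra_simps)
    also have "\<dots> \<le> (1 - s * (l / 2))\<^sup>2 * (norm v)\<^sup>2"
    proof (rule mult_right_mono)
      have "(1 - s * (l / 2))\<^sup>2 = (1 - s * l) + (s * (l / 2))\<^sup>2" by (simp add: power2_eq_square algebra_simps)
      then show "1 - s * l \<le> (1 - s * (l / 2))\<^sup>2" by simp
    qed simp
    finally show "(norm (v - gam n *\<^sub>R (H *v v)))\<^sup>2 \<le> ((1 - gam n * (l / 2)) * norm v)\<^sup>2"
      by (simp add: s_def power_mult_distrib)
    have "s * (l / 2) \<le> 1" using s by simp
    then show "0 \<le> (1 - gam n * (l / 2)) * norm v" by (simp add: s_def)
  qed
  then show ?thesis using l(1) by (intro exI[of _ "l / 2"] conjI exI[of _ n0]) auto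
qed

text \<open>A weighted product estimate in which \<open>s\<close> balances second moments of order n
  and n^(-2\<beta>): both contributions become n^(1/2-\<beta>), bounded because
  \<open>\<beta> > 1/2\<close>.\<close>

lemma Mart_R_correlation: "\<exists>C>0. \<forall>n. (\<integral>w. norm (Mart n w) * norm (R n w) \<partial>M) \<le> C"
proof -
  obtain CM where CM: "CM > 0" "\<And>n. m2 (Mart n) \<le> CM * real n"
    using Mart_second_moment by blast
  have "(\<integral>w. norm (Mart n w) * norm (R n w) \<partial>M) \<le> CM + L\<^sup>2 * B4" for n
  proof -
    define x where "x = real (Suc n)"
    define s where "s = x powr (- (1/2) - \<beta>)"
    have x: "x \<ge> 1" by (simp add: x_def)
    have s: "s > 0" using x by (simp add: s_def)
    note i = square_integrableD(2)[OF Mart_square_integrable[of n]] square_integrableD(2)[OF R_square_integrable[of n]]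
    have "(\<integral>w. norm (Mart n w) * norm (R n w) \<partial>M) \<le> (\<integral>w. s * (norm (Mart n w))\<^sup>2 + (1 / s) * (norm (R n w))\<^sup>2 \<partial>M)"
    proof (rule integral_mono[OF square_integrable_norm_mult[OF Mart_square_integrable R_square_integrable]])
      show "integrable M (\<lambda>w. s * (norm (Mart n w))\<^sup>2 + (1 / s) * (norm (R n w))\<^sup>2)"
        by (intro Bochner_Integration.integrable_add integrable_mult_right i)
      fix w
      have "(s * norm (Mart n w)) * norm (R n w) \<le> (s * norm (Mart n w))\<^sup>2 + (norm (R n w))\<^sup>2"
        using s by (intro mult_le_sum_squares) auto
      then show "norm (Mart n w) * norm (R n w) \<le> s * (norm (Mart n w))\<^sup>2 + (1 / s) * (norm (R n w))\<^sup>2"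
        using s by (simp add: field_simps power2_eq_square)
    qed
    also have "\<dots> = s * m2 (Mart n) + (1 / s) * m2 (R n)"
      using i by simp
    also have "\<dots> \<le> s * (CM * x) + (1 / s) * (L\<^sup>2 * B4 * (x powr (- \<beta>))\<^sup>2)"
    proof (intro add_mono mult_left_mono)
      have "CM * real n \<le> CM * x" using CM(1) by (intro mult_left_mono) (auto simp: x_def)
      then show "m2 (Mart n) \<le> CM * x" using CM(2)[of n] by linarith
      show "m2 (R n) \<le> L\<^sup>2 * B4 * (x powr (- \<beta>))\<^sup>2"
        unfolding x_def by (rule R_second_moment)
    qed (use s in auto)
    also have "\<dots> = (CM + L\<^sup>2 * B4) * x powr (1/2 - \<beta>)"
    proof -
      have "s * x = x powr (1/2 - \<beta>)"
      proof -
        have "s * x powr 1 = x powr (- (1/2) - \<beta> + 1)" unfolding s_def by (simp only: powr_add)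
        then show ?thesis using x by (simp add: algebra_simps)
      qed
      moreover have "(1 / s) * (x powr (- \<beta>))\<^sup>2 = x powr (1/2 - \<beta>)"
      proof -
        have "1 / s = x powr (1/2 + \<beta>)" unfolding s_def by (simp add: powr_minus_divide[symmetric] add.commute)
        moreover have "(x powr (- \<beta>))\<^sup>2 = x powr (- (2 * \<beta>))" using x by (simp add: powr_power)
        ultimately have "(1 / s) * (x powr (- \<beta>))\<^sup>2 = x powr ((1/2 + \<beta>) + (- (2 * \<beta>)))" by (simp only: powr_add)
        moreover have "(1/2 + \<beta>) + (- (2 * \<beta>)) = 1/2 - \<beta>" by simp
        ultimately show ?thesis by (simp only:)
      qed
      ultimately show ?thesis by (metis (no_types, opaque_lifting) distrib_right mult.assoc mult.commute)
    qed
    also have "\<dots> \<le> (CM + L\<^sup>2 * B4) * 1"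
    proof (rule mult_left_mono)
      show "x powr (1/2 - \<beta>) \<le> 1" using powr_mono[of "1/2 - \<beta>" 0 x] x \<beta>_bounds by simp
    qed (use CM(1) B4_nonneg in simp)
    finally show ?thesis by simp
  qed
  moreover have "CM + L\<^sup>2 * B4 > 0" using CM(1) B4_nonneg by (simp add: add_pos_nonneg)
  ultimately show ?thesis by blast
qed

text \<open>The covariance of \<open>Mart n\<close> and \<open>\<tau> n\<close> obeys the contractive recursion of the linearised
  dynamics with a source term of the size of the step, so it stays bounded. This is what improves the
  rate from \<open>(3 - \<beta>) / 2\<close>, which Cauchy-Schwarz would give, to \<open>2 - \<beta>\<close>.\<close>

lemma Mart_\<tau>_covariance: "\<exists>C\<ge>0. \<forall>n. norm (\<integral>w. Mart n w $ j *\<^sub>R \<tau> n w \<partial>M) \<le> C"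
proof -
  obtain l n0 where l: "l > 0" "\<And>n v. n \<ge> n0 \<Longrightarrow> norm (v - gam n *\<^sub>R (H *v v)) \<le> (1 - gam n * l) * norm v"
    using hess_contraction by blast
  obtain CR where CR: "CR > 0" "\<And>n. (\<integral>w. norm (Mart n w) * norm (R n w) \<partial>M) \<le> CR"
    using Mart_R_correlation by blast
  obtain CD where CD: "CD > 0" "\<And>n. m2 (D (Suc n)) \<le> CD" using D_bound by blast
  define c where "c n = (\<integral>w. Mart n w $ j *\<^sub>R \<tau> n w \<partial>M)" for n
  have step: "norm (c (Suc n)) \<le> (1 - gam n * l) * norm (c n) + gam n * (CR + CD)" if n: "n \<ge> max 1 n0" for n
  proof -
    define s where "s = gam n"
    have s: "s > 0" by (simp add: s_def gam_pos)
    \<comment> \<open>\<open>U\<close> is the part of the next error that is known at time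
      \<open>n\<close>: \<open>\<tau> (Suc n)\<close> is \<open>U\<close> plus \<open>s\<close>
      times the new noise.\<close>
    define U where "U w = \<tau> n w - s *\<^sub>R grad f (\<theta> n w)" for w
    have gradR: "grad f (\<theta> n w) = H *v \<tau> n w + R n w" for w by (simp add: R_def)
    have sqG: "square_integrable M (\<lambda>w. grad f (\<theta> n w))" unfolding gradR
      by (intro square_integrable_add square_integrable_matrix \<tau>_square_integrable R_square_integrable)
    have sqU: "square_integrable M U" unfolding U_def[abs_def]
      by (intro square_integrable_diff square_integrable_scaleR \<tau>_square_integrable sqG)
    have U_ad: "U \<in> borel_measurable (Fl n)" unfolding U_def[abs_def]
      using \<tau>_adapted[of n] grad_\<theta>_adapted[of n] by measurable
    note sq = Mart_square_integrable[of n] D_square_integrable[of n] \<tau>_square_integrable[of n] R_square_integrable[of n]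
    note i1 = square_integrable_component_scaleR[OF sq(1) sq(3), of j]
    note i2 = square_integrable_component_scaleR[OF sq(1) sq(4), of j]
    note i3 = square_integrable_component_scaleR[OF sq(1) sq(2), of j]
    note i4 = square_integrable_component_scaleR[OF sq(2) sqU, of j]
    note i5 = square_integrable_component_scaleR[OF sq(2) sq(2), of j]
    have i1': "integrable M (\<lambda>w. H *v (Mart n w $ j *\<^sub>R \<tau> n w))"
      by (rule integrable_bounded_linear[OF matrix_vector_mul_bounded_linear i1])
    \<comment> \<open>The products of \<open>Mart n\<close> and of \<open>U\<close> with the new
      noise have mean zero. What remains is the contracted old covariance together with a remainder
      term and a squared noise term, both carrying the factor \<open>s\<close>.\<close>
    have eq: "Mart (Suc n) w $ j *\<^sub>R \<tau> (Suc n) w = Mart n w $ j *\<^sub>R \<tau> n w - s *\<^sub>R (H *v (Mart n w $ j *\<^sub>R \<tau> n w))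
        - s *\<^sub>R (Mart n w $ j *\<^sub>R R n w) + s *\<^sub>R (Mart n w $ j *\<^sub>R D (Suc n) w)
        + D (Suc n) w $ j *\<^sub>R U w + s *\<^sub>R (D (Suc n) w $ j *\<^sub>R D (Suc n) w)" for w
      using n by (simp add: Mart_Suc \<tau>_step U_def gradR s_def[symmetric] matrix_vector_mult_scaleR algebra_simps)
    have z1: "(\<integral>w. Mart n w $ j *\<^sub>R D (Suc n) w \<partial>M) = 0"
    proof (rule vec_eq_iff[THEN iffD2], rule allI)
      fix i
      have "(\<integral>w. Mart n w $ j *\<^sub>R D (Suc n) w \<partial>M) $ i = (\<integral>w. (Mart n w $ j *\<^sub>R D (Suc n) w) $ i \<partial>M)"
        by (rule integral_bounded_linear[OF bounded_linear_vec_nth i3, symmetric])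
      then show "(\<integral>w. Mart n w $ j *\<^sub>R D (Suc n) w \<partial>M) $ i = 0 $ i"
        using D_orthogonal_component[OF Mart_adapted sq(1), of j i] by simp
    qed
    have z2: "(\<integral>w. D (Suc n) w $ j *\<^sub>R U w \<partial>M) = 0"
    proof (rule vec_eq_iff[THEN iffD2], rule allI)
      fix i
      have "(\<integral>w. D (Suc n) w $ j *\<^sub>R U w \<partial>M) $ i = (\<integral>w. (D (Suc n) w $ j *\<^sub>R U w) $ i \<partial>M)"
        by (rule integral_bounded_linear[OF bounded_linear_vec_nth i4, symmetric])
      then show "(\<integral>w. D (Suc n) w $ j *\<^sub>R U w \<partial>M) $ i = 0 $ i"
        using D_orthogonal_component[OF U_ad sqU, of i j] by (simp add: mult.commute)
    qed
    have h: "(\<integral>w. H *v (Mart n w $ j *\<^sub>R \<tau> n w) \<partial>M) = H *v c n"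
      unfolding c_def by (rule integral_bounded_linear[OF matrix_vector_mul_bounded_linear i1])
    have "c (Suc n) = c n - s *\<^sub>R (H *v c n) - s *\<^sub>R (\<integral>w. Mart n w $ j *\<^sub>R R n w \<partial>M)
        + s *\<^sub>R (\<integral>w. D (Suc n) w $ j *\<^sub>R D (Suc n) w \<partial>M)"
      unfolding c_def[of "Suc n"] eq using i1 i1' i2 i3 i4 i5
      by (simp add: z1 z2 h c_def[of n, symmetric] del: scaleR_scaleR)
    also have "norm \<dots> \<le> norm (c n - s *\<^sub>R (H *v c n)) + s * norm (\<integral>w. Mart n w $ j *\<^sub>R R n w \<partial>M)
        + s * norm (\<integral>w. D (Suc n) w $ j *\<^sub>R D (Suc n) w \<partial>M)"
    proof -
      have "norm (a - s *\<^sub>R b + s *\<^sub>R e) \<le> norm a + s * norm b + s * norm e" for a b e :: "real^'d"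
        using norm_triangle_ineq[of "a - s *\<^sub>R b" "s *\<^sub>R e"] norm_triangle_ineq4[of a "s *\<^sub>R b"] s by simp
      then show ?thesis .
    qed
    also have "\<dots> \<le> (1 - s * l) * norm (c n) + s * CR + s * CD"
    proof (intro add_mono mult_left_mono)
      show "norm (c n - s *\<^sub>R (H *v c n)) \<le> (1 - s * l) * norm (c n)" using l(2)[of n] n by (simp add: s_def)
      have "norm (\<integral>w. Mart n w $ j *\<^sub>R R n w \<partial>M) \<le> (\<integral>w. norm (Mart n w $ j *\<^sub>R R n w) \<partial>M)"
        by (rule integral_norm_bound)
      also have "\<dots> \<le> (\<integral>w. norm (Mart n w) * norm (R n w) \<partial>M)"
        by (rule integral_mono[OF integrable_norm[OF i2] square_integrable_norm_mult[OF sq(1) sq(4)] norm_component_scaleR_le])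
      finally show "norm (\<integral>w. Mart n w $ j *\<^sub>R R n w \<partial>M) \<le> CR" using CR(2)[of n] by linarith
      have "norm (\<integral>w. D (Suc n) w $ j *\<^sub>R D (Suc n) w \<partial>M) \<le> (\<integral>w. norm (D (Suc n) w $ j *\<^sub>R D (Suc n) w) \<partial>M)"
        by (rule integral_norm_bound)
      also have "\<dots> \<le> (\<integral>w. norm (D (Suc n) w) * norm (D (Suc n) w) \<partial>M)"
        by (rule integral_mono[OF integrable_norm[OF i5] square_integrable_norm_mult[OF sq(2) sq(2)] norm_component_scaleR_le])
      finally show "norm (\<integral>w. D (Suc n) w $ j *\<^sub>R D (Suc n) w \<partial>M) \<le> CD"
        using CD(2)[of n] by (simp add: power2_eq_square)
    qed (use s in auto)
    finally show ?thesis by (simp add: s_def algebra_simps)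
  qed
  \<comment> \<open>The exponent is 0: the source is of the order of the contraction rate itself,
    which yields boundedness without decay.\<close>
  have "\<exists>B\<ge>0. \<forall>n. norm (c n) \<le> B * real (Suc n) powr (- 0)"
  proof (rule contraction_rate[where a=\<beta> and c="\<gamma> * l" and C="\<gamma> * (CR + CD)" and ?n0.0="max 1 n0"])
    fix n assume "n \<ge> max 1 n0"
    then show "norm (c (Suc n)) \<le> (1 - \<gamma> * l * real (Suc n) powr (- \<beta>)) * norm (c n)
        + \<gamma> * (CR + CD) * real (Suc n) powr (- \<beta> - 0)"
      using step[of n] by (simp add: gam_def mult_ac)
  qed (use \<beta>_bounds \<gamma>_pos l(1) CR(1) CD(1) in auto)
  then show ?thesis by (simp add: c_def)
qed

text \<open>The increments after time \<open>k\<close> are orthogonal to \<open>\<tau> k\<close>, so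
  for \<open>k \<le> n\<close> the covariance with \<open>Mart n\<close> equals the one with
  \<open>Mart k\<close>, which is bounded coordinate by coordinate.\<close>

lemma G_Mart_\<tau>_covariance:
  "\<exists>C\<ge>0. \<forall>n k. k \<le> n \<longrightarrow> \<bar>\<integral>w. (G *v Mart n w) \<bullet> (G *v \<tau> k w) \<partial>M\<bar> \<le> C"
proof -
  have "\<exists>C. \<forall>j. C j \<ge> 0 \<and> (\<forall>n. norm (\<integral>w. Mart n w $ j *\<^sub>R \<tau> n w \<partial>M) \<le> C j)"
    using Mart_\<tau>_covariance by (intro choice allI) blast
  then obtain C where C: "\<And>j. C j \<ge> 0" "\<And>j n. norm (\<integral>w. Mart n w $ j *\<^sub>R \<tau> n w \<partial>M) \<le> C j" by blast
  define C' where "C' = (\<Sum>i\<in>UNIV. \<Sum>a\<in>UNIV. \<Sum>b\<in>UNIV. \<bar>G $ i $ a * G $ i $ b\<bar> * C a)"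
  have C': "C' \<ge> 0" unfolding C'_def using C(1) by (intro sum_nonneg mult_nonneg_nonneg) auto
  have diag: "\<bar>\<integral>w. (G *v Mart k w) \<bullet> (G *v \<tau> k w) \<partial>M\<bar> \<le> C'" for k
  proof -
    have eq: "(G *v x) \<bullet> (G *v y) = (\<Sum>i\<in>UNIV. \<Sum>a\<in>UNIV. \<Sum>b\<in>UNIV. G $ i $ a * G $ i $ b * (x $ a * y $ b))"
      for x y :: "real ^ 'd"
      unfolding inner_vec_def by (simp add: matrix_vector_mult_def sum_product mult_ac)
    have i: "integrable M (\<lambda>w. Mart k w $ a * \<tau> k w $ b)" for a b
      by (rule square_integrable_component_mult[OF Mart_square_integrable \<tau>_square_integrable])
    have comp: "\<bar>\<integral>w. Mart k w $ a * \<tau> k w $ b \<partial>M\<bar> \<le> C a" for a b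
    proof -
      have "(\<integral>w. (Mart k w $ a *\<^sub>R \<tau> k w) $ b \<partial>M) = (\<integral>w. Mart k w $ a *\<^sub>R \<tau> k w \<partial>M) $ b"
        by (rule integral_bounded_linear[OF bounded_linear_vec_nth
              square_integrable_component_scaleR[OF Mart_square_integrable \<tau>_square_integrable]])
      then have "\<bar>\<integral>w. Mart k w $ a * \<tau> k w $ b \<partial>M\<bar> \<le> norm (\<integral>w. Mart k w $ a *\<^sub>R \<tau> k w \<partial>M)"
        using component_le_norm_cart[of "\<integral>w. Mart k w $ a *\<^sub>R \<tau> k w \<partial>M" b] by simp
      then show ?thesis using C(2)[of k a] by linarith
    qed
    have "(\<integral>w. (G *v Mart k w) \<bullet> (G *v \<tau> k w) \<partial>M)
        = (\<Sum>i\<in>UNIV. \<Sum>a\<in>UNIV. \<Sum>b\<in>UNIV. G $ i $ a * G $ i $ b * (\<integral>w. Mart k w $ a * \<tau> k w $ b \<partial>M))"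
      unfolding eq using i by (simp add: Bochner_Integration.integral_sum)
    also have "\<bar>\<dots>\<bar> \<le> C'"
      unfolding C'_def
    proof (intro order_trans[OF sum_abs] sum_mono)
      show "\<bar>G $ i $ a * G $ i $ b * (\<integral>w. Mart k w $ a * \<tau> k w $ b \<partial>M)\<bar> \<le> \<bar>G $ i $ a * G $ i $ b\<bar> * C a" for i a b
        unfolding abs_mult[of "G $ i $ a * G $ i $ b"] by (intro mult_left_mono comp abs_ge_zero)
    qed
    finally show ?thesis .
  qed
  have later: "(\<integral>w. (G *v Mart (k + m) w) \<bullet> (G *v \<tau> k w) \<partial>M) = (\<integral>w. (G *v Mart k w) \<bullet> (G *v \<tau> k w) \<partial>M)" for k m
  proof (induction m)
    case (Suc m)
    show ?case
    proof (cases "k + m \<ge> 1")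
      case True
      note sq = square_integrable_matrix[OF Mart_square_integrable[of "k + m"], of G]
        square_integrable_matrix[OF D_square_integrable[of "k + m"], of G]
        square_integrable_matrix[OF \<tau>_square_integrable[of k], of G]
      have "(G *v Mart (k + Suc m) w) \<bullet> (G *v \<tau> k w)
          = (G *v Mart (k + m) w) \<bullet> (G *v \<tau> k w) + (G *v \<tau> k w) \<bullet> (G *v D (Suc (k + m)) w)" for w
        using True by (simp add: Mart_Suc matrix_vector_right_distrib inner_add_left inner_add_right inner_commute)
      then have "(\<integral>w. (G *v Mart (k + Suc m) w) \<bullet> (G *v \<tau> k w) \<partial>M)
          = (\<integral>w. (G *v Mart (k + m) w) \<bullet> (G *v \<tau> k w) \<partial>M) + (\<integral>w. (G *v \<tau> k w) \<bullet> (G *v D (Suc (k + m)) w) \<partial>M)"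
        using square_integrable_inner[OF sq(1) sq(3)] square_integrable_inner[OF sq(3) sq(2)] by simp
      also have "(\<integral>w. (G *v \<tau> k w) \<bullet> (G *v D (Suc (k + m)) w) \<partial>M) = 0"
      proof (rule D_orthogonal_inner[OF _ sq(3)])
        have "\<tau> k \<in> borel_measurable (Fl (k + m))"
          using measurable_from_subalg[OF Fl_mono \<tau>_adapted, of k "k + m"] by simp
        then show "(\<lambda>w. G *v \<tau> k w) \<in> borel_measurable (Fl (k + m))" by (rule matrix_adapted)
      qed
      finally show ?thesis using Suc by simp
    next
      case False
      then show ?thesis by (simp add: Mart_def)
    qed
  qed simp
  show ?thesis
  proof (intro exI[of _ C'] conjI allI impI C')
    fix n k :: nat assume "k \<le> n"
    then show "\<bar>\<integral>w. (G *v Mart n w) \<bullet> (G *v \<tau> k w) \<partial>M\<bar> \<le> C'"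
      using later[of k "n - k"] diag[of k] by simp
  qed
qed

section \<open>Decomposition of the summed errors and the size of its parts\<close>

definition inv_step :: "nat \<Rightarrow> real" where "inv_step k = real (Suc k) powr \<beta> / \<gamma>"

lemma inv_step_gam: "inv_step k * gam k = 1"
  using \<gamma>_pos by (simp add: inv_step_def gam_def powr_minus field_simps)

lemma inv_step_pos: "inv_step k > 0"
  using \<gamma>_pos by (simp add: inv_step_def)

lemma inv_step_less: "k \<ge> 1 \<Longrightarrow> inv_step (k - 1) < inv_step k"
  using \<gamma>_pos \<beta>_bounds by (simp add: inv_step_def divide_strict_right_mono powr_less_mono2)

definition Tel :: "nat \<Rightarrow> 'w \<Rightarrow> real ^ 'd" where
  "Tel n w = (\<Sum>k=1..n. inv_step k *\<^sub>R (\<tau> k w - \<tau> (Suc k) w))"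

definition Rem :: "nat \<Rightarrow> 'w \<Rightarrow> real ^ 'd" where
  "Rem n w = (\<Sum>k=1..n. R k w)"

lemma Tel_eq: "Tel n w = inv_step 0 *\<^sub>R \<tau> 1 w + (\<Sum>k=1..n. (inv_step k - inv_step (k - 1)) *\<^sub>R \<tau> k w) - inv_step n *\<^sub>R \<tau> (Suc n) w"
  unfolding Tel_def by (rule abel_summation)

text \<open>The linearised recursion is solved for \<open>H\<close> times \<open>\<tau> k\<close>
  and summed. The noise carries the index \<open>Suc k\<close>, which turns the sum from 1 to
  \<open>n\<close> into \<open>Mart (Suc n)\<close>.\<close>

lemma decomposition: "(\<Sum>k=1..n. \<tau> k w) = G *v Mart (Suc n) w + (G *v Tel n w - G *v Rem n w)"
proof -
  have "H *v \<tau> k w = D (Suc k) w + inv_step k *\<^sub>R (\<tau> k w - \<tau> (Suc k) w) - R k w" for k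
  proof -
    have "\<tau> k w - \<tau> (Suc k) w = gam k *\<^sub>R (H *v \<tau> k w + R k w - D (Suc k) w)"
      by (simp add: \<tau>_step algebra_simps)
    then have "inv_step k *\<^sub>R (\<tau> k w - \<tau> (Suc k) w) = H *v \<tau> k w + R k w - D (Suc k) w"
      by (simp add: inv_step_gam)
    then show ?thesis by simp
  qed
  then have "H *v (\<Sum>k=1..n. \<tau> k w) = Mart (Suc n) w + Tel n w - Rem n w"
    by (simp add: linear_sum[OF matrix_vector_mul_linear] Mart_def Tel_def Rem_def sum.distrib sum_subtractf atLeastLessThanSuc_atLeastAtMost)
  then have "G *v (H *v (\<Sum>k=1..n. \<tau> k w)) = G *v (Mart (Suc n) w + Tel n w - Rem n w)" by simp
  then show ?thesis
    by (simp add: matrix_vector_mul_assoc G_inv matrix_vector_right_distrib matrix_vector_mult_diff_distrib)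
qed

lemma Tel_square_integrable: "square_integrable M (Tel n)"
  unfolding Tel_def[abs_def]
  by (intro square_integrable_sum square_integrable_scaleR square_integrable_diff \<tau>_square_integrable) auto

lemma Rem_square_integrable: "square_integrable M (Rem n)"
  unfolding Rem_def[abs_def] by (intro square_integrable_sum R_square_integrable) auto

text \<open>The root mean squares of the \<open>R k\<close> are of order k^(-\<beta>) and are added
  by Minkowski's inequality; no cancellation between the remainders is used.\<close>

lemma Rem_second_moment: "\<exists>C\<ge>0. \<forall>n. m2 (Rem n) \<le> C * (real n powr (1 - \<beta>))\<^sup>2"
proof -
  have "m2 (Rem n) \<le> (L\<^sup>2 * B4 / (1 - \<beta>)\<^sup>2) * (real n powr (1 - \<beta>))\<^sup>2" for n
  proof -
    have "m2 (Rem n) \<le> (L\<^sup>2 * B4) * (\<Sum>k=1..n. real (Suc k) powr (- \<beta>))\<^sup>2"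
      unfolding Rem_def
      by (rule second_moment_sum_le) (use R_square_integrable R_second_moment in auto)
    also have "\<dots> \<le> (L\<^sup>2 * B4) * (real n powr (1 - \<beta>) / (1 - \<beta>))\<^sup>2"
    proof (intro mult_left_mono power_mono)
      have "(\<Sum>k=1..n. real (Suc k) powr (- \<beta>)) \<le> (\<Sum>k=1..n. real k powr (- \<beta>))"
        using \<beta>_bounds by (intro sum_mono powr_mono2') auto
      also have "\<dots> \<le> real n powr (1 - \<beta>) / (1 - \<beta>)" using \<beta>_bounds by (intro sum_powr_le) auto
      finally show "(\<Sum>k=1..n. real (Suc k) powr (- \<beta>)) \<le> real n powr (1 - \<beta>) / (1 - \<beta>)" .
    qed (use B4_nonneg in \<open>auto intro!: sum_nonneg\<close>)
    finally show ?thesis by (simp add: power_divide)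
  qed
  then show ?thesis using B4_nonneg by (intro exI[of _ "L\<^sup>2 * B4 / (1 - \<beta>)\<^sup>2"]) auto
qed

text \<open>Abel summation leaves two boundary terms and the weighted sum \<open>Mid\<close>. The
  last boundary term has root mean square of order n^\<beta> n^(-\<beta>/2), and Minkowski's
  inequality gives the same order for \<open>Mid\<close>.\<close>

lemma Tel_second_moment: "\<exists>C\<ge>0. \<forall>n. m2 (Tel n) \<le> C * real (Suc n) powr \<beta>"
proof -
  define Mid where "Mid n w = (\<Sum>k=1..n. (inv_step k - inv_step (k - 1)) *\<^sub>R \<tau> k w)" for n w
  have sqMid: "square_integrable M (Mid n)" for n unfolding Mid_def[abs_def]
    by (intro square_integrable_sum square_integrable_scaleR \<tau>_square_integrable) auto
  have B: "1 + B4 \<ge> 0" using B4_nonneg by simp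
  have scaled: "(\<integral>w. (norm (a *\<^sub>R \<tau> k w))\<^sup>2 \<partial>M) \<le> (1 + B4) * (a * real (Suc k) powr (- (\<beta> / 2)))\<^sup>2" for a k
  proof -
    have "(\<integral>w. (norm (a *\<^sub>R \<tau> k w))\<^sup>2 \<partial>M) = a\<^sup>2 * m2 (\<tau> k)"
      by (simp add: power_mult_distrib)
    also have "\<dots> \<le> a\<^sup>2 * ((1 + B4) * real (Suc k) powr (- \<beta>))" by (intro mult_left_mono \<tau>_second_moment) auto
    also have "real (Suc k) powr (- \<beta>) = (real (Suc k) powr (- (\<beta> / 2)))\<^sup>2" by (simp add: powr_power)
    finally show ?thesis by (simp add: power_mult_distrib mult_ac)
  qed
  have mid: "m2 (Mid n) \<le> (1 + B4) * (4 / \<gamma>\<^sup>2) * real (Suc n) powr \<beta>" for n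
  proof -
    define c where "c k = (inv_step k - inv_step (k - 1)) * real (Suc k) powr (- (\<beta> / 2))" for k
    have cpos: "c k > 0" if "k \<in> {1..n}" for k
      using that inv_step_less[of k] by (simp add: c_def)
    have "m2 (Mid n) \<le> (1 + B4) * (\<Sum>k=1..n. c k)\<^sup>2"
      unfolding Mid_def
      by (rule second_moment_sum_le) (use cpos scaled in \<open>auto simp: c_def intro!: square_integrable_scaleR \<tau>_square_integrable\<close>)
    also have "\<dots> \<le> (1 + B4) * (2 / \<gamma> * real (Suc n) powr (\<beta> / 2))\<^sup>2"
    proof (intro mult_left_mono power_mono B)
      \<comment> \<open>With \<open>A\<close> and \<open>b\<close> the powers \<beta>/2 of
        \<open>k + 1\<close> and \<open>k\<close>, the weight is \<open>(A^2 - b^2) / A\<close> over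
        \<open>\<gamma>\<close>, and this quotient is at most \<open>2 * (A - b)\<close>, which
        telescopes.\<close>
      have "c k \<le> 2 / \<gamma> * (real (Suc k) powr (\<beta> / 2) - real k powr (\<beta> / 2))" if k: "k \<in> {1..n}" for k
      proof -
        define A where "A = real (Suc k) powr (\<beta> / 2)"
        define b where "b = real k powr (\<beta> / 2)"
        have A: "A > 0" by (simp add: A_def)
        have bA: "0 \<le> b" "b \<le> A" using \<beta>_bounds by (auto simp: A_def b_def intro!: powr_mono2)
        have "inv_step k - inv_step (k - 1) = (A\<^sup>2 - b\<^sup>2) / \<gamma>"
          using k by (simp add: inv_step_def A_def b_def powr_power diff_divide_distrib)
        moreover have "real (Suc k) powr (- (\<beta> / 2)) = 1 / A" by (simp add: A_def powr_minus_divide)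
        ultimately have "c k = (A\<^sup>2 - b\<^sup>2) / \<gamma> * (1 / A)" by (simp only: c_def)
        then have "c k = (A - b) * ((A + b) / A) / \<gamma>"
          using A \<gamma>_pos by (simp add: power2_eq_square field_simps)
        also have "\<dots> \<le> (A - b) * 2 / \<gamma>"
          using A bA \<gamma>_pos by (intro divide_right_mono mult_left_mono) (auto simp: divide_le_eq)
        finally show ?thesis by (simp add: A_def b_def mult.commute)
      qed
      then have "(\<Sum>k=1..n. c k) \<le> (\<Sum>k=1..n. 2 / \<gamma> * (real (Suc k) powr (\<beta> / 2) - real k powr (\<beta> / 2)))"
        by (rule sum_mono)
      also have "\<dots> = 2 / \<gamma> * (\<Sum>k=1..n. real (Suc k) powr (\<beta> / 2) - real k powr (\<beta> / 2))"
        by (simp add: sum_distrib_left)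
      also have "(\<Sum>k=1..n. real (Suc k) powr (\<beta> / 2) - real k powr (\<beta> / 2)) = real (Suc n) powr (\<beta> / 2) - 1"
        by (induction n) simp_all
      also have "2 / \<gamma> * (real (Suc n) powr (\<beta> / 2) - 1) \<le> 2 / \<gamma> * real (Suc n) powr (\<beta> / 2)"
        using \<gamma>_pos by (intro mult_left_mono) auto
      finally show "(\<Sum>k=1..n. c k) \<le> 2 / \<gamma> * real (Suc n) powr (\<beta> / 2)" .
      show "0 \<le> (\<Sum>k=1..n. c k)" using cpos by (intro sum_nonneg less_imp_le) auto
    qed
    also have "\<dots> = (1 + B4) * (4 / \<gamma>\<^sup>2) * real (Suc n) powr \<beta>"
      by (simp add: power_mult_distrib power_divide powr_power)
    finally show ?thesis .
  qed
  define C where "C = 4 * ((1 + B4) * (inv_step 0)\<^sup>2) + 4 * ((1 + B4) * (4 / \<gamma>\<^sup>2)) + 2 * ((1 + B4) / \<gamma>\<^sup>2)"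
  have C: "C \<ge> 0" using B4_nonneg unfolding C_def by (intro add_nonneg_nonneg mult_nonneg_nonneg divide_nonneg_nonneg) auto
  have "m2 (Tel n) \<le> C * real (Suc n) powr \<beta>" for n
  proof -
    define x where "x = real (Suc n)"
    have x1: "x powr \<beta> \<ge> 1" using \<beta>_bounds by (simp add: x_def ge_one_powr_ge_zero)
    define X where "X w = inv_step 0 *\<^sub>R \<tau> 1 w" for w
    define Y where "Y w = (- inv_step n) *\<^sub>R \<tau> (Suc n) w" for w
    have sqX: "square_integrable M X" and sqY: "square_integrable M Y"
      unfolding X_def[abs_def] Y_def[abs_def] by (intro square_integrable_scaleR \<tau>_square_integrable)+
    have pw: "(norm (Tel n w))\<^sup>2 \<le> 4 * (norm (X w))\<^sup>2 + 4 * (norm (Mid n w))\<^sup>2 + 2 * (norm (Y w))\<^sup>2" for w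
    proof -
      have "Tel n w = (X w + Mid n w) + Y w" by (simp add: Tel_eq X_def Y_def Mid_def)
      then show ?thesis using norm_add_sq_le[of "X w + Mid n w" "Y w"] norm_add_sq_le[of "X w" "Mid n w"] by simp
    qed
    note i = square_integrableD(2)[OF sqX] square_integrableD(2)[OF sqMid[of n]] square_integrableD(2)[OF sqY]
    have "m2 (Tel n) \<le> (\<integral>w. 4 * (norm (X w))\<^sup>2 + 4 * (norm (Mid n w))\<^sup>2 + 2 * (norm (Y w))\<^sup>2 \<partial>M)"
      by (rule integral_mono[OF square_integrableD(2)[OF Tel_square_integrable] _ pw])
         (intro Bochner_Integration.integrable_add integrable_mult_right i)
    also have "\<dots> = 4 * m2 X + 4 * m2 (Mid n) + 2 * m2 Y"
      using i by simp
    also have "\<dots> \<le> 4 * ((1 + B4) * (inv_step 0)\<^sup>2 * x powr \<beta>) + 4 * ((1 + B4) * (4 / \<gamma>\<^sup>2) * x powr \<beta>)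
        + 2 * ((1 + B4) / \<gamma>\<^sup>2 * x powr \<beta>)"
    proof (intro add_mono mult_left_mono)
      have "(inv_step 0 * real (Suc 1) powr (- (\<beta> / 2)))\<^sup>2 \<le> (inv_step 0 * 1)\<^sup>2"
        using powr_mono[of "- (\<beta> / 2)" 0 "real (Suc 1)"] \<beta>_bounds inv_step_pos[of 0]
        by (intro power_mono mult_left_mono) auto
      then have "(1 + B4) * (inv_step 0 * real (Suc 1) powr (- (\<beta> / 2)))\<^sup>2 \<le> (1 + B4) * (inv_step 0 * 1)\<^sup>2"
        using B by (intro mult_left_mono)
      then have "m2 X \<le> (1 + B4) * (inv_step 0 * 1)\<^sup>2"
        unfolding X_def by (rule order_trans[OF scaled])
      then have "m2 X \<le> (1 + B4) * (inv_step 0)\<^sup>2" by simp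
      also have "\<dots> \<le> (1 + B4) * (inv_step 0)\<^sup>2 * x powr \<beta>"
        using mult_left_mono[OF x1, of "(1 + B4) * (inv_step 0)\<^sup>2"] B by simp
      finally show "m2 X \<le> (1 + B4) * (inv_step 0)\<^sup>2 * x powr \<beta>" .
      show "m2 (Mid n) \<le> (1 + B4) * (4 / \<gamma>\<^sup>2) * x powr \<beta>" unfolding x_def by (rule mid)
      have "(- inv_step n * real (Suc (Suc n)) powr (- (\<beta> / 2)))\<^sup>2 \<le> (inv_step n * x powr (- (\<beta> / 2)))\<^sup>2"
      proof -
        have "real (Suc (Suc n)) powr (- (\<beta> / 2)) \<le> x powr (- (\<beta> / 2))"
          using \<beta>_bounds by (intro powr_mono2') (auto simp: x_def)
        then have "(inv_step n * real (Suc (Suc n)) powr (- (\<beta> / 2)))\<^sup>2 \<le> (inv_step n * x powr (- (\<beta> / 2)))\<^sup>2"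
          using inv_step_pos[of n] by (intro power_mono mult_left_mono) auto
        then show ?thesis by simp
      qed
      also have "(inv_step n * x powr (- (\<beta> / 2)))\<^sup>2 = 1 / \<gamma>\<^sup>2 * x powr \<beta>"
      proof -
        have "inv_step n * x powr (- (\<beta> / 2)) = (x powr \<beta> * x powr (- (\<beta> / 2))) / \<gamma>" by (simp add: inv_step_def x_def)
        also have "x powr \<beta> * x powr (- (\<beta> / 2)) = x powr (\<beta> / 2)" by (simp add: powr_add[symmetric])
        finally show ?thesis by (simp add: power_divide x_def powr_power)
      qed
      finally have "(1 + B4) * (- inv_step n * real (Suc (Suc n)) powr (- (\<beta> / 2)))\<^sup>2 \<le> (1 + B4) * (1 / \<gamma>\<^sup>2 * x powr \<beta>)"
        using B by (intro mult_left_mono)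
      then show "m2 Y \<le> (1 + B4) / \<gamma>\<^sup>2 * x powr \<beta>"
        using scaled[of "- inv_step n" "Suc n"] unfolding Y_def by simp
    qed auto
    also have "\<dots> = C * x powr \<beta>" by (simp add: C_def algebra_simps)
    finally show ?thesis by (simp add: x_def)
  qed
  then show ?thesis using C by blast
qed

text \<open>All covariances share one bound, so only the total mass of the Abel weights counts. As
  \<open>inv_step\<close> increases, boundary terms and differences add up to
  \<open>2 * inv_step n\<close>, which is of order n^\<beta>.\<close>

lemma Mart_Tel_correlation:
  "\<exists>C\<ge>0. \<forall>n. (\<integral>w. (G *v Mart (Suc n) w) \<bullet> (G *v Tel n w) \<partial>M) \<le> C * real (Suc n) powr \<beta>"
proof -
  obtain C where C: "C \<ge> 0" "\<And>n k. k \<le> n \<Longrightarrow> \<bar>\<integral>w. (G *v Mart n w) \<bullet> (G *v \<tau> k w) \<partial>M\<bar> \<le> C"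
    using G_Mart_\<tau>_covariance by blast
  have "(\<integral>w. (G *v Mart (Suc n) w) \<bullet> (G *v Tel n w) \<partial>M) \<le> (2 * C / \<gamma>) * real (Suc n) powr \<beta>" for n
  proof -
    define I where "I k = (\<integral>w. (G *v Mart (Suc n) w) \<bullet> (G *v \<tau> k w) \<partial>M)" for k
    have Ib: "\<bar>I k\<bar> \<le> C" if "k \<le> Suc n" for k unfolding I_def by (rule C(2)[OF that])
    have i: "integrable M (\<lambda>w. (G *v Mart (Suc n) w) \<bullet> (G *v \<tau> k w))" for k
      by (intro square_integrable_inner square_integrable_matrix Mart_square_integrable \<tau>_square_integrable)
    define d where "d k = inv_step k - inv_step (k - 1)" for k
    have d: "d k \<ge> 0" if "k \<in> {1..n}" for k using that inv_step_less[of k] by (simp add: d_def)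
    have eq: "(G *v Mart (Suc n) w) \<bullet> (G *v Tel n w) = inv_step 0 * ((G *v Mart (Suc n) w) \<bullet> (G *v \<tau> 1 w))
        + (\<Sum>k=1..n. d k * ((G *v Mart (Suc n) w) \<bullet> (G *v \<tau> k w))) - inv_step n * ((G *v Mart (Suc n) w) \<bullet> (G *v \<tau> (Suc n) w))" for w
      unfolding Tel_eq d_def[symmetric]
      by (simp add: matrix_vector_right_distrib matrix_vector_mult_diff_distrib matrix_vector_mult_scaleR
          linear_sum[OF matrix_vector_mul_linear] inner_add_right inner_diff_right inner_sum_right)
    have "(\<integral>w. (G *v Mart (Suc n) w) \<bullet> (G *v Tel n w) \<partial>M) = inv_step 0 * I 1 + (\<Sum>k=1..n. d k * I k) - inv_step n * I (Suc n)"
      unfolding eq I_def using i by (simp add: Bochner_Integration.integral_sum)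
    also have "\<dots> \<le> inv_step 0 * C + (\<Sum>k=1..n. d k * C) + inv_step n * C"
    proof -
      have "inv_step 0 * I 1 \<le> inv_step 0 * C" using Ib[of 1] inv_step_pos[of 0] by (intro mult_left_mono) (auto simp: abs_le_iff)
      moreover have "(\<Sum>k=1..n. d k * I k) \<le> (\<Sum>k=1..n. d k * C)"
        using Ib d by (intro sum_mono mult_left_mono) (auto simp: abs_le_iff)
      moreover have "inv_step n * (- I (Suc n)) \<le> inv_step n * C"
        using Ib[of "Suc n"] inv_step_pos[of n] by (intro mult_left_mono) (auto simp: abs_le_iff)
      ultimately show ?thesis by simp
    qed
    also have "(\<Sum>k=1..n. d k * C) = (inv_step n - inv_step 0) * C"
    proof -
      have "(\<Sum>k=1..n. d k) = inv_step n - inv_step 0" by (induction n) (simp_all add: d_def)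
      then show ?thesis by (simp add: sum_distrib_right[symmetric])
    qed
    also have "inv_step 0 * C + (inv_step n - inv_step 0) * C + inv_step n * C = (2 * C / \<gamma>) * real (Suc n) powr \<beta>"
      by (simp add: inv_step_def algebra_simps)
    finally show ?thesis .
  qed
  then show ?thesis using C(1) \<gamma>_pos by (intro exI[of _ "2 * C / \<gamma>"]) auto
qed

lemma G_second_moment_le:
  assumes "square_integrable M X"
  shows "m2 (\<lambda>w. G *v X w) \<le> (norm G)\<^sup>2 * m2 X"
proof -
  have "m2 (\<lambda>w. G *v X w) \<le> (\<integral>w. (norm G)\<^sup>2 * (norm (X w))\<^sup>2 \<partial>M)"
  proof (rule integral_mono)
    show "integrable M (\<lambda>w. (norm (G *v X w))\<^sup>2)"
      using square_integrableD(2)[OF square_integrable_matrix[OF assms]] .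
    show "integrable M (\<lambda>w. (norm G)\<^sup>2 * (norm (X w))\<^sup>2)"
      by (intro integrable_mult_right square_integrableD(2)[OF assms])
    show "(norm (G *v X w))\<^sup>2 \<le> (norm G)\<^sup>2 * (norm (X w))\<^sup>2" for w
      using power_mono[OF norm_matrix_vector_mult_le[of G "X w"], of 2] by (simp add: power_mult_distrib)
  qed
  then show ?thesis by simp
qed

text \<open>The square of \<open>X + (Y - Z)\<close> is expanded, with \<open>X\<close> the
  martingale, \<open>Y\<close> the telescoping part and \<open>Z\<close> the remainder. The leading
  term comes from \<open>X\<close> alone; \<open>X\<close> against \<open>Y\<close> uses the bounded
  covariances, \<open>X\<close> against \<open>Z\<close> a weighted product estimate.\<close>

lemma sum_\<tau>_second_moment:
  "\<exists>C\<ge>0. \<forall>n\<ge>1. m2 (\<lambda>w. \<Sum>k=1..n. \<tau> k w)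
     \<le> real n * trace (G ** S x0 ** G) + C * (real n powr (3/2 - \<beta>) + real n powr \<beta>)"
proof -
  obtain C1 where C1: "C1 > 0" "\<And>n. m2 (\<lambda>w. G *v D (Suc n) w) \<le> trace (G ** S x0 ** G) + C1 * real (Suc n) powr (- (\<beta> / 2))"
    using G_D_second_moment by blast
  obtain C2 where C2: "C2 \<ge> 0" "\<And>n. (\<integral>w. (G *v Mart (Suc n) w) \<bullet> (G *v Tel n w) \<partial>M) \<le> C2 * real (Suc n) powr \<beta>"
    using Mart_Tel_correlation by blast
  obtain C3 where C3: "C3 \<ge> 0" "\<And>n. m2 (Tel n) \<le> C3 * real (Suc n) powr \<beta>"
    using Tel_second_moment by blast
  obtain C4 where C4: "C4 \<ge> 0" "\<And>n. m2 (Rem n) \<le> C4 * (real n powr (1 - \<beta>))\<^sup>2"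
    using Rem_second_moment by blast
  obtain C5 where C5: "C5 > 0" "\<And>n. m2 (Mart n) \<le> C5 * real n"
    using Mart_second_moment by blast
  define g where "g = (norm G)\<^sup>2"
  have g: "g \<ge> 0" by (simp add: g_def)
  define T where "T = trace (G ** S x0 ** G)"
  define Ca where "Ca = C1 / (1 - \<beta> / 2) + 2 * g * C5 + 3 * (g * C4)"
  define Cb where "Cb = 4 * C2 + 4 * (g * C3)"
  have Ca: "Ca \<ge> 0" using C1 C4 C5 g \<beta>_bounds by (simp add: Ca_def)
  have Cb: "Cb \<ge> 0" using C2 C3 g by (simp add: Cb_def)
  have main: "m2 (\<lambda>w. \<Sum>k=1..n. \<tau> k w) \<le> real n * T + Ca * real n powr (3/2 - \<beta>) + Cb * real n powr \<beta>" if n: "n \<ge> 1" for n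
  proof -
    define x where "x = real n"
    have x: "x \<ge> 1" using n by (simp add: x_def)
    have xs: "real (Suc n) \<le> 2 * x" using n by (simp add: x_def)
    have xb: "real (Suc n) powr \<beta> \<le> 2 * x powr \<beta>"
    proof -
      have "real (Suc n) powr \<beta> \<le> (2 * x) powr \<beta>" using xs \<beta>_bounds by (intro powr_mono2) auto
      also have "\<dots> = 2 powr \<beta> * x powr \<beta>" using x by (simp add: powr_mult)
      also have "\<dots> \<le> 2 powr 1 * x powr \<beta>" using \<beta>_bounds by (intro mult_right_mono powr_mono) auto
      finally show ?thesis by simp
    qed
    \<comment> \<open>This weight balances s n against n^(2-2\<beta>)/s; both equal
      n^(3/2-\<beta>).\<close>
    define s where "s = x powr (1/2 - \<beta>)"
    have s: "s > 0" using x by (simp add: s_def)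
    define X where "X w = G *v Mart (Suc n) w" for w
    define Y where "Y w = G *v Tel n w" for w
    define Z where "Z w = G *v Rem n w" for w
    have sqX: "square_integrable M X" and sqY: "square_integrable M Y" and sqZ: "square_integrable M Z"
      unfolding X_def[abs_def] Y_def[abs_def] Z_def[abs_def]
      by (intro square_integrable_matrix Mart_square_integrable Tel_square_integrable Rem_square_integrable)+
    note i = square_integrableD(2)[OF sqX] square_integrableD(2)[OF sqY] square_integrableD(2)[OF sqZ]
      square_integrable_inner[OF sqX sqY]
    have pw: "(norm (\<Sum>k=1..n. \<tau> k w))\<^sup>2 \<le> (norm (X w))\<^sup>2 + 2 * (X w \<bullet> Y w) + s * (norm (X w))\<^sup>2
        + (1 / s) * (norm (Z w))\<^sup>2 + 2 * (norm (Y w))\<^sup>2 + 2 * (norm (Z w))\<^sup>2" for w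
    proof -
      have "(norm (\<Sum>k=1..n. \<tau> k w))\<^sup>2 = (norm (X w + (Y w - Z w)))\<^sup>2"
        unfolding decomposition X_def Y_def Z_def ..
      also have "\<dots> = (norm (X w))\<^sup>2 + 2 * (X w \<bullet> Y w) - 2 * (X w \<bullet> Z w) + (norm (Y w - Z w))\<^sup>2"
        unfolding power2_norm_eq_inner by (simp add: inner_add_left inner_add_right inner_diff_left inner_diff_right inner_commute)
      finally have 1: "(norm (\<Sum>k=1..n. \<tau> k w))\<^sup>2
          = (norm (X w))\<^sup>2 + 2 * (X w \<bullet> Y w) - 2 * (X w \<bullet> Z w) + (norm (Y w - Z w))\<^sup>2" .
      have 2: "(norm (Y w - Z w))\<^sup>2 \<le> 2 * (norm (Y w))\<^sup>2 + 2 * (norm (Z w))\<^sup>2"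
        using norm_add_sq_le[of "Y w" "- Z w"] by simp
      have 3: "- 2 * (X w \<bullet> Z w) \<le> s * (norm (X w))\<^sup>2 + (1 / s) * (norm (Z w))\<^sup>2"
      proof -
        have "2 * (s * norm (X w)) * norm (Z w) \<le> (s * norm (X w))\<^sup>2 + (norm (Z w))\<^sup>2"
          by (rule sum_squares_bound)
        then have "2 * (norm (X w) * norm (Z w)) \<le> s * (norm (X w))\<^sup>2 + (1 / s) * (norm (Z w))\<^sup>2"
          using s by (simp add: field_simps power2_eq_square)
        moreover have "- (X w \<bullet> Z w) \<le> norm (X w) * norm (Z w)"
          using Cauchy_Schwarz_ineq2[of "X w" "Z w"] by (simp add: abs_le_iff)
        ultimately show ?thesis by linarith
      qed
      show ?thesis using 1 2 3 by linarith
    qed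
    have sq: "square_integrable M (\<lambda>w. \<Sum>k=1..n. \<tau> k w)"
      by (intro square_integrable_sum \<tau>_square_integrable) auto
    have "m2 (\<lambda>w. \<Sum>k=1..n. \<tau> k w) \<le> (\<integral>w. (norm (X w))\<^sup>2 + 2 * (X w \<bullet> Y w) + s * (norm (X w))\<^sup>2
        + (1 / s) * (norm (Z w))\<^sup>2 + 2 * (norm (Y w))\<^sup>2 + 2 * (norm (Z w))\<^sup>2 \<partial>M)"
      by (rule integral_mono[OF square_integrableD(2)[OF sq] _ pw])
         (intro Bochner_Integration.integrable_add integrable_mult_right i)
    also have "\<dots> = m2 X + 2 * (\<integral>w. X w \<bullet> Y w \<partial>M) + s * m2 X
        + (1 / s) * m2 Z + 2 * m2 Y + 2 * m2 Z"
      using i by simp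
    also have "\<dots> \<le> (x * T + C1 / (1 - \<beta> / 2) * x powr (3/2 - \<beta>)) + 2 * (C2 * (2 * x powr \<beta>)) + 2 * g * C5 * x powr (3/2 - \<beta>)
        + g * C4 * x powr (3/2 - \<beta>) + 2 * (g * (C3 * (2 * x powr \<beta>))) + 2 * (g * (C4 * x powr (3/2 - \<beta>)))"
    proof (intro add_mono)
      have "m2 X = (\<Sum>j\<in>{1..<Suc n}. m2 (\<lambda>w. G *v D (Suc j) w))"
        unfolding X_def by (rule Mart_second_moment_eq)
      also have "\<dots> \<le> (\<Sum>j\<in>{1..<Suc n}. T + C1 * real j powr (- (\<beta> / 2)))"
      proof (rule sum_mono)
        fix j assume j: "j \<in> {1..<Suc n}"
        then have "real (Suc j) powr (- (\<beta> / 2)) \<le> real j powr (- (\<beta> / 2))" using \<beta>_bounds by (intro powr_mono2') auto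
        then have "C1 * real (Suc j) powr (- (\<beta> / 2)) \<le> C1 * real j powr (- (\<beta> / 2))" using C1(1) by (intro mult_left_mono) auto
        then show "m2 (\<lambda>w. G *v D (Suc j) w) \<le> T + C1 * real j powr (- (\<beta> / 2))"
          using C1(2)[of j] unfolding T_def by linarith
      qed
      also have "\<dots> = x * T + C1 * (\<Sum>j=1..n. real j powr (- (\<beta> / 2)))"
        by (simp add: sum.distrib sum_distrib_left x_def atLeastLessThanSuc_atLeastAtMost)
      also have "\<dots> \<le> x * T + C1 * (x powr (3/2 - \<beta>) / (1 - \<beta> / 2))"
      proof (intro add_left_mono mult_left_mono)
        have "(\<Sum>j=1..n. real j powr (- (\<beta> / 2))) \<le> x powr (1 - \<beta> / 2) / (1 - \<beta> / 2)"
          unfolding x_def using \<beta>_bounds by (intro sum_powr_le) auto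
        \<comment> \<open>As \<open>\<beta> < 1\<close>, evaluating \<open>S\<close> at
          \<open>x0\<close> instead of the iterates costs no more than the product of martingale and
          remainder.\<close>
        also have "\<dots> \<le> x powr (3/2 - \<beta>) / (1 - \<beta> / 2)"
          using \<beta>_bounds x by (intro divide_right_mono powr_mono) (auto simp: field_simps)
        finally show "(\<Sum>j=1..n. real j powr (- (\<beta> / 2))) \<le> x powr (3/2 - \<beta>) / (1 - \<beta> / 2)" .
      qed (use C1 in simp)
      finally show "m2 X \<le> x * T + C1 / (1 - \<beta> / 2) * x powr (3/2 - \<beta>)" by simp
      have "(\<integral>w. X w \<bullet> Y w \<partial>M) \<le> C2 * real (Suc n) powr \<beta>" unfolding X_def Y_def by (rule C2(2))
      also have "\<dots> \<le> C2 * (2 * x powr \<beta>)" by (intro mult_left_mono xb C2(1))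
      finally show "2 * (\<integral>w. X w \<bullet> Y w \<partial>M) \<le> 2 * (C2 * (2 * x powr \<beta>))" by simp
      have "m2 X \<le> g * m2 (Mart (Suc n))"
        unfolding X_def g_def by (rule G_second_moment_le[OF Mart_square_integrable])
      also have "\<dots> \<le> g * (C5 * (2 * x))"
      proof (intro mult_left_mono g)
        have "C5 * real (Suc n) \<le> C5 * (2 * x)" using C5(1) xs by (intro mult_left_mono) auto
        then show "m2 (Mart (Suc n)) \<le> C5 * (2 * x)" using C5(2)[of "Suc n"] by linarith
      qed
      finally have "s * m2 X \<le> s * (g * (C5 * (2 * x)))" using s by (intro mult_left_mono) auto
      also have "\<dots> = 2 * g * C5 * (s * x powr 1)" using x by simp
      also have "s * x powr 1 = x powr (3/2 - \<beta>)" 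
      proof -
        have "(1/2 - \<beta>) + 1 = 3/2 - \<beta>" by simp
        then show ?thesis by (simp only: s_def powr_add[symmetric])
      qed
      finally show "s * m2 X \<le> 2 * g * C5 * x powr (3/2 - \<beta>)" .
      have Zb: "m2 Z \<le> g * (C4 * x powr (2 - 2 * \<beta>))"
      proof -
        have "m2 Z \<le> g * m2 (Rem n)"
          unfolding Z_def g_def by (rule G_second_moment_le[OF Rem_square_integrable])
        also have "\<dots> \<le> g * (C4 * (x powr (1 - \<beta>))\<^sup>2)" unfolding x_def by (intro mult_left_mono g C4(2))
        also have "(x powr (1 - \<beta>))\<^sup>2 = x powr (2 - 2 * \<beta>)" using x by (simp add: powr_power algebra_simps)
        finally show ?thesis .
      qed
      have "(1 / s) * m2 Z \<le> (1 / s) * (g * (C4 * x powr (2 - 2 * \<beta>)))"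
        using s Zb by (intro mult_left_mono) auto
      also have "\<dots> = g * C4 * (x powr (- (1/2 - \<beta>)) * x powr (2 - 2 * \<beta>))"
        by (simp only: s_def powr_minus_divide) simp
      also have "x powr (- (1/2 - \<beta>)) * x powr (2 - 2 * \<beta>) = x powr (3/2 - \<beta>)" by (simp add: powr_add[symmetric])
      finally show "(1 / s) * m2 Z \<le> g * C4 * x powr (3/2 - \<beta>)" .
      have "m2 Y \<le> g * m2 (Tel n)"
        unfolding Y_def g_def by (rule G_second_moment_le[OF Tel_square_integrable])
      also have "\<dots> \<le> g * (C3 * real (Suc n) powr \<beta>)" by (intro mult_left_mono g C3(2))
      also have "\<dots> \<le> g * (C3 * (2 * x powr \<beta>))" by (intro mult_left_mono xb g C3(1))
      finally show "2 * m2 Y \<le> 2 * (g * (C3 * (2 * x powr \<beta>)))" by (intro mult_left_mono) auto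
      \<comment> \<open>As \<open>\<beta> > 1/2\<close>, the square of the remainder is no larger
        than its product with the martingale.\<close>
      have "x powr (2 - 2 * \<beta>) \<le> x powr (3/2 - \<beta>)" using x \<beta>_bounds by (intro powr_mono) auto
      then have "g * (C4 * x powr (2 - 2 * \<beta>)) \<le> g * (C4 * x powr (3/2 - \<beta>))" by (intro mult_left_mono g C4(1))
      then show "2 * m2 Z \<le> 2 * (g * (C4 * x powr (3/2 - \<beta>)))" using Zb by simp
    qed
    also have "\<dots> = x * T + Ca * x powr (3/2 - \<beta>) + Cb * x powr \<beta>"
      by (simp add: Ca_def Cb_def algebra_simps)
    finally show ?thesis by (simp add: x_def)
  qed
  show ?thesis
  proof (intro exI[of _ "Ca + Cb"] conjI allI impI)
    fix n :: nat assume n: "n \<ge> 1"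
    have "0 \<le> Cb * real n powr (3/2 - \<beta>)" "0 \<le> Ca * real n powr \<beta>" using Ca Cb by simp_all
    then show "m2 (\<lambda>w. \<Sum>k=1..n. \<tau> k w)
     \<le> real n * trace (G ** S x0 ** G) + (Ca + Cb) * (real n powr (3/2 - \<beta>) + real n powr \<beta>)"
      using main[OF n] unfolding T_def by (simp add: algebra_simps)
  qed (use Ca Cb in simp)
qed

theorem rp_average_bound:
  "\<exists>C. \<forall>n\<ge>1. integrable M (\<lambda>w. (norm (rp_average \<theta> n w - x0))\<^sup>2) \<and>
     (\<integral>w. (norm (rp_average \<theta> n w - x0))\<^sup>2 \<partial>M)
       \<le> trace (G ** S x0 ** G) / real n + C * real n powr (- min (\<beta> + 1/2) (2 - \<beta>))"
proof -
  obtain C where C: "C \<ge> 0" "\<And>n. n \<ge> 1 \<Longrightarrow> m2 (\<lambda>w. \<Sum>k=1..n. \<tau> k w)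
     \<le> real n * trace (G ** S x0 ** G) + C * (real n powr (3/2 - \<beta>) + real n powr \<beta>)"
    using sum_\<tau>_second_moment by blast
  have "integrable M (\<lambda>w. (norm (rp_average \<theta> n w - x0))\<^sup>2) \<and>
     (\<integral>w. (norm (rp_average \<theta> n w - x0))\<^sup>2 \<partial>M)
       \<le> trace (G ** S x0 ** G) / real n + 2 * C * real n powr (- min (\<beta> + 1/2) (2 - \<beta>))" if n: "n \<ge> 1" for n
  proof -
    define x where "x = real n"
    have x: "x \<ge> 1" using n by (simp add: x_def)
    have eq: "rp_average \<theta> n w - x0 = (1 / x) *\<^sub>R (\<Sum>k=1..n. \<tau> k w)" for w
    proof -
      have "(\<Sum>k=1..n. \<tau> k w) = (\<Sum>k=1..n. \<theta> k w) - x *\<^sub>R x0"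
        by (simp add: \<tau>_def sum_subtractf x_def scaleR_conv_of_real sum_constant_scaleR)
      then show ?thesis using x by (simp add: rp_average_def x_def[symmetric] scaleR_diff_right)
    qed
    have sq: "square_integrable M (\<lambda>w. \<Sum>k=1..n. \<tau> k w)"
      by (intro square_integrable_sum \<tau>_square_integrable) auto
    have i: "integrable M (\<lambda>w. (norm (rp_average \<theta> n w - x0))\<^sup>2)"
      unfolding eq by (rule square_integrableD(2)[OF square_integrable_scaleR[OF sq]])
    have "(\<integral>w. (norm (rp_average \<theta> n w - x0))\<^sup>2 \<partial>M) = (1 / x)\<^sup>2 * m2 (\<lambda>w. \<Sum>k=1..n. \<tau> k w)"
      unfolding eq by (simp add: power_mult_distrib power_divide)
    also have "\<dots> \<le> (1 / x)\<^sup>2 * (x * trace (G ** S x0 ** G) + C * (x powr (3/2 - \<beta>) + x powr \<beta>))"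
      unfolding x_def by (intro mult_left_mono C(2)[OF n]) auto
    also have "\<dots> = trace (G ** S x0 ** G) / x + C * ((1 / x)\<^sup>2 * x powr (3/2 - \<beta>) + (1 / x)\<^sup>2 * x powr \<beta>)"
      using x by (simp add: field_simps power2_eq_square)
    also have "(1 / x)\<^sup>2 = x powr (- 2)"
      using x by (simp add: powr_minus_divide power_divide)
    also have "x powr (- 2) * x powr (3/2 - \<beta>) + x powr (- 2) * x powr \<beta> = x powr (- (\<beta> + 1/2)) + x powr (- (2 - \<beta>))"
    proof -
      have "- 2 + (3/2 - \<beta>) = - (\<beta> + 1/2)" "- 2 + \<beta> = - (2 - \<beta>)" by simp_all
      then show ?thesis by (simp only: powr_add[symmetric])
    qed
    \<comment> \<open>Both powers are bounded by the one with the slower decay, hence the factor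
      2.\<close>
    also have "C * (x powr (- (\<beta> + 1/2)) + x powr (- (2 - \<beta>))) \<le> C * (2 * x powr (- min (\<beta> + 1/2) (2 - \<beta>)))"
    proof (intro mult_left_mono C(1))
      have "x powr (- (\<beta> + 1/2)) \<le> x powr (- min (\<beta> + 1/2) (2 - \<beta>))" "x powr (- (2 - \<beta>)) \<le> x powr (- min (\<beta> + 1/2) (2 - \<beta>))"
        using x by (auto intro!: powr_mono)
      then show "x powr (- (\<beta> + 1/2)) + x powr (- (2 - \<beta>)) \<le> 2 * x powr (- min (\<beta> + 1/2) (2 - \<beta>))" by linarith
    qed
    finally show ?thesis using i by (simp add: x_def mult.assoc)
  qed
  then show ?thesis by blast
qed

end

section \<open>The noise of stochastic gradient descent\<close>

lemma GDERIV_unique: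
  fixes f :: "'a::real_inner \<Rightarrow> real"
  assumes "GDERIV f x :> D" "GDERIV f x :> D'"
  shows "D = D'"
proof -
  have "(\<lambda>h. h \<bullet> D) = (\<lambda>h. h \<bullet> D')"
    using has_derivative_unique[OF assms[unfolded gderiv_def]] .
  then have "(D - D') \<bullet> D = (D - D') \<bullet> D'" by metis
  then have "(D - D') \<bullet> (D - D') = 0" by (simp add: inner_diff_right)
  then show ?thesis by simp
qed

text \<open>As \<open>grad\<close> is a definite description, existence and uniqueness are both
  required; existence is the Riesz representation of the derivative in the standard basis.\<close>

lemma GDERIV_grad:
  fixes f :: "real ^ 'd \<Rightarrow> real"
  assumes "f differentiable at x"
  shows "GDERIV f x :> grad f x"
proof -
  obtain f' where f': "(f has_derivative f') (at x)" using assms by (auto simp: differentiable_def)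
  then have lin: "linear f'" by (rule has_derivative_linear)
  define D where "D = (\<Sum>b\<in>Basis. f' b *\<^sub>R b)"
  have "f' h = h \<bullet> D" for h
  proof -
    have "f' h = f' (\<Sum>b\<in>Basis. (h \<bullet> b) *\<^sub>R b)" by (simp add: euclidean_representation)
    also have "\<dots> = h \<bullet> D" by (simp add: linear_sum[OF lin] linear_cmul[OF lin] D_def inner_sum_right mult.commute)
    finally show ?thesis .
  qed
  then have "f' = (\<lambda>h. h \<bullet> D)" by blast
  then have "GDERIV f x :> D" using f' by (simp add: gderiv_def)
  then show ?thesis unfolding grad_def by (rule theI) (rule GDERIV_unique[OF _ \<open>GDERIV f x :> D\<close>])
qed

lemma measurable_pair_apply:
  assumes "(\<lambda>(x, z). \<Lambda> x z) \<in> borel \<Otimes>\<^sub>M borel \<rightarrow>\<^sub>M borel"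
    and "X \<in> borel_measurable N" "Y \<in> borel_measurable N"
  shows "(\<lambda>w. \<Lambda> (X w) (Y w)) \<in> borel_measurable N"
  using measurable_compose[OF measurable_Pair[OF assms(2,3)] assms(1)] by simp

lemma sgd_measurable:
  fixes \<Lambda> :: "real ^ 'd \<Rightarrow> real ^ 'k \<Rightarrow> real ^ 'd"
  assumes L: "(\<lambda>(x, z). \<Lambda> x z) \<in> borel \<Otimes>\<^sub>M borel \<rightarrow>\<^sub>M borel"
    and "\<And>i. i \<in> {1..n} \<Longrightarrow> Z i \<in> borel_measurable N"
  shows "sgd step \<Lambda> Z \<theta>0 n \<in> borel_measurable N"
  using assms(2)
proof (induction n)
  case 0
  have "sgd step \<Lambda> Z \<theta>0 0 = (\<lambda>_. \<theta>0)" by auto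
  then show ?case by simp
next
  case (Suc n)
  have IH: "sgd step \<Lambda> Z \<theta>0 n \<in> borel_measurable N" using Suc by simp
  have "Z (Suc n) \<in> borel_measurable N" using Suc.prems[of "Suc n"] by simp
  note * = measurable_pair_apply[OF L IH this]
  have "sgd step \<Lambda> Z \<theta>0 (Suc n) =
     (\<lambda>w. sgd step \<Lambda> Z \<theta>0 n w - step (Suc n) *\<^sub>R \<Lambda> (sgd step \<Lambda> Z \<theta>0 n w) (Z (Suc n) w))" by auto
  then show ?case using IH * by simp
qed

lemma space_nat_filt: "space (nat_filt M X n) = space M"
  unfolding nat_filt_def by (rule space_measure_of) auto

lemma nat_filt_generators: "{X k -` A \<inter> space M | k A. k \<in> {1..n} \<and> A \<in> sets borel} \<subseteq> Pow (space M)"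
  by auto

lemma sets_nat_filt_subset:
  assumes "\<And>k. k \<in> {1..n} \<Longrightarrow> X k \<in> borel_measurable N" and "space N = space M"
  shows "sets (nat_filt M X n) \<subseteq> sets N"
proof -
  have "sigma_sets (space M) {X k -` A \<inter> space M | k A. k \<in> {1..n} \<and> A \<in> sets borel} \<subseteq> sets N"
    unfolding assms(2)[symmetric]
    by (rule sets.sigma_sets_subset) (use measurable_sets[OF assms(1)] in blast)
  then show ?thesis unfolding nat_filt_def by (simp only: sets_measure_of[OF nat_filt_generators])
qed

lemma nat_filt_measurable:
  assumes "k \<in> {1..n}"
  shows "X k \<in> borel_measurable (nat_filt M X n)"
proof (rule measurableI)
  fix A :: "'b set" assume "A \<in> sets borel"
  then have "X k -` A \<inter> space M \<in> {X k -` A \<inter> space M | k A. k \<in> {1..n} \<and> A \<in> sets borel}" using assms by blast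
  then show "X k -` A \<inter> space (nat_filt M X n) \<in> sets (nat_filt M X n)"
    unfolding space_nat_filt unfolding nat_filt_def
    by (simp only: sets_measure_of[OF nat_filt_generators]) (rule sigma_sets.Basic)
qed simp

lemma nat_filt_subalgebra:
  assumes "\<And>k. X k \<in> borel_measurable M"
  shows "subalgebra M (nat_filt M X n)"
  unfolding subalgebra_def using sets_nat_filt_subset[of n X M M] assms by (simp add: space_nat_filt)

lemma nat_filt_mono:
  assumes "m \<le> n"
  shows "subalgebra (nat_filt M X n) (nat_filt M X m)"
  unfolding subalgebra_def using sets_nat_filt_subset[of m X "nat_filt M X n" M] assms nat_filt_measurable[of _ n X M]
  by (simp add: space_nat_filt)

context prob_space
begin

text \<open>The iterates up to time \<open>n\<close> are functions of \<open>Z 1\<close>, ...,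
  \<open>Z n\<close>, so their sigma-algebra lies in the one generated by this block, which is
  independent of the block consisting of \<open>Z (Suc n)\<close> alone.\<close>

lemma indep_nat_filt_sgd:
  fixes \<Lambda> :: "real ^ 'd \<Rightarrow> real ^ 'k \<Rightarrow> real ^ 'd" and Z :: "nat \<Rightarrow> 'a \<Rightarrow> real ^ 'k"
  assumes L: "(\<lambda>(x, z). \<Lambda> x z) \<in> borel \<Otimes>\<^sub>M borel \<rightarrow>\<^sub>M borel"
    and Z: "indep_vars (\<lambda>_. borel) Z {1..}"
  shows "indep_set (sets (nat_filt M (sgd step \<Lambda> Z \<theta>0) n)) {Z (Suc n) -` A \<inter> space M |A. A \<in> sets borel}"
proof -
  let ?\<theta> = "sgd step \<Lambda> Z \<theta>0"
  let ?F = "nat_filt M ?\<theta> n"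
  let ?P = "PiM {1..n} (\<lambda>_. borel) :: (nat \<Rightarrow> real ^ 'k) measure"
  define W where "W w = restrict (\<lambda>i. Z i w) {1..n}" for w
  have Zm: "Z i \<in> borel_measurable M" if "i \<ge> 1" for i using Z that by (auto simp: indep_vars_def)
  have \<theta>m: "?\<theta> k \<in> borel_measurable M" for k by (rule sgd_measurable[OF L]) (use Zm in auto)
  let ?P' = "PiM {Suc n} (\<lambda>_. borel) :: (nat \<Rightarrow> real ^ 'k) measure"
  define W' where "W' w = restrict (\<lambda>i. Z i w) {Suc n}" for w
  have indW: "indep_var ?P W ?P' W'"
    unfolding W_def[abs_def] W'_def[abs_def] by (rule indep_var_restrict[OF Z]) auto
  have WM: "W \<in> measurable M ?P" using indW by (simp add: indep_var_eq)
  \<comment> \<open>The sigma-algebra on \<open>space M\<close> pulled back along \<open>W\<close>: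
    being measurable for it amounts to depending only on the block.\<close>
  define N where "N = vimage_algebra (space M) W ?P"
  have spN: "space N = space M" by (simp add: N_def)
  have WN: "W \<in> measurable N ?P"
    unfolding N_def using measurable_space[OF WM] by (intro measurable_vimage_algebra1) auto
  have ZN: "Z i \<in> borel_measurable N" if i: "i \<in> {1..n}" for i
  proof -
    have "(\<lambda>w. W w i) \<in> borel_measurable N"
      by (rule measurable_compose[OF WN measurable_component_singleton[OF i]])
    then show ?thesis using i by (simp add: W_def)
  qed
  have "sets ?F \<subseteq> sets N"
    by (rule sets_nat_filt_subset[OF _ spN], rule sgd_measurable[OF L]) (use ZN in auto)
  then have FN: "sets ?F \<subseteq> sigma_sets (space M) {W -` A \<inter> space M |A. A \<in> sets ?P}"
    by (simp add: N_def sets_vimage_algebra)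
  have ZW: "{Z (Suc n) -` A \<inter> space M |A. A \<in> sets borel}
      \<subseteq> sigma_sets (space M) {W' -` A \<inter> space M |A. A \<in> sets ?P'}"
  proof clarify
    fix A :: "(real ^ 'k) set" assume "A \<in> sets borel"
    then have "(\<lambda>x. x (Suc n)) -` A \<inter> space ?P' \<in> sets ?P'"
      by (intro measurable_sets[OF measurable_component_singleton]) auto
    moreover have "Z (Suc n) -` A \<inter> space M = W' -` ((\<lambda>x. x (Suc n)) -` A \<inter> space ?P') \<inter> space M"
      by (auto simp: W'_def space_PiM)
    ultimately show "Z (Suc n) -` A \<inter> space M \<in> sigma_sets (space M) {W' -` A \<inter> space M |A. A \<in> sets ?P'}"
      by (intro sigma_sets.Basic) blast
  qed
  have "indep_set (sigma_sets (space M) {W -` A \<inter> space M |A. A \<in> sets ?P})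
      (sigma_sets (space M) {W' -` A \<inter> space M |A. A \<in> sets ?P'})"
    using indW by (simp add: indep_var_eq)
  then show ?thesis unfolding indep_sets2_eq using FN ZW by blast
qed

text \<open>The freezing lemma. The past is represented by the point \<open>w\<close> itself:
  \<open>distr M F (\<lambda>w. w)\<close> is \<open>M\<close> restricted to \<open>F\<close>,
  independence makes the joint law of \<open>w\<close> and \<open>Y w\<close> a product measure, and
  Fubini's theorem applies.\<close>

lemma indep_integral_zero:
  fixes h :: "'a \<times> 'b::topological_space \<Rightarrow> real"
  assumes ind: "indep_set (sets F) {Y -` A \<inter> space M |A. A \<in> sets borel}"
    and sub: "subalgebra M F" and Y: "Y \<in> borel_measurable M"
    and h: "h \<in> borel_measurable (F \<Otimes>\<^sub>M borel)"
    and i: "integrable M (\<lambda>w. h (w, Y w))"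
    and z: "\<And>w. (\<integral>y. h (w, y) \<partial>distr M borel Y) = 0"
  shows "(\<integral>w. h (w, Y w) \<partial>M) = 0"
proof -
  let ?P = "distr M F (\<lambda>w. w)" and ?Q = "distr M borel Y"
  have m: "(\<lambda>w. w) \<in> measurable M F" "Y \<in> measurable M borel"
    using measurable_from_subalg[OF sub measurable_ident[of F, unfolded id_def]] Y by blast+
  have pm: "(\<lambda>w. (w, Y w)) \<in> measurable M (F \<Otimes>\<^sub>M borel)" using m by (rule measurable_Pair)
  interpret P: prob_space ?P by (rule prob_space_distr[OF m(1)])
  interpret Q: prob_space ?Q by (rule prob_space_distr[OF m(2)])
  interpret PQ: pair_sigma_finite ?P ?Q by unfold_locales
  have eq: "?P \<Otimes>\<^sub>M ?Q = distr M (F \<Otimes>\<^sub>M borel) (\<lambda>w. (w, Y w))"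
  proof (rule pair_measure_eqI)
    show "sets (?P \<Otimes>\<^sub>M ?Q) = sets (distr M (F \<Otimes>\<^sub>M borel) (\<lambda>w. (w, Y w)))"
      by (simp cong: sets_pair_measure_cong)
    fix A B assume "A \<in> sets ?P" "B \<in> sets ?Q"
    then have A: "A \<in> sets F" and B: "B \<in> sets borel" by simp_all
    have AM: "A \<in> sets M" "A \<inter> space M = A"
      using A sub sets.sets_into_space[OF A] by (auto simp: subalgebra_def)
    have BM: "Y -` B \<inter> space M \<in> sets M" by (rule measurable_sets[OF m(2) B])
    have "prob (A \<inter> (Y -` B \<inter> space M)) = prob A * prob (Y -` B \<inter> space M)"
      using indep_setD[OF ind A] B by blast
    moreover have "(\<lambda>w. (w, Y w)) -` (A \<times> B) \<inter> space M = A \<inter> (Y -` B \<inter> space M)"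
      using AM(2) by auto
    ultimately show "emeasure ?P A * emeasure ?Q B = emeasure (distr M (F \<Otimes>\<^sub>M borel) (\<lambda>w. (w, Y w))) (A \<times> B)"
      using A B AM BM by (simp add: emeasure_distr[OF m(1)] emeasure_distr[OF m(2)] emeasure_distr[OF pm]
          emeasure_eq_measure ennreal_mult[symmetric])
  qed unfold_locales
  have "integrable (?P \<Otimes>\<^sub>M ?Q) h"
    unfolding eq integrable_distr_eq[OF pm h] by (rule i)
  from PQ.integral_fst'[OF this] have "(\<integral>w. h w \<partial>(?P \<Otimes>\<^sub>M ?Q)) = 0" by (simp add: z)
  then show ?thesis unfolding eq integral_distr[OF pm h] .
qed

text \<open>Once the past is frozen the iterate is a fixed point \<open>x\<close>, and the mean of
  \<open>\<Lambda> x\<close> under the law of \<open>Z (Suc n)\<close>, which is that of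
  \<open>Z 1\<close>, equals \<open>grad f x\<close>.\<close>

lemma sgd_noise_orthogonal:
  fixes \<Lambda> :: "real ^ 'd \<Rightarrow> real ^ 'k \<Rightarrow> real ^ 'd" and Z :: "nat \<Rightarrow> 'a \<Rightarrow> real ^ 'k"
  assumes L: "(\<lambda>(x, z). \<Lambda> x z) \<in> borel \<Otimes>\<^sub>M borel \<rightarrow>\<^sub>M borel"
    and Z: "iid M Z {1..}"
    and int: "\<And>x. integrable M (\<lambda>w. \<Lambda> x (Z 1 w))"
    and mean: "\<And>x. grad f x = (\<integral>w. \<Lambda> x (Z 1 w) \<partial>M)"
    and grad_m: "grad f \<in> borel_measurable borel"
    and \<theta>_m: "sgd step \<Lambda> Z \<theta>0 n \<in> borel_measurable (nat_filt M (sgd step \<Lambda> Z \<theta>0) n)"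
    and U: "U \<in> borel_measurable (nat_filt M (sgd step \<Lambda> Z \<theta>0) n)"
    and i: "integrable M (\<lambda>w. U w * mart_incr f \<Lambda> Z (sgd step \<Lambda> Z \<theta>0) (Suc n) w $ i)"
  shows "(\<integral>w. U w * mart_incr f \<Lambda> Z (sgd step \<Lambda> Z \<theta>0) (Suc n) w $ i \<partial>M) = 0"
proof -
  let ?\<theta> = "sgd step \<Lambda> Z \<theta>0"
  let ?F = "nat_filt M ?\<theta> n"
  have Zind: "indep_vars (\<lambda>_. borel) Z {1..}" using Z by (simp add: iid_def)
  have Zm: "Z i \<in> borel_measurable M" if "i \<ge> 1" for i using Zind that by (auto simp: indep_vars_def)
  have sub: "subalgebra M ?F" by (rule nat_filt_subalgebra, rule sgd_measurable[OF L]) (use Zm in auto)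
  define h where "h = (\<lambda>(w, z). U w * (grad f (?\<theta> n w) - \<Lambda> (?\<theta> n w) z) $ i)"
  have hm: "h \<in> borel_measurable (?F \<Otimes>\<^sub>M borel)"
  proof -
    have 1: "(\<lambda>w. ?\<theta> n (fst w)) \<in> borel_measurable (?F \<Otimes>\<^sub>M borel)"
      by (rule measurable_compose[OF measurable_fst \<theta>_m])
    have 2: "(\<lambda>w. U (fst w)) \<in> borel_measurable (?F \<Otimes>\<^sub>M borel)"
      by (rule measurable_compose[OF measurable_fst U])
    have 3: "(\<lambda>w. grad f (?\<theta> n (fst w))) \<in> borel_measurable (?F \<Otimes>\<^sub>M borel)"
      by (rule measurable_compose[OF 1 grad_m])
    have 4: "(\<lambda>w. \<Lambda> (?\<theta> n (fst w)) (snd w)) \<in> borel_measurable (?F \<Otimes>\<^sub>M borel)"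
      by (rule measurable_pair_apply[OF L 1 measurable_snd])
    have 5: "(\<lambda>w. (grad f (?\<theta> n (fst w)) - \<Lambda> (?\<theta> n (fst w)) (snd w)) $ i) \<in> borel_measurable (?F \<Otimes>\<^sub>M borel)"
      by (rule borel_measurable_vec_nth[OF borel_measurable_diff[OF 3 4]])
    show ?thesis unfolding h_def split_beta using borel_measurable_times[OF 2 5] by simp
  qed
  have inner: "(\<integral>y. h (w, y) \<partial>distr M borel (Z (Suc n))) = 0" for w
  proof -
    define x where "x = ?\<theta> n w"
    have Lx: "(\<lambda>z. \<Lambda> x z) \<in> borel_measurable borel" by (rule measurable_pair_apply[OF L]) auto
    have same: "distr M borel (Z (Suc n)) = distr M borel (Z 1)" using Z by (auto simp: iid_def)
    have "(\<integral>y. h (w, y) \<partial>distr M borel (Z (Suc n))) = (\<integral>w'. U w * (grad f x - \<Lambda> x (Z 1 w')) $ i \<partial>M)"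
      unfolding same h_def x_def[symmetric] prod.case
      by (rule integral_distr) (use Zm Lx in \<open>auto intro!: borel_measurable_times borel_measurable_vec_nth\<close>)
    also have "\<dots> = U w * (\<integral>w'. grad f x - \<Lambda> x (Z 1 w') \<partial>M) $ i"
      using int[of x] integral_bounded_linear[OF bounded_linear_vec_nth, of M "\<lambda>w'. grad f x - \<Lambda> x (Z 1 w')" i] by simp
    also have "(\<integral>w'. grad f x - \<Lambda> x (Z 1 w') \<partial>M) = 0"
      using int[of x] mean[of x] prob_space by simp
    finally show ?thesis by simp
  qed
  have eq: "U w * mart_incr f \<Lambda> Z ?\<theta> (Suc n) w $ i = h (w, Z (Suc n) w)" for w
    by (simp add: h_def mart_incr_def)
  show ?thesis unfolding eq
    by (rule indep_integral_zero[OF indep_nat_filt_sgd[OF L Zind] sub _ hm i[unfolded eq] inner]) (simp add: Zm)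
qed

end

section \<open>From conditional exponential moments to polynomial moments\<close>

lemma (in sigma_finite_subalgebra) cond_moment_bound:
  fixes X :: "'a \<Rightarrow> 'b::euclidean_space" and U :: "'a \<Rightarrow> real"
  assumes X [measurable]: "X \<in> borel_measurable M"
    and cond: "AE w in M. nn_cond_exp M F (\<lambda>w. ennreal (w' (norm (X w)))) w \<le> ennreal c"
    and w' [measurable]: "w' \<in> borel_measurable borel" and c: "c \<ge> 0"
    and le: "\<And>x. x \<ge> 0 \<Longrightarrow> x ^ p \<le> a + b * w' x" and ab: "a \<ge> 0" "b \<ge> 0" and w'0: "\<And>x. w' x \<ge> 0"
    and U: "U \<in> borel_measurable F" "\<And>w. U w \<ge> 0" "integrable M U"
  shows "integrable M (\<lambda>w. U w * norm (X w) ^ p) \<and>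
     (\<integral>w. U w * norm (X w) ^ p \<partial>M) \<le> (a + b * c) * (\<integral>w. U w \<partial>M)"
proof -
  have [measurable]: "U \<in> borel_measurable M" using U(3) by simp
  have U': "(\<lambda>w. ennreal (U w)) \<in> borel_measurable F" using U(1) by simp
  let ?E = "\<lambda>w. ennreal (w' (norm (X w)))"
  have "(\<integral>\<^sup>+w. ennreal (U w * norm (X w) ^ p) \<partial>M) \<le> (\<integral>\<^sup>+w. ennreal a * ennreal (U w) + ennreal b * (ennreal (U w) * ?E w) \<partial>M)"
  proof (rule nn_integral_mono)
    fix w
    have "U w * norm (X w) ^ p \<le> U w * (a + b * w' (norm (X w)))" using le U(2) by (intro mult_left_mono) auto
    then have "ennreal (U w * norm (X w) ^ p) \<le> ennreal (a * U w + b * (U w * w' (norm (X w))))"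
      by (intro ennreal_leI) (simp add: algebra_simps)
    also have "\<dots> = ennreal a * ennreal (U w) + ennreal b * (ennreal (U w) * ?E w)"
      using ab U(2) w'0 by (simp add: ennreal_mult ennreal_plus)
    finally show "ennreal (U w * norm (X w) ^ p) \<le> ennreal a * ennreal (U w) + ennreal b * (ennreal (U w) * ?E w)" .
  qed
  also have "\<dots> = ennreal a * (\<integral>\<^sup>+w. ennreal (U w) \<partial>M) + ennreal b * (\<integral>\<^sup>+w. ennreal (U w) * ?E w \<partial>M)"
    by (subst nn_integral_add) (simp_all add: nn_integral_cmult)
  \<comment> \<open>The defining property of \<open>nn_cond_exp\<close>. Working with extended
    nonnegative integrals, integrability need not be known beforehand but comes out of the
    bound.\<close>
  also have "(\<integral>\<^sup>+w. ennreal (U w) * ?E w \<partial>M) = (\<integral>\<^sup>+w. ennreal (U w) * nn_cond_exp M F ?E w \<partial>M)"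
    by (rule nn_cond_exp_intg[symmetric, OF U']) simp
  also have "\<dots> \<le> (\<integral>\<^sup>+w. ennreal (U w) * ennreal c \<partial>M)"
    using cond by (intro nn_integral_mono_AE) (auto intro!: mult_left_mono)
  also have "\<dots> = ennreal c * (\<integral>\<^sup>+w. ennreal (U w) \<partial>M)"
    by (simp only: mult.commute[of _ "ennreal c"]) (rule nn_integral_cmult, simp)
  also have "(\<integral>\<^sup>+w. ennreal (U w) \<partial>M) = ennreal (\<integral>w. U w \<partial>M)"
    by (rule nn_integral_eq_integral[OF U(3)]) (use U(2) in auto)
  finally have *: "(\<integral>\<^sup>+w. ennreal (U w * norm (X w) ^ p) \<partial>M)
      \<le> ennreal a * ennreal (\<integral>w. U w \<partial>M) + ennreal b * (ennreal c * ennreal (\<integral>w. U w \<partial>M))"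
    by (simp add: mult_left_mono)
  also have "\<dots> = ennreal ((a + b * c) * (\<integral>w. U w \<partial>M))"
  proof -
    have "(\<integral>w. U w \<partial>M) \<ge> 0" using U(2) by (intro Bochner_Integration.integral_nonneg)
    then show ?thesis using ab c by (simp add: ennreal_mult[symmetric] ennreal_plus[symmetric] algebra_simps del: ennreal_plus)
  qed
  finally have fin: "(\<integral>\<^sup>+w. ennreal (U w * norm (X w) ^ p) \<partial>M) \<le> ennreal ((a + b * c) * (\<integral>w. U w \<partial>M))" .
  have nn: "U w * norm (X w) ^ p \<ge> 0" for w using U(2) by simp
  have i: "integrable M (\<lambda>w. U w * norm (X w) ^ p)"
    unfolding integrable_iff_bounded using fin nn by (auto simp: le_less_trans)
  moreover have "ennreal (\<integral>w. U w * norm (X w) ^ p \<partial>M) \<le> ennreal ((a + b * c) * (\<integral>w. U w \<partial>M))"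
    using fin nn_integral_eq_integral[OF i] nn by simp
  moreover have "0 \<le> (a + b * c) * (\<integral>w. U w \<partial>M)"
    using ab c U(2) by (intro mult_nonneg_nonneg add_nonneg_nonneg Bochner_Integration.integral_nonneg)
  ultimately show ?thesis by (simp add: ennreal_le_iff)
qed

lemma power_le_six_exp:
  fixes x :: real
  assumes x: "x \<ge> 0" and p: "p \<le> 6"
  shows "x ^ p \<le> 1 + 1 * (x ^ 6 * exp (phi r (u * x\<^sup>2)))"
proof -
  have "x ^ p \<le> 1 + x ^ 6 * 1" using power_le_one_plus_power[OF x p] by simp
  also have "\<dots> \<le> 1 + x ^ 6 * exp (phi r (u * x\<^sup>2))"
    using x by (intro add_left_mono mult_left_mono) (auto simp: phi_def)
  finally show ?thesis by simp
qed

text \<open>For \<open>r < 1/2\<close> the value \<open>phi r (x^2)\<close> is at least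
  \<open>x powr s\<close> with \<open>s > 0\<close>, so the exponential dominates every power of
  \<open>x\<close>; the constant comes from \<open>y ^ m \<le> real m ^ m * exp y\<close>.\<close>

lemma power_le_stretched_exp:
  assumes r: "r < 1/2"
  shows "\<exists>b\<ge>0. \<forall>x\<ge>0. x ^ p \<le> 1 + b * (x ^ 6 * exp (phi r (1 * x\<^sup>2)))"
proof -
  define s where "s = 2 * (1 - 2 * r)"
  have s: "s > 0" using r by (simp add: s_def)
  obtain m0 where m0: "real p < real m0 * s" using reals_Archimedean3[OF s] by blast
  \<comment> \<open>The successor makes \<open>m\<close> positive, so that \<open>y / real m\<close>
    below is a genuine quotient.\<close>
  define m where "m = Suc m0"
  have m: "real p \<le> real m * s" "m \<ge> 1" using m0 s by (auto simp: m_def algebra_simps)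
  have "x ^ p \<le> 1 + real m ^ m * (x ^ 6 * exp (phi r (1 * x\<^sup>2)))" if x: "x \<ge> 0" for x
  proof (cases "x \<le> 1")
    case True
    have "x ^ p \<le> 1" using x True by (rule power_le_one)
    moreover have "0 \<le> real m ^ m * (x ^ 6 * exp (phi r (1 * x\<^sup>2)))" using x by simp
    ultimately show ?thesis by linarith
  next
    case False
    define y where "y = x powr s"
    have "s = 4 * ((1 - 2 * r) / 2)" by (simp add: s_def field_simps)
    then have "y = (x powr 4) powr ((1 - 2 * r) / 2)" by (simp only: y_def powr_powr)
    also have "\<dots> = (x ^ 4) powr ((1 - 2 * r) / 2)" using False by simp
    also have "\<dots> \<le> phi r (1 * x\<^sup>2)"
      unfolding phi_def using r False by (intro powr_mono2) auto
    finally have y: "y \<le> phi r (1 * x\<^sup>2)" .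
    have y0: "y \<ge> 0" by (simp add: y_def)
    have "x ^ p = x powr real p" using False by (simp add: powr_realpow)
    also have "\<dots> \<le> x powr (real m * s)" using False m by (intro powr_mono) auto
    also have "\<dots> = y ^ m" using False by (simp add: y_def powr_power mult.commute)
    also have "\<dots> = real m ^ m * (y / real m) ^ m" using m by (simp add: power_divide)
    also have "\<dots> \<le> real m ^ m * exp (y / real m) ^ m"
    proof (intro mult_left_mono power_mono)
      show "y / real m \<le> exp (y / real m)" using exp_ge_add_one_self[of "y / real m"] by linarith
    qed (use y0 in auto)
    also have "exp (y / real m) ^ m = exp y" using m by (simp add: exp_of_nat_mult[symmetric])
    also have "exp y \<le> x ^ 6 * exp (phi r (1 * x\<^sup>2))"
    proof -
      have "1 * exp y \<le> x ^ 6 * exp (phi r (1 * x\<^sup>2))" using y False by (intro mult_mono) (auto simp: one_le_power)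
      then show ?thesis by simp
    qed
    finally show ?thesis by (simp add: mult_left_mono)
  qed
  then show ?thesis by (intro exI[of _ "real m ^ m"]) auto
qed

text \<open>Integrability is part of the conclusion because the Bochner integral of a function that
  is not integrable is 0, so that the inequality alone would say little.\<close>

theorem corollary1p2:
  fixes M :: "'w measure"
    and f :: "real ^ 'd \<Rightarrow> real"
    and \<Lambda> :: "real ^ 'd \<Rightarrow> real ^ 'k \<Rightarrow> real ^ 'd"
    and Z :: "nat \<Rightarrow> 'w \<Rightarrow> real ^ 'k"
    and \<theta>star \<theta>0 :: "real ^ 'd"
    and \<gamma> \<beta> r :: real
    and S :: "real ^ 'd \<Rightarrow> real ^ 'd ^ 'd"
    and \<rho>2 :: "real \<Rightarrow> real"
    and \<theta> \<Delta>M :: "nat \<Rightarrow> 'w \<Rightarrow> real ^ 'd"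
    and F :: "nat \<Rightarrow> 'w measure"
  defines "\<theta> \<equiv> sgd (\<lambda>n. \<gamma> * real n powr (- \<beta>)) \<Lambda> Z \<theta>0"
    and "\<Delta>M \<equiv> mart_incr f \<Lambda> Z \<theta>"
    and "F \<equiv> nat_filt M \<theta>"
  assumes prob: "prob_space M"
    and f_C2: "C2 f"
    and f_coercive: "filterlim f at_top at_infinity"
    and f_crit: "{x. grad f x = 0} = {\<theta>star}"
    and f_min: "f \<theta>star = 0"
    and \<Lambda>_meas: "(\<lambda>(x, z). \<Lambda> x z) \<in> borel \<Otimes>\<^sub>M borel \<rightarrow>\<^sub>M borel"
    and Z_iid: "iid M Z {1..}"
    and \<Lambda>_int: "\<And>x. integrable M (\<lambda>\<omega>. \<Lambda> x (Z 1 \<omega>))"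
    and \<Lambda>_mean: "\<And>x. grad f x = (\<integral>\<omega>. \<Lambda> x (Z 1 \<omega>) \<partial>M)"
    and \<gamma>: "\<gamma> > 0" and \<beta>: "\<beta> \<in> {1/2<..<1}" and r: "r \<in> {0..1/2}"
    and S_lip: "\<exists>L. L-lipschitz_on UNIV S"
    and S_cov: "\<And>n. AE \<omega> in M.
          mat_cond_exp M (F n) (\<lambda>w. outer_prod (\<Delta>M (n + 1) w) (\<Delta>M (n + 1) w)) \<omega> = S (\<theta> n \<omega>)"
    and H_bdd: "bounded (range (hessian f))"
    and H_lip: "\<exists>L. L-lipschitz_on UNIV (hessian f)"
    and H_inv: "invertible (hessian f \<theta>star)"
    and grad_liminf: "Liminf at_infinity (\<lambda>x. ereal (f x powr (- r) * norm (grad f x))) > 0"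
    and grad_limsup: "Limsup at_infinity (\<lambda>x. ereal (f x powr (- r) * norm (grad f x))) < \<infinity>"
    and \<rho>2_nonneg: "\<And>u. u \<ge> 0 \<Longrightarrow> \<rho>2 u \<ge> 0"
    and \<rho>2_bdd: "\<And>K. compact K \<Longrightarrow> K \<subseteq> {0..} \<Longrightarrow> bounded (\<rho>2 ` K)"
    and moment: "\<And>u n. u \<ge> 0 \<Longrightarrow> AE \<omega> in M.
          nn_cond_exp M (F n)
            (\<lambda>w. ennreal (norm (\<Delta>M (n + 1) w) ^ 6 * exp (phi r (u * (norm (\<Delta>M (n + 1) w))\<^sup>2)))) \<omega>
          \<le> ennreal (\<rho>2 u)"
  shows "\<exists>C::real. \<forall>n::nat. n \<ge> 1 \<longrightarrow>
          integrable M (\<lambda>\<omega>. (norm (rp_average \<theta> n \<omega> - \<theta>star))\<^sup>2) \<and>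
          (\<integral>\<omega>. (norm (rp_average \<theta> n \<omega> - \<theta>star))\<^sup>2 \<partial>M)
            \<le> trace (matrix_inv (hessian f \<theta>star) ** S \<theta>star ** matrix_inv (hessian f \<theta>star)) / real n
              + C * real n powr (- min (\<beta> + 1/2) (2 - \<beta>))"
proof -
  interpret prob_space M by (rule prob)
  obtain K0 where K0: "\<And>x. norm (hessian f x) \<le> K0" using H_bdd by (auto simp: bounded_iff)
  obtain L0 where L0: "L0-lipschitz_on UNIV (hessian f)" using H_lip by blast
  \<comment> \<open>The maxima with 1 make both constants positive.\<close>
  define K where "K = max K0 1"
  define L where "L = max L0 1"
  interpret smooth_potential f \<theta>star K L
  proof
    show "GDERIV f x :> grad f x" for x using f_C2 by (intro GDERIV_grad) (simp add: C2_def)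
    show "(grad f has_derivative (*v) (hessian f x)) (at x)" for x
      using f_C2 jacobian_works[of "grad f" "at x"] by (simp add: C2_def hessian_def)
    show "K > 0" "L > 0" by (auto simp: K_def L_def)
    show "norm (hessian f x) \<le> K" for x using K0[of x] by (simp add: K_def)
    show "norm (hessian f x - hessian f y) \<le> L * norm (x - y)" for x y
    proof -
      have "norm (hessian f x - hessian f y) \<le> L0 * norm (x - y)"
        using lipschitz_onD[OF L0, of x y] by (simp add: dist_norm)
      also have "\<dots> \<le> L * norm (x - y)" by (intro mult_right_mono) (auto simp: L_def)
      finally show ?thesis .
    qed
    show "grad f x = 0 \<longleftrightarrow> x = \<theta>star" for x using f_crit by auto
  qed (fact f_coercive f_min H_inv)+
  have grad_m: "grad f \<in> borel_measurable borel"
    using grad_cont by (rule borel_measurable_continuous_onI)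
  have Zm: "Z i \<in> borel_measurable M" if "i \<ge> 1" for i
    using Z_iid that by (auto simp: iid_def indep_vars_def)
  have \<theta>m: "\<theta> n \<in> borel_measurable M" for n
    unfolding \<theta>_def by (rule sgd_measurable[OF \<Lambda>_meas]) (use Zm in auto)
  \<comment> \<open>The generators of the filtration start at index 1, so \<open>F 0\<close> is
    trivial; \<open>\<theta> 0\<close> is measurable for it because it is constant.\<close>
  have \<theta>_ad: "\<theta> n \<in> borel_measurable (F n)" for n
  proof (cases n)
    case 0
    have "\<theta> 0 = (\<lambda>_. \<theta>0)" by (auto simp: \<theta>_def)
    then show ?thesis using 0 by simp
  next
    case (Suc m)
    then show ?thesis unfolding F_def by (intro nat_filt_measurable) auto
  qed
  have F_sub: "subalgebra M (F n)" for n unfolding F_def by (rule nat_filt_subalgebra[OF \<theta>m])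
  have F_mono: "subalgebra (F n) (F m)" if "m \<le> n" for m n unfolding F_def by (rule nat_filt_mono[OF that])
  have step: "\<theta> (Suc n) w = \<theta> n w - (\<gamma> * real (Suc n) powr (- \<beta>)) *\<^sub>R (grad f (\<theta> n w) - \<Delta>M (Suc n) w)" for n w
    by (simp add: \<Delta>M_def mart_incr_def) (simp add: \<theta>_def)
  \<comment> \<open>The filtration is generated by the iterates and not by the \<open>Z n\<close>,
    so the noise is recovered from two consecutive iterates, dividing by the nonzero step.\<close>
  have D_ad: "\<Delta>M (Suc n) \<in> borel_measurable (F (Suc n))" for n
  proof -
    define g where "g = \<gamma> * real (Suc n) powr (- \<beta>)"
    have g: "g \<noteq> 0" using \<gamma> by (simp add: g_def)
    have "\<Delta>M (Suc n) w = grad f (\<theta> n w) + (1 / g) *\<^sub>R (\<theta> (Suc n) w - \<theta> n w)" for w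
      unfolding step[of n w, folded g_def] using g by simp
    then have eq: "\<Delta>M (Suc n) = (\<lambda>w. grad f (\<theta> n w) + (1 / g) *\<^sub>R (\<theta> (Suc n) w - \<theta> n w))" by blast
    have 1: "\<theta> n \<in> borel_measurable (F (Suc n))"
      using measurable_from_subalg[OF F_mono \<theta>_ad, of n "Suc n"] by simp
    show ?thesis unfolding eq
      using 1 \<theta>_ad[of "Suc n"] measurable_compose[OF 1 grad_m] by measurable
  qed
  interpret noisy_descent M f \<theta>star K L \<theta> \<Delta>M F \<gamma> \<beta>
  proof
    show "\<theta> 0 w = \<theta> 0 w'" for w w' by (simp add: \<theta>_def)
    show "(\<integral>w. U w * \<Delta>M (Suc n) w $ i \<partial>M) = 0"
      if "U \<in> borel_measurable (F n)" "integrable M (\<lambda>w. U w * \<Delta>M (Suc n) w $ i)" for n U i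
      using that sgd_noise_orthogonal[OF \<Lambda>_meas Z_iid \<Lambda>_int \<Lambda>_mean grad_m] \<theta>_ad
      unfolding F_def \<Delta>M_def \<theta>_def by blast
  qed (use \<gamma> \<beta> F_sub F_mono \<theta>_ad D_ad step in auto)
  have sfs: "sigma_finite_subalgebra M (F n)" for n
  proof -
    interpret finite_measure_subalgebra M "F n" by unfold_locales (rule F_sub)
    show ?thesis by unfold_locales
  qed
  \<comment> \<open>The moment hypothesis is converted once for every power dominated by the sixth
    power times the exponential; it is then used with \<open>u = 0\<close> up to order six, and with
    \<open>u = 1\<close> for all orders if \<open>r < 1/2\<close>.\<close>
  have bm: "bounded_moment p" if u: "u \<ge> 0" and b: "b \<ge> 0"
      and le: "\<And>x. x \<ge> 0 \<Longrightarrow> x ^ p \<le> 1 + b * (x ^ 6 * exp (phi r (u * x\<^sup>2)))" for p u b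
    unfolding bounded_moment_def
  proof (intro exI[of _ "1 + b * \<rho>2 u"] conjI allI impI)
    show "1 + b * \<rho>2 u > 0" using \<rho>2_nonneg[OF u] b by (simp add: add_pos_nonneg)
    fix n and U :: "'w \<Rightarrow> real"
    assume U: "U \<in> borel_measurable (F n)" "\<forall>w. U w \<ge> 0" "integrable M U"
    interpret sigma_finite_subalgebra M "F n" by (rule sfs)
    have [measurable]: "(\<lambda>x. x ^ 6 * exp (phi r (u * x\<^sup>2))) \<in> borel_measurable borel"
      unfolding phi_def by measurable
    have c: "AE w in M. nn_cond_exp M (F n)
        (\<lambda>w. ennreal (norm (\<Delta>M (Suc n) w) ^ 6 * exp (phi r (u * (norm (\<Delta>M (Suc n) w))\<^sup>2)))) w \<le> ennreal (\<rho>2 u)"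
      using moment[OF u, of n] by simp
    have "integrable M (\<lambda>w. U w * norm (\<Delta>M (Suc n) w) ^ p) \<and>
       (\<integral>w. U w * norm (\<Delta>M (Suc n) w) ^ p \<partial>M) \<le> (1 + b * \<rho>2 u) * (\<integral>w. U w \<partial>M)"
      by (rule cond_moment_bound[where w'="\<lambda>x. x ^ 6 * exp (phi r (u * x\<^sup>2))", OF D_meas c])
         (use U \<rho>2_nonneg[OF u] b le in auto)
    then show "integrable M (\<lambda>w. U w * norm (\<Delta>M (Suc n) w) ^ p)"
      "(\<integral>w. U w * norm (\<Delta>M (Suc n) w) ^ p \<partial>M) \<le> (1 + b * \<rho>2 u) * (\<integral>w. U w \<partial>M)" by auto
  qed
  have bm6: "bounded_moment p" if "p \<le> 6" for p
    by (rule bm[of 0 1]) (use power_le_six_exp[OF _ that, of _ r 0] in auto)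
  obtain c where c: "c > 0" "eventually (\<lambda>x. c < f x powr (- r) * norm (grad f x)) at_infinity"
  proof -
    obtain c where c: "0 < ereal c" "ereal c < Liminf at_infinity (\<lambda>x. ereal (f x powr (- r) * norm (grad f x)))"
      using ereal_dense2[OF grad_liminf] by blast
    then have "eventually (\<lambda>x. ereal c < ereal (f x powr (- r) * norm (grad f x))) at_infinity"
      using le_Liminf_iff[of "Liminf at_infinity (\<lambda>x. ereal (f x powr (- r) * norm (grad f x)))"
          at_infinity "\<lambda>x. ereal (f x powr (- r) * norm (grad f x))"] by blast
    then show ?thesis using c(1) that[of c] by simp
  qed
  have "eventually (\<lambda>x. f x \<ge> 1) at_infinity" using f_coercive by (auto simp: filterlim_at_top)
  then have "eventually (\<lambda>x. f x \<ge> 1 \<and> c < f x powr (- r) * norm (grad f x)) at_infinity"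
    using c(2) by eventually_elim auto
  then obtain b where b: "\<And>x. norm x \<ge> b \<Longrightarrow> f x \<ge> 1 \<and> c < f x powr (- r) * norm (grad f x)"
    by (auto simp: eventually_at_infinity)
  \<comment> \<open>\<open>b\<close> refers to balls around the origin; the shift by
    \<open>norm \<theta>star\<close> passes to balls around the minimiser.\<close>
  define R0 where "R0 = b + norm \<theta>star"
  have far: "f x \<ge> 1" "c * f x powr r \<le> norm (grad f x)" if "norm (x - \<theta>star) > R0" for x
  proof -
    have "norm x \<ge> b" using that norm_triangle_ineq4[of x \<theta>star] by (simp add: R0_def)
    note * = b[OF this]
    then show "f x \<ge> 1" by simp
    then have "f x powr r * f x powr (- r) = 1" by (simp add: powr_minus)
    then have "f x powr r * (f x powr (- r) * norm (grad f x)) = norm (grad f x)"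
      by (simp add: mult.assoc[symmetric])
    moreover have "f x powr r * c \<le> f x powr r * (f x powr (- r) * norm (grad f x))"
      using * by (intro mult_left_mono) auto
    ultimately show "c * f x powr r \<le> norm (grad f x)" by (simp only: mult.commute[of c])
  qed
  have "\<exists>B\<ge>0. \<forall>n. integrable M (\<lambda>w. norm (\<theta> n w - \<theta>star) ^ 4) \<and>
    (\<integral>w. norm (\<theta> n w - \<theta>star) ^ 4 \<partial>M) \<le> B * real (Suc n) powr (- (2 * \<beta>))"
  proof (cases "r = 1/2")
    case True
    have q: "c * sqrt (f x) \<le> norm (grad f x)" if "norm (x - \<theta>star) > R0" for x
      using far[OF that] True by (simp add: powr_half_sqrt)
    obtain c1 where c1: "c1 > 0" "\<And>x. c1 * f x \<le> (norm (grad f x))\<^sup>2"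
      using quadratic_growth(1)[OF c(1) q] by blast
    obtain C1 where C1: "C1 > 0" "\<And>x. (norm (x - \<theta>star))\<^sup>2 \<le> C1 * f x"
      using quadratic_growth(2)[OF c(1) q] by blast
    show ?thesis by (rule fourth_moment_strong[OF bm6 c1 C1]) simp
  next
    case False
    then have r2: "r < 1/2" using r by simp
    have q: "c \<le> norm (grad f x)" if "norm (x - \<theta>star) > R0" for x
    proof -
      \<comment> \<open>As \<open>f \<ge> 1\<close> far out, the bound \<open>c * f x powr r\<close>
        may be weakened to the constant \<open>c\<close>.\<close>
      have "1 \<le> f x powr r" using far(1)[OF that] r by (intro ge_one_powr_ge_zero) auto
      then have "c * 1 \<le> c * f x powr r" using c(1) by (intro mult_left_mono) auto
      then show ?thesis using far(2)[OF that] by simp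
    qed
    obtain c1 where c1: "c1 > 0" "\<And>x. c1 * min (f x) 1 \<le> (norm (grad f x))\<^sup>2"
      using weak_growth(1)[OF c(1) q] by blast
    obtain C1 where C1: "C1 > 0" "\<And>x. norm (x - \<theta>star) ^ 4 \<le> C1 * ((f x)\<^sup>2 + f x ^ 4)"
      using weak_growth(2)[OF c(1) q] by blast
    have "bounded_moment p" for p
    proof -
      obtain b where "b \<ge> 0" "\<And>x. x \<ge> 0 \<Longrightarrow> x ^ p \<le> 1 + b * (x ^ 6 * exp (phi r (1 * x\<^sup>2)))"
        using power_le_stretched_exp[OF r2, of p] by blast
      then show ?thesis by (intro bm[of 1 b]) auto
    qed
    then show ?thesis by (rule fourth_moment_weak[OF _ c1 C1])
  qed
  then obtain B4 where B4: "B4 \<ge> 0" "\<And>n. integrable M (\<lambda>w. norm (\<theta> n w - \<theta>star) ^ 4)"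
    "\<And>n. (\<integral>w. norm (\<theta> n w - \<theta>star) ^ 4 \<partial>M) \<le> B4 * real (Suc n) powr (- (2 * \<beta>))" by blast
  obtain LS where LS: "LS-lipschitz_on UNIV S" using S_lip by blast
  have cov: "(\<integral>w. \<Delta>M (Suc n) w $ i * \<Delta>M (Suc n) w $ j \<partial>M) = (\<integral>w. S (\<theta> n w) $ i $ j \<partial>M)" for n i j
  proof -
    interpret sigma_finite_subalgebra M "F n" by (rule sfs)
    have sq: "square_integrable M (\<Delta>M (Suc n))"
      unfolding square_integrable_def using bounded_moment_D[OF bm6[of 2]] D_meas[of n] by auto
    \<comment> \<open>Integrability of the products comes first, as \<open>real_cond_exp\<close>
      preserves the mean only for integrable functions; the covariance hypothesis is then
      integrated.\<close>
    have i: "integrable M (\<lambda>w. \<Delta>M (Suc n) w $ i * \<Delta>M (Suc n) w $ j)"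
      by (rule square_integrable_component_mult[OF sq sq])
    have "(\<integral>w. \<Delta>M (Suc n) w $ i * \<Delta>M (Suc n) w $ j \<partial>M)
       = (\<integral>w. real_cond_exp M (F n) (\<lambda>w. \<Delta>M (Suc n) w $ i * \<Delta>M (Suc n) w $ j) w \<partial>M)"
      using real_cond_exp_int(2)[OF i] by simp
    also have "\<dots> = (\<integral>w. S (\<theta> n w) $ i $ j \<partial>M)"
    proof (rule integral_cong_AE)
      show "AE w in M. real_cond_exp M (F n) (\<lambda>w. \<Delta>M (Suc n) w $ i * \<Delta>M (Suc n) w $ j) w = S (\<theta> n w) $ i $ j"
        using S_cov[of n] by eventually_elim (auto simp: mat_cond_exp_def outer_prod_def vec_eq_iff)
      have "S \<in> borel_measurable borel"
        using LS by (intro borel_measurable_continuous_onI lipschitz_on_continuous_on)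
      then have "(\<lambda>w. S (\<theta> n w)) \<in> borel_measurable M" by (rule measurable_compose[OF \<theta>m])
      then show "(\<lambda>w. S (\<theta> n w) $ i $ j) \<in> borel_measurable M"
        using measurable_compose[OF _ borel_measurable_continuous_onI[OF continuous_on_component[OF continuous_on_id]]]
        by (intro borel_measurable_vec_nth) blast
    qed simp
    finally show ?thesis .
  qed
  interpret averaged_descent M f \<theta>star K L \<theta> \<Delta>M F \<gamma> \<beta> S LS B4
  proof
    show "LS \<ge> 0" using LS by (rule lipschitz_on_nonneg)
    show "norm (S x - S y) \<le> LS * norm (x - y)" for x y using lipschitz_onD[OF LS, of x y] by (simp add: dist_norm)
    show "bounded_moment 2" by (rule bm6) simp
  qed (use B4 cov in auto)
  show ?thesis using rp_average_bound by blast
qed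

end
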